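(* Let $H$ be a real Hilbert space and let $A_1,A_2,B_1,B_2$, $\alpha$, $g$, $\lambda_0\ge 1$ satisfy the assumptions $\mathrm{(I_1)}$, $\mathrm{(I_2)}$, $\mathrm{(I_3')}$ and $\mathrm{(I_4)}$ listed in the context. Let $u_0\in\mathcal D(A_1)$, $v_0\in\mathcal D(A_2)$, $u_1\in\mathcal D(\sqrt{A_1})$, $v_1\in\mathcal D(\sqrt{A_2})$, and let $(u,v)$ be the classical solution on $[0,\infty)$ of $$u''(t)+A_1u(t)-\int_0^t g(t-s)A_1u(s)\,ds+\alpha u(t)+B_2v(t)=0,$$ $$v''(t)+A_2v(t)+B_1u(t)=0,$$ $$u(0)=u_0,\quad u'(0)=u_1,\quad v(0)=v_0,\quad v'(0)=v_1,$$ with energy $E(t)$ as defined in the context. Then there is a constant $C>0$ (independent of $t$) such that $$E(t)\le C(t+1)^{-\lambda_0}\qquad\text{for all } t\ge 0,$$ and furthermore $$\int_0^{+\infty}(t+1)^{\min\{\lambda_0,\,2(\lambda_0-1)\}}E(t)\,dt\le C.$$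
   Context: Notation: $H$ is a real Hilbert space with inner product $\langle\cdot,\cdot\rangle$ and norm $\|\cdot\|$. For a linear operator $A$ in $H$, $\mathcal D(A)$ is its domain and $[\mathcal D(A)]$ the domain with the graph norm. Convolution: $(h*w)(t)=\int_0^t h(t-s)w(s)\,ds$. The subscript "loc" in $L^p_{loc}(0,+\infty)$ refers to integrability on bounded intervals $(0,T)$. Generalized positive definite kernels: let $h\in L^1_{loc}(0,+\infty)$ and $\varphi\in L^\infty_{loc}(0,+\infty)$ with $\varphi(t)>0$ for $t>0$. $h$ is a $\varphi$-positive definite kernel if $\int_0^t\varphi(s)\langle (h*w)(s),w(s)\rangle ds\ge 0$ for all $t\ge0$ and all $w\in L^2_{loc}(0,+\infty;H)$. $h$ is a strongly $\varphi$-positive definite kernel if there are constants $\delta>0$, $N>0$ such that $h(t)-\delta e^{-Nt}$ is a $\varphi$-positive definite kernel. Assumptions: $\mathrm{(I_1)}$ $A_1,A_2$ are positive self-adjoint linear operators in $H$ with dense domains, and there are constants $a_1,a_2>0$ with $a_1\langle A_1u,u\rangle\ge\|u\|^2$ for $u\in\mathcal D(A_1)$ and $a_2\langle A_2v,v\rangle\ge\|v\|^2$ for $v\in\mathcal D(A_2)$. $\mathrm{(I_2)}$ $B_1,B_2$ are linear operators in $H$ with $\mathcal D(B_1)\supset\mathcal D(\sqrt{A_1})$, $\mathcal D(B_2)\supset\mathcal D(\sqrt{A_2})$, $\langle B_1u,v\rangle=\langle u,B_2v\rangle$ for $u\in\mathcal D(A_1)$, $v\in\mathcal D(A_2)$,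 and there are constants $\beta,\beta_1>0$ such that $\beta\|\sqrt{A_i}w\|\le\|B_iw\|\le\beta_1\|\sqrt{A_i}w\|$ for $w\in\mathcal D(\sqrt{A_i})$, $i=1,2$. $\mathrm{(I_3')}$ $\alpha\ge0$ and $\lambda_0\ge1$ are constants, and $g\in L^1(0,+\infty)$ is a real function satisfying $\int_0^{+\infty}g(t)dt<1$, $\int_0^{+\infty}g(t)dt+a_1(\beta_1^2-\alpha)<1$, $(t+1)^{\lambda_0}g(t)\in L^1(0,+\infty)$, $(t+1)^{\lambda_0}g'(t)\in L^1(0,+\infty)$, and $t\mapsto\int_t^{+\infty}g(s)ds$ is a strongly $(t+1)^{\lambda_0}$-positive definite kernel. $\mathrm{(I_4)}$ There exist a nonnegative functional $P$ on $B_1\mathcal D(A_1)\cup B_2\mathcal D(A_2)$, two bounded linear operators $\Lambda_1,\Lambda_2$ on $H$, and constants $D_1,D_2>0$ such that for $u\in\mathcal D(A_1)$, $v\in\mathcal D(A_2)$, $$|\langle A_1u,B_2v\rangle-\langle B_1u,A_2v\rangle|\le D_1\big(\|B_1u\|\,\|B_2v\|+P(B_1u)P(B_2v)\big),$$ and for $w\in\mathcal D(A_i)$, $i=1,2$, $$P^2(B_iw)\le\langle A_iw,\Lambda_iB_iw\rangle+D_2\|B_iw\|^2,\qquad \langle w,\Lambda_iB_iw\rangle\le D_2\|w\|^2.$$ Classical solution on $[0,\infty)$: a pair $(u,v)$ satisfying the system and initial conditions, with $u\in C^2([0,\infty);H)\cap C^1([0,\infty);[\mathcal D(\sqrt{A_1})])\cap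 C([0,\infty);[\mathcal D(A_1)])$ and $v\in C^2([0,\infty);H)\cap C^1([0,\infty);[\mathcal D(\sqrt{A_2})])\cap C([0,\infty);[\mathcal D(A_2)])$. (Under the assumptions a unique classical solution exists for the given initial data.) Energy: $$E(t)=\tfrac12\|u'(t)\|^2+\tfrac{1-\int_0^{+\infty}g(s)ds}{2}\|\sqrt{A_1}u(t)\|^2+\tfrac12\|v'(t)\|^2+\tfrac12\|\sqrt{A_2}v(t)\|^2+\tfrac{\alpha}{2}\|u(t)\|^2+\langle B_1u(t),v(t)\rangle.$$ *)

theory Defs
  imports "HOL-Analysis.Analysis"
begin

(* A possibly unbounded operator: a domain together with a map whose values
   outside the domain carry no meaning. *)
datatype 'a oper = Oper (Dom: "'a set") (app: "'a \<Rightarrow> 'a")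

definition linear_oper :: "'a::real_vector oper \<Rightarrow> bool" where
  "linear_oper A \<longleftrightarrow> subspace (Dom A) \<and>
     (\<forall>x\<in>Dom A. \<forall>y\<in>Dom A. app A (x + y) = app A x + app A y) \<and>
     (\<forall>c. \<forall>x\<in>Dom A. app A (c *\<^sub>R x) = c *\<^sub>R app A x)"

definition adjoint_Dom :: "'a::real_inner oper \<Rightarrow> 'a set" where
  "adjoint_Dom A = {y. \<exists>z. \<forall>x\<in>Dom A. app A x \<bullet> y = x \<bullet> z}"

(* By density of the domain the vector z above is unique; the symmetry clause below
   says that it equals A y, so the last two clauses together say that A is its own adjoint. *)
definition self_adjoint :: "'a::real_inner oper \<Rightarrow> bool" where
  "self_adjoint A \<longleftrightarrow> linear_oper A \<and> closure (Dom A) = UNIV \<and>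
     adjoint_Dom A = Dom A \<and>
     (\<forall>x\<in>Dom A. \<forall>y\<in>Dom A. app A x \<bullet> y = x \<bullet> app A y)"

definition positive_oper :: "'a::real_inner oper \<Rightarrow> bool" where
  "positive_oper A \<longleftrightarrow> (\<forall>x\<in>Dom A. 0 \<le> app A x \<bullet> x)"

definition is_sqrt_oper :: "'a::real_inner oper \<Rightarrow> 'a oper \<Rightarrow> bool" where
  "is_sqrt_oper S A \<longleftrightarrow> self_adjoint S \<and> positive_oper S \<and>
     Dom A = {x \<in> Dom S. app S x \<in> Dom S} \<and>
     (\<forall>x\<in>Dom A. app S (app S x) = app A x)"

(* For a positive self-adjoint A on a Hilbert space the square root exists and is unique
   up to its meaningless values outside the domain; hence SOME rather than THE. *)
definition sqrt_oper :: "'a::real_inner oper \<Rightarrow> 'a oper" where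
  "sqrt_oper A = (SOME S. is_sqrt_oper S A)"

definition graph_norm :: "'a::real_normed_vector oper \<Rightarrow> 'a \<Rightarrow> real" where
  "graph_norm A x = sqrt ((norm x)\<^sup>2 + (norm (app A x))\<^sup>2)"

definition C0_graph :: "'a::real_normed_vector oper \<Rightarrow> (real \<Rightarrow> 'a) \<Rightarrow> bool" where
  "C0_graph A u \<longleftrightarrow> (\<forall>t\<ge>0. u t \<in> Dom A) \<and>
     (\<forall>t\<ge>0. ((\<lambda>s. graph_norm A (u s - u t)) \<longlongrightarrow> 0) (at t within {0..}))"

definition C1_graph :: "'a::real_normed_vector oper \<Rightarrow> (real \<Rightarrow> 'a) \<Rightarrow> (real \<Rightarrow> 'a) \<Rightarrow> bool" where
  "C1_graph A u u' \<longleftrightarrow> C0_graph A u \<and> C0_graph A u' \<and>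
     (\<forall>t\<ge>0. ((\<lambda>s. graph_norm A ((u s - u t) /\<^sub>R (s - t) - u' t)) \<longlongrightarrow> 0) (at t within {0..}))"

definition C2_half_line ::
  "(real \<Rightarrow> 'a::real_normed_vector) \<Rightarrow> (real \<Rightarrow> 'a) \<Rightarrow> (real \<Rightarrow> 'a) \<Rightarrow> bool" where
  "C2_half_line u u' u'' \<longleftrightarrow>
     (\<forall>t\<ge>0. (u has_vector_derivative u' t) (at t within {0..})) \<and>
     (\<forall>t\<ge>0. (u' has_vector_derivative u'' t) (at t within {0..})) \<and>
     continuous_on {0..} u''"

(* The Bochner integral of the library is restricted to second countable spaces, i.e. to
   separable H.  Vector-valued integrals are therefore gauge integrals; these agree with
   the Bochner integral whenever the latter exists. *)
definition convol :: "(real \<Rightarrow> real) \<Rightarrow> (real \<Rightarrow> 'a::real_normed_vector) \<Rightarrow> real \<Rightarrow> 'a" where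
  "convol h w t = integral {0..t} (\<lambda>s. h (t - s) *\<^sub>R w s)"

definition L1_loc :: "(real \<Rightarrow> real) \<Rightarrow> bool" where
  "L1_loc h \<longleftrightarrow> (\<forall>T>0. h absolutely_integrable_on {0<..<T})"

definition Linf_loc :: "(real \<Rightarrow> real) \<Rightarrow> bool" where
  "Linf_loc \<phi> \<longleftrightarrow> \<phi> measurable_on {0<..} \<and>
     (\<forall>T>0. \<exists>M. AE t in lebesgue. t \<in> {0<..<T} \<longrightarrow> \<bar>\<phi> t\<bar> \<le> M)"

(* measurable_on (a.e. limit of continuous functions) is strong measurability, also when
   H is not separable. *)
definition L2_loc :: "(real \<Rightarrow> 'a::real_normed_vector) \<Rightarrow> bool" where
  "L2_loc w \<longleftrightarrow> w measurable_on {0<..} \<and>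
     (\<forall>T>0. (\<lambda>t. (norm (w t))\<^sup>2) absolutely_integrable_on {0<..<T})"

(* The type argument is the Hilbert space in which the test functions w take their values. *)
definition pd_kernel ::
  "'a::{real_inner,complete_space} itself \<Rightarrow> (real \<Rightarrow> real) \<Rightarrow> (real \<Rightarrow> real) \<Rightarrow> bool" where
  "pd_kernel _ \<phi> h \<longleftrightarrow> L1_loc h \<and> Linf_loc \<phi> \<and> (\<forall>t>0. 0 < \<phi> t) \<and>
     (\<forall>w :: real \<Rightarrow> 'a. L2_loc w \<longrightarrow>
        (\<forall>t\<ge>0. 0 \<le> integral {0..t} (\<lambda>s. \<phi> s * (convol h w s \<bullet> w s))))"

definition strongly_pd_kernel ::
  "'a::{real_inner,complete_space} itself \<Rightarrow> (real \<Rightarrow> real) \<Rightarrow> (real \<Rightarrow> real) \<Rightarrow> bool" where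
  "strongly_pd_kernel H \<phi> h \<longleftrightarrow>
     (\<exists>\<delta>>0. \<exists>N>0. pd_kernel H \<phi> (\<lambda>t. h t - \<delta> * exp (- N * t)))"

definition assumption_I1 ::
  "'a::{real_inner,complete_space} oper \<Rightarrow> 'a oper \<Rightarrow> real \<Rightarrow> real \<Rightarrow> bool" where
  "assumption_I1 A1 A2 a1 a2 \<longleftrightarrow>
     self_adjoint A1 \<and> positive_oper A1 \<and> self_adjoint A2 \<and> positive_oper A2 \<and>
     a1 > 0 \<and> a2 > 0 \<and>
     (\<forall>u\<in>Dom A1. a1 * (app A1 u \<bullet> u) \<ge> (norm u)\<^sup>2) \<and>
     (\<forall>v\<in>Dom A2. a2 * (app A2 v \<bullet> v) \<ge> (norm v)\<^sup>2)"

definition assumption_I2 ::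
  "'a::{real_inner,complete_space} oper \<Rightarrow> 'a oper \<Rightarrow> 'a oper \<Rightarrow> 'a oper \<Rightarrow> real \<Rightarrow> real \<Rightarrow> bool" where
  "assumption_I2 A1 A2 B1 B2 \<beta> \<beta>1 \<longleftrightarrow>
     linear_oper B1 \<and> linear_oper B2 \<and>
     Dom (sqrt_oper A1) \<subseteq> Dom B1 \<and> Dom (sqrt_oper A2) \<subseteq> Dom B2 \<and>
     (\<forall>u\<in>Dom A1. \<forall>v\<in>Dom A2. app B1 u \<bullet> v = u \<bullet> app B2 v) \<and>
     \<beta> > 0 \<and> \<beta>1 > 0 \<and>
     (\<forall>w\<in>Dom (sqrt_oper A1).
        \<beta> * norm (app (sqrt_oper A1) w) \<le> norm (app B1 w) \<and>
        norm (app B1 w) \<le> \<beta>1 * norm (app (sqrt_oper A1) w)) \<and>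
     (\<forall>w\<in>Dom (sqrt_oper A2).
        \<beta> * norm (app (sqrt_oper A2) w) \<le> norm (app B2 w) \<and>
        norm (app B2 w) \<le> \<beta>1 * norm (app (sqrt_oper A2) w))"

(* g is (the continuous representative of) a locally absolutely continuous function and g'
   its derivative in the a.e., equivalently weak, sense.  No condition is put on g 0. *)
definition ac_derivative :: "(real \<Rightarrow> real) \<Rightarrow> (real \<Rightarrow> real) \<Rightarrow> bool" where
  "ac_derivative g g' \<longleftrightarrow>
     (\<forall>s t. 0 < s \<and> s \<le> t \<longrightarrow>
        g' absolutely_integrable_on {s..t} \<and> integral {s..t} g' = g t - g s)"

definition assumption_I3' ::
  "'a::{real_inner,complete_space} itself \<Rightarrow> real \<Rightarrow> real \<Rightarrow> real \<Rightarrow> real \<Rightarrow> (real \<Rightarrow> real) \<Rightarrow> bool" where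
  "assumption_I3' H a1 \<beta>1 \<alpha> lam0 g \<longleftrightarrow>
     \<alpha> \<ge> 0 \<and> lam0 \<ge> 1 \<and>
     g absolutely_integrable_on {0<..} \<and>
     integral {0<..} g < 1 \<and>
     integral {0<..} g + a1 * (\<beta>1\<^sup>2 - \<alpha>) < 1 \<and>
     (\<lambda>t. (t + 1) powr lam0 * g t) absolutely_integrable_on {0<..} \<and>
     (\<exists>g'. ac_derivative g g' \<and>
        (\<lambda>t. (t + 1) powr lam0 * g' t) absolutely_integrable_on {0<..}) \<and>
     strongly_pd_kernel H (\<lambda>t. (t + 1) powr lam0) (\<lambda>t. integral {t<..} g)"

definition assumption_I4 ::
  "'a::{real_inner,complete_space} oper \<Rightarrow> 'a oper \<Rightarrow> 'a oper \<Rightarrow> 'a oper \<Rightarrow> bool" where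
  "assumption_I4 A1 A2 B1 B2 \<longleftrightarrow>
     (\<exists>(P :: 'a \<Rightarrow> real) (\<Lambda>1 :: 'a \<Rightarrow> 'a) (\<Lambda>2 :: 'a \<Rightarrow> 'a) D1 D2.
        (\<forall>x \<in> app B1 ` Dom A1 \<union> app B2 ` Dom A2. 0 \<le> P x) \<and>
        bounded_linear \<Lambda>1 \<and> bounded_linear \<Lambda>2 \<and> D1 > 0 \<and> D2 > 0 \<and>
        (\<forall>u\<in>Dom A1. \<forall>v\<in>Dom A2.
           \<bar>app A1 u \<bullet> app B2 v - app B1 u \<bullet> app A2 v\<bar>
             \<le> D1 * (norm (app B1 u) * norm (app B2 v) + P (app B1 u) * P (app B2 v))) \<and>
        (\<forall>w\<in>Dom A1. (P (app B1 w))\<^sup>2 \<le> app A1 w \<bullet> \<Lambda>1 (app B1 w) + D2 * (norm (app B1 w))\<^sup>2 \<and>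
           w \<bullet> \<Lambda>1 (app B1 w) \<le> D2 * (norm w)\<^sup>2) \<and>
        (\<forall>w\<in>Dom A2. (P (app B2 w))\<^sup>2 \<le> app A2 w \<bullet> \<Lambda>2 (app B2 w) + D2 * (norm (app B2 w))\<^sup>2 \<and>
           w \<bullet> \<Lambda>2 (app B2 w) \<le> D2 * (norm w)\<^sup>2))"

(* u', u'', v', v'' are pinned down on the half line by the regularity clauses. *)
definition classical_solution ::
  "'a::{real_inner,complete_space} oper \<Rightarrow> 'a oper \<Rightarrow> 'a oper \<Rightarrow> 'a oper \<Rightarrow> real \<Rightarrow> (real \<Rightarrow> real) \<Rightarrow>
   'a \<Rightarrow> 'a \<Rightarrow> 'a \<Rightarrow> 'a \<Rightarrow>
   (real \<Rightarrow> 'a) \<Rightarrow> (real \<Rightarrow> 'a) \<Rightarrow> (real \<Rightarrow> 'a) \<Rightarrow>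
   (real \<Rightarrow> 'a) \<Rightarrow> (real \<Rightarrow> 'a) \<Rightarrow> (real \<Rightarrow> 'a) \<Rightarrow> bool" where
  "classical_solution A1 A2 B1 B2 \<alpha> g u0 u1 v0 v1 u u' u'' v v' v'' \<longleftrightarrow>
     C2_half_line u u' u'' \<and> C1_graph (sqrt_oper A1) u u' \<and> C0_graph A1 u \<and>
     C2_half_line v v' v'' \<and> C1_graph (sqrt_oper A2) v v' \<and> C0_graph A2 v \<and>
     (\<forall>t\<ge>0. u'' t + app A1 (u t) - convol g (\<lambda>s. app A1 (u s)) t
              + \<alpha> *\<^sub>R u t + app B2 (v t) = 0) \<and>
     (\<forall>t\<ge>0. v'' t + app A2 (v t) + app B1 (u t) = 0) \<and>
     u 0 = u0 \<and> u' 0 = u1 \<and> v 0 = v0 \<and> v' 0 = v1"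

definition energy ::
  "'a::{real_inner,complete_space} oper \<Rightarrow> 'a oper \<Rightarrow> 'a oper \<Rightarrow> real \<Rightarrow> (real \<Rightarrow> real) \<Rightarrow>
   (real \<Rightarrow> 'a) \<Rightarrow> (real \<Rightarrow> 'a) \<Rightarrow> (real \<Rightarrow> 'a) \<Rightarrow> (real \<Rightarrow> 'a) \<Rightarrow> real \<Rightarrow> real" where
  "energy A1 A2 B1 \<alpha> g u u' v v' t =
     1/2 * (norm (u' t))\<^sup>2
     + (1 - integral {0<..} g) / 2 * (norm (app (sqrt_oper A1) (u t)))\<^sup>2
     + 1/2 * (norm (v' t))\<^sup>2
     + 1/2 * (norm (app (sqrt_oper A2) (v t)))\<^sup>2
     + \<alpha> / 2 * (norm (u t))\<^sup>2
     + app B1 (u t) \<bullet> v t"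

end

theory Submission
  imports Defs
begin

text \<open>
  Let \<open>*\<close> denote convolution, \<open>G\<close> the tail integral of \<open>g\<close>, \<open>U = A\<^sub>1\<^sup>1\<^sup>/\<^sup>2 u\<close> and \<open>W = U'\<close>.  An
  integration by parts in the memory term gives \<open>E' = - \<langle>G * W, W\<rangle> - G \<langle>U(0), W\<rangle>\<close>.  With the weight
  \<open>(t + 1) powr m\<close>, \<open>0 \<le> m \<le> lam0\<close>, the
  strong positive definiteness of \<open>G\<close> yields a weighted \<open>L\<^sup>2\<close> bound for \<open>z = exp(- N t) * W\<close>, up to the
  integral of \<open>E\<close> against the derivative of the weight, which is an arbitrarily small multiple of the weighted
  integral of \<open>E\<close> plus a constant.  Call such quantities small.  Suitable multipliers then show
  successively that the squares of \<open>u'\<close> (multiplier \<open>A\<^sub>1\<^sup>-\<^sup>1\<^sup>/\<^sup>2 z\<close>), \<open>U\<close> (multipliers \<open>u\<close> and \<open>- A\<^sub>2\<^sup>-\<^sup>1 B\<^sub>1 u\<close>),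
  \<open>A\<^sub>2\<^sup>1\<^sup>/\<^sup>2 v\<close> (the commutator condition applied to \<open>u - g * u\<close> and \<open>v\<close>) and \<open>v'\<close> (multiplier \<open>v\<close>) are
  small; hence \<open>E\<close> is small compared with itself and its weighted integral is finite.  Since
  \<open>G * W = G(0) z - g * z + N G * z\<close>, the second step needs \<open>(t + 1) powr (m / 2) * G\<close> to be integrable, that is
  \<open>m \<le> 2 (lam0 - 1)\<close>.  The pointwise decay follows from the energy identity with \<open>m = lam0\<close>.
\<close>

section \<open>Hilbert spaces and square roots of coercive operators\<close>

text \<open>The dissipation acts on \<open>W\<close>, which lies one order above the energy:
  \<open>E\<close> sees only \<open>Q1 W = u'\<close>. Strong positive definiteness controls just
  the exponential average \<open>z\<close> of \<open>W\<close>; \<open>W\<close> itself is never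
  estimated. Wherever \<open>W\<close> or a second derivative occurs, it has to be part of a total
  derivative, be written as \<open>z' + N z\<close>, be moved onto the kernel, or sit behind an
  operator that turns it into \<open>u'\<close>. The tail \<open>G\<close> inherits one power of
  weight less than \<open>g\<close> has, (t+1)^(lam0-1). Young's inequality for squares with weight
  exponent m spends m/2 on the kernel, whence m/2 \<le> lam0-1. The pointwise bound loses nothing by
  this restriction: the energy inequality with exponent lam0 asks only for the integral of
  \<open>E\<close> with exponent lam0-1. The commutator condition is applied to u - g*u because the
  first equation expresses the image of this function under \<open>A1\<close> through u'', u and v,
  with no memory left.\<close>

lemma closed_subspace_orthogonal_vector:
  fixes M :: "'a::{real_inner,complete_space} set"
  assumes sub: "subspace M" and cl: "closed M" and x: "x \<notin> M"
  obtains y where "y \<noteq> 0" "\<And>w. w \<in> M \<Longrightarrow> y \<bullet> w = 0"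
proof -
  define d where "d = (INF m\<in>M. (norm (x - m))\<^sup>2)"
  have ne: "M \<noteq> {}"
    using sub subspace_0 by blast
  have bdd: "bdd_below ((\<lambda>m. (norm (x - m))\<^sup>2) ` M)"
    by (rule bdd_belowI[where m=0]) auto
  have dle: "d \<le> (norm (x - m))\<^sup>2" if "m \<in> M" for m
    unfolding d_def using bdd that by (rule cINF_lower)
  have "\<exists>m\<in>M. (norm (x - m))\<^sup>2 < d + inverse (Suc n)" for n
  proof -
    have "Inf ((\<lambda>m. (norm (x - m))\<^sup>2) ` M) < d + inverse (Suc n)"
      unfolding d_def by simp
    from cInf_lessD[OF _ this] ne show ?thesis by auto
  qed
  then obtain m where mM: "\<And>n. m n \<in> M" and md: "\<And>n. (norm (x - m n))\<^sup>2 < d + inverse (Suc n)"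
    by metis
  \<comment> \<open>Parallelogram law: the midpoint of two near-minimizers lies in \<open>M\<close>
    again and cannot be closer to \<open>x\<close> than \<open>d\<close> allows, which forces the
    two points together.\<close>
  have par: "(norm (m n - m k))\<^sup>2 \<le> 2 * inverse (Suc n) + 2 * inverse (Suc k)" for n k
  proof -
    have "(1/2) *\<^sub>R (m n + m k) \<in> M"
      using sub mM by (simp add: subspace_add subspace_scale)
    from dle[OF this] have 1: "4 * d \<le> 4 * (norm (x - (1/2) *\<^sub>R (m n + m k)))\<^sup>2"
      by simp
    have "(norm (m n - m k))\<^sup>2 + 4 * (norm (x - (1/2) *\<^sub>R (m n + m k)))\<^sup>2
        = 2 * (norm (x - m n))\<^sup>2 + 2 * (norm (x - m k))\<^sup>2"
      unfolding power2_norm_eq_inner by (simp add: inner_simps inner_commute algebra_simps)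
    with 1 md[of n] md[of k] show ?thesis
      by linarith
  qed
  have "Cauchy m"
  proof (rule metric_CauchyI)
    fix e :: real assume e: "e > 0"
    obtain N where N: "inverse (real (Suc N)) < e\<^sup>2 / 4"
      using reals_Archimedean[of "e\<^sup>2/4"] e by auto
    have "dist (m n) (m k) < e" if "n \<ge> N" "k \<ge> N" for n k
    proof -
      have "inverse (real (Suc n)) \<le> inverse (real (Suc N))" "inverse (real (Suc k)) \<le> inverse (real (Suc N))"
        using that by (auto intro: le_imp_inverse_le)
      with par[of n k] N have "(norm (m n - m k))\<^sup>2 < e\<^sup>2"
        by linarith
      then show ?thesis
        using e by (simp add: dist_norm power_less_imp_less_base)
    qed
    then show "\<exists>N. \<forall>n\<ge>N. \<forall>k\<ge>N. dist (m n) (m k) < e"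
      by blast
  qed
  then obtain p where p: "m \<longlonglongrightarrow> p"
    using Cauchy_convergent convergent_def by blast
  have pM: "p \<in> M"
    using cl mM p closed_sequentially by blast
  have "(norm (x - p))\<^sup>2 \<le> d + 0"
  proof (rule tendsto_le)
    show "(\<lambda>n. (norm (x - m n))\<^sup>2) \<longlonglongrightarrow> (norm (x - p))\<^sup>2"
      by (intro tendsto_intros p)
    show "(\<lambda>n. d + inverse (real (Suc n))) \<longlonglongrightarrow> d + 0"
      by (intro tendsto_intros LIMSEQ_inverse_real_of_nat)
  qed (use md less_imp_le in \<open>auto intro!: always_eventually\<close>)
  then have dp: "(norm (x - p))\<^sup>2 = d"
    using dle[OF pM] by simp
  have "(x - p) \<bullet> w = 0" if w: "w \<in> M" for w
  proof (cases "w = 0")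
    case False
    \<comment> \<open>The optimal step from \<open>p\<close> along \<open>w\<close>: it would lower
      the squared distance by \<open>((x - p) \<bullet> w)\<^sup>2 / (w \<bullet> w)\<close>, which
      minimality makes zero.\<close>
    define s where "s = ((x - p) \<bullet> w) / (w \<bullet> w)"
    have ww: "w \<bullet> w > 0" using False by simp
    have "p + s *\<^sub>R w \<in> M"
      using sub pM w by (simp add: subspace_add subspace_scale)
    from dle[OF this] have "(norm (x - p))\<^sup>2 \<le> (norm ((x - p) - s *\<^sub>R w))\<^sup>2"
      by (simp add: dp algebra_simps)
    also have "\<dots> = (norm (x - p))\<^sup>2 - 2 * s * ((x - p) \<bullet> w) + s\<^sup>2 * (w \<bullet> w)"
      unfolding power2_norm_eq_inner
      by (simp add: inner_simps inner_commute algebra_simps power2_eq_square)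
    also have "\<dots> = (norm (x - p))\<^sup>2 - ((x - p) \<bullet> w)\<^sup>2 / (w \<bullet> w)"
      using ww by (simp add: s_def field_simps power2_eq_square)
    finally have "((x - p) \<bullet> w)\<^sup>2 / (w \<bullet> w) \<le> 0"
      by simp
    with ww show ?thesis
      by (simp add: divide_le_0_iff not_le[symmetric])
  qed simp
  moreover have "x - p \<noteq> 0"
    using x pM by auto
  ultimately show thesis
    using that by blast
qed

text \<open>Existence comes from a rescaled vector orthogonal to the kernel. Uniqueness is included
  because the inverse isomorphism is defined by \<open>THE\<close> below.\<close>

lemma riesz_representation:
  fixes f :: "'a::{real_inner,complete_space} \<Rightarrow> real"
  assumes "bounded_linear f"
  shows "\<exists>!y. \<forall>x. f x = y \<bullet> x"
proof -
  note lin = bounded_linear.linear[OF assms]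
  note zero = linear_0[OF lin] and add = linear_add[OF lin] and scale = linear_scale[OF lin] and diff = linear_diff[OF lin]
  have "\<exists>y. \<forall>x. f x = y \<bullet> x"
  proof (cases "\<forall>x. f x = 0")
    case True
    then show ?thesis by (intro exI[of _ 0]) simp
  next
    case False
    then obtain x where x: "f x \<noteq> 0" by blast
    have sub: "subspace (f -` {0})"
      unfolding subspace_def by (simp add: zero add scale)
    have cl: "closed (f -` {0})"
      by (rule continuous_closed_vimage[OF closed_singleton linear_continuous_at[OF assms]])
    have "x \<notin> f -` {0}"
      using x unfolding vimage_singleton_eq .
    from closed_subspace_orthogonal_vector[OF sub cl this]
    obtain y where y0: "y \<noteq> 0" and y': "\<And>w. w \<in> f -` {0} \<Longrightarrow> y \<bullet> w = 0"
      by blast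
    have y: "y \<bullet> w = 0" if "f w = 0" for w
      using that by (intro y') (simp only: vimage_singleton_eq)
    have fy: "f y \<noteq> 0"
      using y[of y] y0 by (metis inner_eq_zero_iff)
    have "f w = ((f y / (y \<bullet> y)) *\<^sub>R y) \<bullet> w" for w
    proof -
      have "f (w - (f w / f y) *\<^sub>R y) = f w - (f w / f y) * f y"
        by (simp only: diff scale real_scaleR_def)
      then have "f (w - (f w / f y) *\<^sub>R y) = 0"
        using fy by simp
      from y[OF this] have "y \<bullet> w = (f w / f y) * (y \<bullet> y)"
        by (simp only: inner_diff_right inner_scaleR_right right_minus_eq)
      moreover have "y \<bullet> y \<noteq> 0"
        using y0 by simp
      ultimately show ?thesis
        using fy by (simp only: inner_scaleR_left) (simp add: divide_simps)
    qed
    then show ?thesis by (intro exI allI)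
  qed
  moreover have "y = z" if "\<forall>x. f x = y \<bullet> x" "\<forall>x. f x = z \<bullet> x" for y z
  proof -
    have "y \<bullet> x = z \<bullet> x" for x
      using that(1)[THEN spec, of x] that(2)[THEN spec, of x] by (rule subst)
    then show ?thesis
      by (rule vector_eq_rdot[THEN iffD1, OF allI])
  qed
  ultimately show ?thesis
    by (rule ex_ex1I)
qed

text \<open>The sort of \<open>'a\<close> is not below \<^class>\<open>banach\<close>, but its dual is a Banach space, and the Riesz
  isomorphism carries the integral over from there.\<close>

lemma integrable_continuous_hilbert:
  fixes f :: "real \<Rightarrow> 'a::{real_inner,complete_space}"
  assumes "continuous_on {a..b} f"
  shows "f integrable_on {a..b}"
proof -
  define K :: "('a \<Rightarrow>\<^sub>L real) \<Rightarrow> 'a" where "K = (\<lambda>L. THE y. \<forall>x. blinfun_apply L x = y \<bullet> x)"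
  have K: "blinfun_apply L x = K L \<bullet> x" for L x
    unfolding K_def
    using theI'[OF riesz_representation[OF blinfun.bounded_linear_right[of L]]] by blast
  have Keq: "K L = y" if "\<And>x. blinfun_apply L x = y \<bullet> x" for L y
    using that unfolding K by (rule vector_eq_rdot[THEN iffD1, OF allI])
  have "bounded_linear K"
  proof (rule bounded_linear_intro[where K=1])
    show "K (L + M) = K L + K M" for L M
      by (rule Keq) (simp only: blinfun.add_left inner_add_left flip: K)
    show "K (r *\<^sub>R L) = r *\<^sub>R K L" for r L
      by (rule Keq) (simp only: blinfun.scaleR_left inner_scaleR_left real_scaleR_def flip: K)
    show "norm (K L) \<le> norm L * 1" for L
    proof -
      have "(norm (K L))\<^sup>2 = blinfun_apply L (K L)"
        by (simp only: K power2_norm_eq_inner)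
      also have "\<dots> \<le> norm L * norm (K L)"
        using norm_blinfun[of L "K L"] by simp
      finally show ?thesis
        by (cases "K L = 0") (auto simp: power2_eq_square)
    qed
  qed
  moreover have "(\<lambda>t. blinfun_inner_right (f t)) integrable_on {a..b}"
    by (intro integrable_continuous_interval bounded_linear.continuous_on[OF bounded_linear_blinfun_inner_right] assms)
  ultimately have "(K \<circ> (\<lambda>t. blinfun_inner_right (f t))) integrable_on {a..b}"
    by (rule integrable_linear[rotated])
  moreover have "K (blinfun_inner_right y) = y" for y
    by (rule Keq) (simp add: blinfun_inner_right.rep_eq)
  ultimately show ?thesis
    by (simp add: o_def)
qed

lemma integral_inner_left:
  fixes f :: "real \<Rightarrow> 'a::real_inner"
  assumes "f integrable_on S"
  shows "integral S (\<lambda>t. f t \<bullet> x) = integral S f \<bullet> x"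
  using integral_linear[OF assms bounded_linear_inner_left[of x]] by (simp add: o_def)

text \<open>Pairing with the integral itself reduces the claim to a scalar inequality, so only gauge
  integrability of \<open>f\<close> and of its majorant enters.\<close>

lemma norm_integral_le_hilbert:
  fixes f :: "real \<Rightarrow> 'a::{real_inner,complete_space}"
  assumes f: "f integrable_on S" and h: "h integrable_on S"
    and le: "\<And>t. t \<in> S \<Longrightarrow> norm (f t) \<le> h t"
  shows "norm (integral S f) \<le> integral S h"
proof (cases "integral S f = 0")
  case True
  have "0 \<le> integral S h"
    using h by (rule integral_nonneg) (use le norm_ge_zero order_trans in blast)
  then show ?thesis by (simp add: True)
next
  case False
  let ?I = "integral S f"
  have "(norm ?I)\<^sup>2 = integral S (\<lambda>t. f t \<bullet> ?I)"
    by (simp add: integral_inner_left[OF f] power2_norm_eq_inner)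
  also have "\<dots> \<le> integral S (\<lambda>t. norm ?I * h t)"
  proof (rule integral_le)
    show "(\<lambda>t. f t \<bullet> ?I) integrable_on S"
      using integrable_linear[OF f bounded_linear_inner_left[of ?I]] by (simp add: o_def)
    show "(\<lambda>t. norm ?I * h t) integrable_on S"
      using integrable_on_cmult_left[OF h, of "norm ?I"] by simp
    show "f t \<bullet> ?I \<le> norm ?I * h t" if "t \<in> S" for t
      using norm_cauchy_schwarz[of "f t" ?I] mult_left_mono[OF le[OF that], of "norm ?I"]
      by (simp add: mult.commute)
  qed
  finally show ?thesis
    using False by (simp add: power2_eq_square)
qed

section \<open>Self-adjoint operators bounded below: range, inverse and square root\<close>

lemma closure_dense_inner_eq:
  fixes y z :: "'a::real_inner"
  assumes D: "closure D = UNIV" and eq: "\<And>x. x \<in> D \<Longrightarrow> x \<bullet> y = x \<bullet> z"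
  shows "y = z"
proof -
  have "closed {x. x \<bullet> y = x \<bullet> z}"
    by (intro closed_Collect_eq continuous_intros)
  then have "closure D \<subseteq> {x. x \<bullet> y = x \<bullet> z}"
    using eq by (intro closure_minimal) auto
  then have "(y - z) \<bullet> y = (y - z) \<bullet> z"
    using D by auto
  then have "(y - z) \<bullet> (y - z) = 0"
    by (simp add: inner_diff_right)
  then show ?thesis by simp
qed

lemma self_adjointD:
  assumes "self_adjoint A"
  shows "linear_oper A" "closure (Dom A) = UNIV"
    "\<And>x y. x \<in> Dom A \<Longrightarrow> y \<in> Dom A \<Longrightarrow> app A x \<bullet> y = x \<bullet> app A y"
  using assms by (auto simp: self_adjoint_def)

lemma linear_operD:
  assumes "linear_oper A"
  shows "subspace (Dom A)"
    "\<And>x y. x \<in> Dom A \<Longrightarrow> y \<in> Dom A \<Longrightarrow> x + y \<in> Dom A"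
    "\<And>c x. x \<in> Dom A \<Longrightarrow> c *\<^sub>R x \<in> Dom A"
    "\<And>x y. x \<in> Dom A \<Longrightarrow> y \<in> Dom A \<Longrightarrow> app A (x + y) = app A x + app A y"
    "\<And>c x. x \<in> Dom A \<Longrightarrow> app A (c *\<^sub>R x) = c *\<^sub>R app A x"
    "\<And>x y. x \<in> Dom A \<Longrightarrow> y \<in> Dom A \<Longrightarrow> x - y \<in> Dom A"
    "\<And>x y. x \<in> Dom A \<Longrightarrow> y \<in> Dom A \<Longrightarrow> app A (x - y) = app A x - app A y"
proof -
  show 1: "subspace (Dom A)"
    and 2: "\<And>x y. x \<in> Dom A \<Longrightarrow> y \<in> Dom A \<Longrightarrow> app A (x + y) = app A x + app A y"
    and 3: "\<And>c x. x \<in> Dom A \<Longrightarrow> app A (c *\<^sub>R x) = c *\<^sub>R app A x"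
    using assms by (auto simp: linear_oper_def)
  show "\<And>x y. x \<in> Dom A \<Longrightarrow> y \<in> Dom A \<Longrightarrow> x + y \<in> Dom A"
    and 4: "\<And>c x. x \<in> Dom A \<Longrightarrow> c *\<^sub>R x \<in> Dom A"
    and "\<And>x y. x \<in> Dom A \<Longrightarrow> y \<in> Dom A \<Longrightarrow> x - y \<in> Dom A"
    using 1 by (auto simp: subspace_add subspace_scale subspace_diff)
  fix x y assume "x \<in> Dom A" "y \<in> Dom A"
  then show "app A (x - y) = app A x - app A y"
    using 2[of x "(-1) *\<^sub>R y"] 3[of y "-1"] 4[of y "-1"] by simp
qed

text \<open>The working form of self-adjointness: the adjoint relation alone puts a vector into the
  domain. It takes the place of arguments with closed graphs.\<close>

lemma self_adjoint_memI:
  assumes A: "self_adjoint A" and z: "\<And>x. x \<in> Dom A \<Longrightarrow> app A x \<bullet> y = x \<bullet> z"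
  shows "y \<in> Dom A" "app A y = z"
proof -
  show y: "y \<in> Dom A"
    using A z unfolding self_adjoint_def adjoint_Dom_def by blast
  show "app A y = z"
  proof (rule closure_dense_inner_eq[OF self_adjointD(2)[OF A]])
    show "x \<bullet> app A y = x \<bullet> z" if "x \<in> Dom A" for x
      using self_adjointD(3)[OF A that y] z[OF that] by simp
  qed
qed

text \<open>Coercivity gives \<open>norm u \<le> a * norm (app A u)\<close>, so preimages of a
  convergent sequence in the range converge, and \<open>self_adjoint_memI\<close> identifies the
  image of their limit: the range is closed. A vector orthogonal to it lies in the kernel, which
  coercivity makes trivial.\<close>

lemma coercive_self_adjoint_range:
  fixes A :: "'a::{real_inner,complete_space} oper"
  assumes A: "self_adjoint A" and a: "a > 0"
    and co: "\<And>u. u \<in> Dom A \<Longrightarrow> a * (app A u \<bullet> u) \<ge> (norm u)\<^sup>2"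
  shows "app A ` Dom A = UNIV"
proof (rule ccontr)
  note lin = linear_operD[OF self_adjointD(1)[OF A]]
  have below: "norm u \<le> a * norm (app A u)" if "u \<in> Dom A" for u
  proof -
    have "(norm u)\<^sup>2 \<le> a * (norm (app A u) * norm u)"
      using co[OF that] mult_left_mono[OF norm_cauchy_schwarz[of "app A u" u], of a] a by linarith
    then show ?thesis
      by (cases "u = 0") (use a in \<open>auto simp: power2_eq_square\<close>)
  qed
  assume "app A ` Dom A \<noteq> UNIV"
  then obtain x where x: "x \<notin> app A ` Dom A" by blast
  have sub: "subspace (app A ` Dom A)"
    unfolding subspace_def
  proof (safe)
    show "0 \<in> app A ` Dom A"
      using lin(5)[OF subspace_0[OF lin(1)], of 0] subspace_0[OF lin(1)] by (auto intro!: image_eqI[of _ _ 0])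
  next
    fix u w assume "u \<in> Dom A" "w \<in> Dom A"
    then show "app A u + app A w \<in> app A ` Dom A"
      by (intro image_eqI[of _ _ "u + w"]) (auto simp: lin(2,4))
  next
    fix c u assume "u \<in> Dom A"
    then show "c *\<^sub>R app A u \<in> app A ` Dom A"
      by (intro image_eqI[of _ _ "c *\<^sub>R u"]) (auto simp: lin(3,5))
  qed
  have cl: "closed (app A ` Dom A)"
  proof (rule closed_sequential_limits[THEN iffD2], safe)
    show "l \<in> app A ` Dom A" if f: "\<forall>n. f n \<in> app A ` Dom A" and l: "f \<longlonglongrightarrow> l" for f l
    proof -
      obtain w where w: "\<And>n. w n \<in> Dom A" "\<And>n. f n = app A (w n)"
        using f unfolding image_iff by metis
      have "Cauchy w"
      proof (rule metric_CauchyI)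
        fix e :: real assume e: "e > 0"
        obtain N where N: "\<And>n k. n \<ge> N \<Longrightarrow> k \<ge> N \<Longrightarrow> dist (f n) (f k) < e / a"
          using metric_CauchyD[OF LIMSEQ_imp_Cauchy[OF l], of "e/a"] e a by auto
        have "dist (w n) (w k) < e" if "n \<ge> N" "k \<ge> N" for n k
        proof -
          have "norm (w n - w k) \<le> a * norm (f n - f k)"
            using below[OF lin(6)[OF w(1) w(1)], of n k] by (simp add: lin(7) w)
          also have "\<dots> < e"
            using N[OF that] a by (simp add: dist_norm field_simps)
          finally show ?thesis by (simp add: dist_norm)
        qed
        then show "\<exists>N. \<forall>n\<ge>N. \<forall>k\<ge>N. dist (w n) (w k) < e" by blast
      qed
      then obtain y where y: "w \<longlonglongrightarrow> y"
        using Cauchy_convergent convergent_def by blast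
      have "app A x \<bullet> y = x \<bullet> l" if x: "x \<in> Dom A" for x
      proof -
        have "(\<lambda>n. app A x \<bullet> w n) \<longlonglongrightarrow> app A x \<bullet> y" "(\<lambda>n. x \<bullet> f n) \<longlonglongrightarrow> x \<bullet> l"
          by (intro tendsto_intros y l)+
        moreover have "app A x \<bullet> w n = x \<bullet> f n" for n
          using self_adjointD(3)[OF A x w(1)] w(2) by simp
        ultimately show ?thesis
          using LIMSEQ_unique by auto
      qed
      from self_adjoint_memI[OF A this] show ?thesis by blast
    qed
  qed
  obtain y where y0: "y \<noteq> 0" and y: "\<And>w. w \<in> app A ` Dom A \<Longrightarrow> y \<bullet> w = 0"
    using closed_subspace_orthogonal_vector[OF sub cl x] by blast
  have "app A x \<bullet> y = x \<bullet> 0" if "x \<in> Dom A" for x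
    using y[of "app A x"] that by (simp add: inner_commute)
  from self_adjoint_memI[OF A this] have "y \<in> Dom A" "app A y = 0" by auto
  with below[of y] y0 show False by simp
qed


lemma coercive_self_adjoint_inverse:
  fixes A :: "'a::{real_inner,complete_space} oper"
  assumes A: "self_adjoint A" and a: "a > 0"
    and co: "\<And>u. u \<in> Dom A \<Longrightarrow> a * (app A u \<bullet> u) \<ge> (norm u)\<^sup>2"
  obtains R where "bounded_linear R" "\<And>y. R y \<in> Dom A" "\<And>y. app A (R y) = y"
    "\<And>x. x \<in> Dom A \<Longrightarrow> R (app A x) = x" "\<And>x y. R x \<bullet> y = x \<bullet> R y"
    "\<And>y. (norm (R y))\<^sup>2 \<le> a * (y \<bullet> R y)" "\<And>y. norm (R y) \<le> a * norm y"
proof -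
  note lin = linear_operD[OF self_adjointD(1)[OF A]]
  have "\<exists>x. x \<in> Dom A \<and> app A x = y" for y
    using coercive_self_adjoint_range[OF A a co] by (metis UNIV_I imageE)
  then obtain R where RD: "\<And>y. R y \<in> Dom A" and AR: "\<And>y. app A (R y) = y"
    by metis
  have inj: "x = y" if "x \<in> Dom A" "y \<in> Dom A" "app A x = app A y" for x y
    using co[OF lin(6)[OF that(1,2)]] that by (simp add: lin(7))
  have le: "(norm (R y))\<^sup>2 \<le> a * (y \<bullet> R y)" for y
    using co[OF RD[of y]] by (simp add: AR)
  have bd: "norm (R y) \<le> a * norm y" for y
  proof -
    have "(norm (R y))\<^sup>2 \<le> a * (norm y * norm (R y))"
      using le[of y] mult_left_mono[OF norm_cauchy_schwarz[of y "R y"], of a] a by linarith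
    then show ?thesis
      by (cases "R y = 0") (use a in \<open>auto simp: power2_eq_square\<close>)
  qed
  have "bounded_linear R"
  proof (rule bounded_linear_intro[where K=a])
    show "R (x + y) = R x + R y" for x y
      by (rule inj) (simp_all add: RD AR lin(2,4))
    show "R (r *\<^sub>R x) = r *\<^sub>R R x" for r x
      by (rule inj) (simp_all add: RD AR lin(3,5))
    show "norm (R x) \<le> norm x * a" for x
      using bd[of x] by (simp add: mult.commute)
  qed
  moreover have "R (app A x) = x" if "x \<in> Dom A" for x
    by (rule inj) (simp_all add: RD AR that)
  moreover have "R x \<bullet> y = x \<bullet> R y" for x y
    using self_adjointD(3)[OF A RD[of x] RD[of y]] by (simp add: AR)
  ultimately show thesis
    using RD AR le bd by (intro that)
qed

text \<open>If \<open>Y = (T + Y\<^sup>2) / 2\<close>, then \<open>(1 - Y)\<^sup>2 = 1 - T\<close>.  The Picard iterates of this equation are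
  dominated in norm by those of \<open>y = (1 + y\<^sup>2) / 2\<close>, which increase to \<open>1\<close>.\<close>

lemma contraction_sqrt_iteration:
  fixes T :: "'a::{real_inner,complete_space} \<Rightarrow> 'a"
  assumes T: "bounded_linear T" and sym: "\<And>x y. T x \<bullet> y = x \<bullet> T y" and le: "\<And>x. norm (T x) \<le> norm x"
  obtains Y where "bounded_linear Y" "\<And>x y. Y x \<bullet> y = x \<bullet> Y y" "\<And>x. norm (Y x) \<le> norm x"
    "\<And>x. Y x = (1/2) *\<^sub>R (T x + Y (Y x))"
proof -
  define Z where "Z = rec_nat (\<lambda>x::'a. 0) (\<lambda>n f x. (1/2) *\<^sub>R (T x + f (f x)))"
  define r where "r = rec_nat (0::real) (\<lambda>n c. (1/2) * (1 + c\<^sup>2))"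
  have Z0: "Z 0 x = 0" and ZS: "Z (Suc n) x = (1/2) *\<^sub>R (T x + Z n (Z n x))" for n x
    by (simp_all add: Z_def)
  have r0: "r 0 = 0" and rS: "r (Suc n) = (1/2) * (1 + (r n)\<^sup>2)" for n
    by (simp_all add: r_def)
  have r: "0 \<le> r n \<and> r n \<le> 1" for n
  proof (induction n)
    case (Suc n)
    then have "(r n)\<^sup>2 \<le> 1" by (simp add: power_le_one)
    then show ?case by (simp add: rS)
  qed (simp add: r0)
  have rmono: "r n \<le> r (Suc n)" for n
  proof -
    have "0 \<le> (1 - r n)\<^sup>2" by simp
    then show ?thesis by (simp add: rS power2_eq_square algebra_simps)
  qed
  note linT = bounded_linear.linear[OF T]
  have addZ: "Z n (x + y) = Z n x + Z n y" for n x y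
    by (induction n arbitrary: x y) (simp_all add: Z0 ZS linear_add[OF linT] algebra_simps)
  have sclZ: "Z n (c *\<^sub>R x) = c *\<^sub>R Z n x" for n c x
    by (induction n arbitrary: c x) (simp_all add: Z0 ZS linear_scale[OF linT] algebra_simps)
  have linZ: "linear (Z n)" for n
    by (rule linearI) (simp_all add: addZ sclZ)
  have symZ: "Z n x \<bullet> y = x \<bullet> Z n y" for n x y
    by (induction n arbitrary: x y) (simp_all add: Z0 ZS inner_add_left inner_add_right sym)
  have nZ: "norm (Z n x) \<le> r n * norm x" for n x
  proof (induction n arbitrary: x)
    case (Suc n)
    have "norm (Z n (Z n x)) \<le> r n * (r n * norm x)"
      using Suc[of "Z n x"] mult_left_mono[OF Suc[of x], of "r n"] r[of n] by linarith
    moreover have "norm (T x + Z n (Z n x)) \<le> norm (T x) + norm (Z n (Z n x))"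
      by (rule norm_triangle_ineq)
    ultimately have "norm (T x + Z n (Z n x)) \<le> norm x + r n * (r n * norm x)"
      using le[of x] by linarith
    then show ?case
      unfolding ZS rS norm_scaleR by (simp add: power2_eq_square algebra_simps del: scaleR_add_right)
  qed (simp add: Z0 r0)
  have nZ1: "norm (Z n x) \<le> norm x" for n x
    using nZ[of n x] r[of n] mult_right_mono[of "r n" 1 "norm x"] by simp
  have dZ: "norm (Z (Suc n) x - Z n x) \<le> (r (Suc n) - r n) * norm x" for n x
  proof (induction n arbitrary: x)
    case 0
    show ?case
      using le[of x] by (simp add: Z0 ZS r0 rS)
  next
    case (Suc n)
    let ?d = "r (Suc n) - r n"
    have d: "?d \<ge> 0" using rmono[of n] by simp
    \<comment> \<open>The difference of two operator squares is split as Z' (Z' - Z) + (Z' - Z) Z,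
      with Z' the later iterate, so that factors are never interchanged; the scalar iteration
      \<open>r\<close> majorizes both summands.\<close>
    have "Z (Suc (Suc n)) x - Z (Suc n) x
        = (1/2) *\<^sub>R (Z (Suc n) (Z (Suc n) x - Z n x) + (Z (Suc n) (Z n x) - Z n (Z n x)))"
      unfolding ZS[of "Suc n"] ZS[of n x] by (simp add: linear_diff[OF linZ] algebra_simps flip: ZS[of n x])
    also have "norm \<dots> \<le> (1/2) * (norm (Z (Suc n) (Z (Suc n) x - Z n x)) + norm (Z (Suc n) (Z n x) - Z n (Z n x)))"
      using norm_triangle_ineq by simp
    also have "\<dots> \<le> (1/2) * (r (Suc n) * (?d * norm x) + ?d * (r n * norm x))"
    proof -
      have "norm (Z (Suc n) (Z (Suc n) x - Z n x)) \<le> r (Suc n) * (?d * norm x)"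
        using nZ[of "Suc n" "Z (Suc n) x - Z n x"] mult_left_mono[OF Suc[of x], of "r (Suc n)"] r[of "Suc n"]
        by linarith
      moreover have "norm (Z (Suc n) (Z n x) - Z n (Z n x)) \<le> ?d * (r n * norm x)"
        using Suc[of "Z n x"] mult_left_mono[OF nZ[of n x] d] by linarith
      ultimately show ?thesis by (intro mult_left_mono add_mono) simp_all
    qed
    also have "\<dots> = (r (Suc (Suc n)) - r (Suc n)) * norm x"
      unfolding rS[of "Suc n"] by (subst (5) rS) (simp add: power2_eq_square algebra_simps)
    finally show ?case .
  qed
  have dmn: "norm (Z m x - Z n x) \<le> (r m - r n) * norm x" if "n \<le> m" for m n x
    using that
  proof (induction m rule: dec_induct)
    case (step m)
    have "norm (Z (Suc m) x - Z n x) \<le> norm (Z (Suc m) x - Z m x) + norm (Z m x - Z n x)"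
      using norm_triangle_ineq[of "Z (Suc m) x - Z m x" "Z m x - Z n x"] by simp
    with step dZ[of m x] show ?case
      by (simp add: algebra_simps)
  qed simp
  have "Bseq r"
    by (rule BseqI'[of _ 1]) (use r in auto)
  then have cr: "convergent r"
    using rmono by (intro Bseq_mono_convergent) (auto intro: incseq_SucI[THEN incseqD])
  have "Cauchy (\<lambda>n. Z n x)" for x
  proof (rule metric_CauchyI)
    fix e :: real assume e: "e > 0"
    obtain N where N: "\<And>m n. m \<ge> N \<Longrightarrow> n \<ge> N \<Longrightarrow> dist (r m) (r n) < e / (norm x + 1)"
      using metric_CauchyD[OF convergent_Cauchy[OF cr], of "e / (norm x + 1)"] e by (auto simp: add_nonneg_pos)
    have *: "dist (Z m x) (Z n x) < e" if "n \<ge> N" "m \<ge> n" for m n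
    proof -
      have "dist (Z m x) (Z n x) \<le> dist (r m) (r n) * norm x"
        using dmn[OF that(2), of x] mult_right_mono[OF abs_ge_self[of "r m - r n"] norm_ge_zero[of x]]
        by (simp add: dist_norm)
      also have "\<dots> \<le> e / (norm x + 1) * norm x"
        using N[of m n] that by (intro mult_right_mono) auto
      also have "\<dots> < e"
        using e by (simp add: field_simps add_pos_nonneg)
      finally show ?thesis .
    qed
    show "\<exists>N. \<forall>m\<ge>N. \<forall>n\<ge>N. dist (Z m x) (Z n x) < e"
    proof (intro exI allI impI)
      fix m n assume "m \<ge> N" "n \<ge> N"
      then show "dist (Z m x) (Z n x) < e"
        using *[of n m] *[of m n] by (cases "n \<le> m") (auto simp: dist_commute)
    qed
  qed
  then have "\<exists>l. (\<lambda>n. Z n x) \<longlonglongrightarrow> l" for x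
    using Cauchy_convergent convergent_def by blast
  then obtain Y where Y: "\<And>x. (\<lambda>n. Z n x) \<longlonglongrightarrow> Y x"
    by metis
  have nY: "norm (Y x) \<le> norm x" for x
  proof (rule LIMSEQ_le_const2[OF tendsto_norm[OF Y]])
    show "\<exists>N. \<forall>n\<ge>N. norm (Z n x) \<le> norm x"
      using nZ1 by blast
  qed
  have "bounded_linear Y"
  proof (rule bounded_linear_intro[where K=1])
    show "Y (x + y) = Y x + Y y" for x y
      by (rule LIMSEQ_unique[OF Y]) (auto simp: addZ intro!: tendsto_intros Y)
    show "Y (c *\<^sub>R x) = c *\<^sub>R Y x" for c x
      by (rule LIMSEQ_unique[OF Y]) (auto simp: sclZ intro!: tendsto_intros Y)
  qed (use nY in simp)
  moreover have "Y x \<bullet> y = x \<bullet> Y y" for x y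
  proof (rule LIMSEQ_unique)
    show "(\<lambda>n. Z n x \<bullet> y) \<longlonglongrightarrow> Y x \<bullet> y" by (intro tendsto_intros Y)
    show "(\<lambda>n. Z n x \<bullet> y) \<longlonglongrightarrow> x \<bullet> Y y" unfolding symZ by (intro tendsto_intros Y)
  qed
  moreover have "Y x = (1/2) *\<^sub>R (T x + Y (Y x))" for x
  proof (rule LIMSEQ_unique)
    show "(\<lambda>n. Z (Suc n) x) \<longlonglongrightarrow> Y x"
      using LIMSEQ_Suc[OF Y[of x]] .
    have "(\<lambda>n. Z n (Z n x - Y x)) \<longlonglongrightarrow> 0"
    proof (rule Lim_null_comparison)
      show "(\<lambda>n. norm (Z n x - Y x)) \<longlonglongrightarrow> 0"
        using Y[of x] by (simp add: LIM_zero tendsto_norm_zero)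
      show "\<forall>\<^sub>F n in sequentially. norm (Z n (Z n x - Y x)) \<le> norm (Z n x - Y x)"
        by (intro always_eventually allI nZ1)
    qed
    from tendsto_add[OF this Y[of "Y x"]] have "(\<lambda>n. Z n (Z n x)) \<longlonglongrightarrow> Y (Y x)"
      by (simp add: linear_diff[OF linZ])
    then show "(\<lambda>n. Z (Suc n) x) \<longlonglongrightarrow> (1/2) *\<^sub>R (T x + Y (Y x))"
      unfolding ZS by (intro tendsto_intros)
  qed
  ultimately show thesis
    using nY by (intro that)
qed

text \<open>The root is extracted from the bounded inverse \<open>R\<close> rather than from
  \<open>A\<close>. As \<open>R\<close> lies between 0 and \<open>a\<close> in the sense of forms,
  \<open>T = 1 - R / a\<close> is a contraction; with the \<open>Y\<close> of
  \<open>contraction_sqrt_iteration\<close>, the operator \<open>Q = sqrt a (1 - Y)\<close> has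
  square \<open>R\<close>, and the inverse of \<open>Q\<close> on \<open>range Q\<close> is a root
  of \<open>A\<close>. Existence of one root is what \<open>someI\<close> asks for.\<close>

lemma coercive_sqrt_oper:
  fixes A :: "'a::{real_inner,complete_space} oper"
  assumes A: "self_adjoint A" and a: "a > 0"
    and co: "\<And>u. u \<in> Dom A \<Longrightarrow> a * (app A u \<bullet> u) \<ge> (norm u)\<^sup>2"
  shows "is_sqrt_oper (sqrt_oper A) A"
proof -
  obtain R where R: "bounded_linear R" and RD: "\<And>y. R y \<in> Dom A" and AR: "\<And>y. app A (R y) = y"
    and RA: "\<And>x. x \<in> Dom A \<Longrightarrow> R (app A x) = x" and Rsym: "\<And>x y. R x \<bullet> y = x \<bullet> R y"
    and Rle: "\<And>y. (norm (R y))\<^sup>2 \<le> a * (y \<bullet> R y)" and Rbd: "\<And>y. norm (R y) \<le> a * norm y"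
    by (rule coercive_self_adjoint_inverse[OF A a], erule co, rule that)
  define T where "T = (\<lambda>x. x - (1/a) *\<^sub>R R x)"
  have T: "bounded_linear T"
    unfolding T_def by (intro bounded_linear_sub bounded_linear_ident bounded_linear_const_scaleR R)
  have Tsym: "T x \<bullet> y = x \<bullet> T y" for x y
    by (simp add: T_def inner_diff_left inner_diff_right Rsym)
  have Tle: "norm (T x) \<le> norm x" for x
  proof -
    have "(norm (T x))\<^sup>2 = (norm x)\<^sup>2 - (2/a) * (x \<bullet> R x) + (1/a)\<^sup>2 * (norm (R x))\<^sup>2"
      unfolding T_def power2_norm_eq_inner
      by (simp add: inner_diff_left inner_diff_right inner_commute algebra_simps power2_eq_square)
    also have "\<dots> \<le> (norm x)\<^sup>2 - (2/a) * (x \<bullet> R x) + (1/a)\<^sup>2 * (a * (x \<bullet> R x))"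
      using Rle[of x] by (intro add_left_mono mult_left_mono) auto
    also have "\<dots> = (norm x)\<^sup>2 - (1/a) * (x \<bullet> R x)"
      using a by (simp add: power2_eq_square field_simps)
    also have "\<dots> \<le> (norm x)\<^sup>2"
    proof -
      have "0 \<le> a * (x \<bullet> R x)"
        using Rle[of x] zero_le_power2[of "norm (R x)"] by linarith
      then show ?thesis
        using a by (simp add: zero_le_mult_iff)
    qed
    finally show ?thesis
      by (simp add: power2_le_iff_abs_le)
  qed
  obtain Y where Y: "bounded_linear Y" and Ysym: "\<And>x y. Y x \<bullet> y = x \<bullet> Y y"
    and Yle: "\<And>x. norm (Y x) \<le> norm x" and Yeq: "\<And>x. Y x = (1/2) *\<^sub>R (T x + Y (Y x))"
    by (rule contraction_sqrt_iteration[OF T Tsym Tle]) (rule that)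
  define Q where "Q = (\<lambda>x. sqrt a *\<^sub>R (x - Y x))"
  have Q: "linear Q"
    unfolding Q_def
    by (intro bounded_linear.linear bounded_linear_const_scaleR bounded_linear_sub bounded_linear_ident Y)
  have QQ: "Q (Q x) = R x" for x
  proof -
    have "Y x + Y x = T x + Y (Y x)"
      using arg_cong[OF Yeq[of x], of "\<lambda>y. 2 *\<^sub>R y"] by (simp only: scaleR_scaleR) (simp add: scaleR_2)
    then have "x - Y x - Y (x - Y x) = (1/a) *\<^sub>R R x"
      by (simp add: linear_diff[OF bounded_linear.linear[OF Y]] T_def algebra_simps)
    then have "a *\<^sub>R (x - Y x - Y (x - Y x)) = R x"
      using a by simp
    moreover have "Q (Q x) = a *\<^sub>R (x - Y x - Y (x - Y x))"
      using a by (simp add: Q_def linear_scale[OF bounded_linear.linear[OF Y]] flip: scaleR_diff_right)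
    ultimately show ?thesis by simp
  qed
  have Qsym: "Q x \<bullet> y = x \<bullet> Q y" for x y
    by (simp add: Q_def inner_diff_left inner_diff_right Ysym)
  have Qpos: "0 \<le> Q x \<bullet> x" for x
  proof -
    have "Y x \<bullet> x \<le> norm x * norm x"
      using norm_cauchy_schwarz[of "Y x" x] mult_right_mono[OF Yle[of x] norm_ge_zero[of x]] by linarith
    then show ?thesis
      using a by (simp add: Q_def inner_diff_left power2_norm_eq_inner[symmetric] power2_eq_square)
  qed
  have Qinj: "inj Q"
  proof (rule injI)
    fix x y assume "Q x = Q y"
    then have "app A (R x) = app A (R y)" by (simp flip: QQ)
    then show "x = y" by (simp add: AR)
  qed
  have rR: "range R = Dom A"
  proof
    show "range R \<subseteq> Dom A" using RD by blast
    show "Dom A \<subseteq> range R"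
    proof
      fix x assume "x \<in> Dom A"
      then show "x \<in> range R" by (intro range_eqI[of _ _ "app A x"]) (simp add: RA)
    qed
  qed
  define S where "S = Oper (range Q) (inv Q)"
  have DS: "Dom S = range Q" and SQ: "app S (Q x) = x" for x
    by (simp_all add: S_def inv_f_f[OF Qinj])
  have lin: "linear_oper S"
    unfolding linear_oper_def DS
  proof (intro conjI ballI allI)
    show "subspace (range Q)"
      using linear_subspace_image[OF Q subspace_UNIV] .
    fix x y assume "x \<in> range Q" "y \<in> range Q"
    then obtain p q where "x = Q p" "y = Q q" by blast
    then show "app S (x + y) = app S x + app S y"
      by (simp add: SQ flip: linear_add[OF Q])
  next
    fix c x assume "x \<in> range Q"
    then obtain p where "x = Q p" by blast
    then show "app S (c *\<^sub>R x) = c *\<^sub>R app S x"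
      by (simp add: SQ flip: linear_scale[OF Q])
  qed
  have "range R \<subseteq> range Q"
    by (intro image_subsetI) (simp flip: QQ)
  then have "closure (range Q) = UNIV"
    using closure_mono[of "range R" "range Q"] self_adjointD(2)[OF A] rR by auto
  moreover have "adjoint_Dom S = Dom S"
  proof
    show "adjoint_Dom S \<subseteq> Dom S"
    proof
      fix y assume "y \<in> adjoint_Dom S"
      then obtain z where z: "\<And>x. app S (Q x) \<bullet> y = Q x \<bullet> z"
        by (auto simp: adjoint_Dom_def DS)
      have "y = Q z"
      proof (rule vector_eq_ldot[THEN iffD1, OF allI])
        show "x \<bullet> y = x \<bullet> Q z" for x
          using z[of x] Qsym[of x z] by (simp only: SQ)
      qed
      then show "y \<in> Dom S" by (simp add: DS)
    qed
    show "Dom S \<subseteq> adjoint_Dom S"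
    proof
      fix y assume "y \<in> Dom S"
      then obtain q where q: "y = Q q" by (auto simp: DS)
      have "app S (Q x) \<bullet> y = Q x \<bullet> q" for x
        by (simp only: SQ q Qsym)
      then show "y \<in> adjoint_Dom S"
        by (auto simp: adjoint_Dom_def DS)
    qed
  qed
  moreover have "app S x \<bullet> y = x \<bullet> app S y" if "x \<in> Dom S" "y \<in> Dom S" for x y
  proof -
    from that obtain p q where "x = Q p" "y = Q q" by (auto simp: DS)
    then show ?thesis by (simp add: SQ Qsym)
  qed
  ultimately have "self_adjoint S"
    using lin by (simp add: self_adjoint_def DS)
  moreover have "positive_oper S"
    unfolding positive_oper_def DS using Qpos by (auto simp: SQ inner_commute)
  moreover have "Dom A = {x \<in> Dom S. app S x \<in> Dom S}"
  proof (intro set_eqI iffI)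
    fix x assume "x \<in> Dom A"
    then obtain p where "x = Q (Q p)"
      unfolding rR[symmetric] QQ by blast
    then show "x \<in> {x \<in> Dom S. app S x \<in> Dom S}"
      by (simp only: mem_Collect_eq DS SQ rangeI simp_thms)
  next
    fix x assume "x \<in> {x \<in> Dom S. app S x \<in> Dom S}"
    then obtain p where p: "x = Q p" "app S x \<in> range Q"
      unfolding DS by blast
    then obtain q where "p = Q q"
      by (auto simp: SQ)
    then show "x \<in> Dom A"
      using p RD by (simp only: QQ)
  qed
  moreover have "app S (app S x) = app A x" if "x \<in> Dom A" for x
  proof -
    have "x = Q (Q (app A x))"
      using RA[OF that] by (simp only: QQ)
    then have "app S (app S x) = app S (app S (Q (Q (app A x))))"
      by (rule arg_cong)
    then show ?thesis by (simp only: SQ)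
  qed
  ultimately have "is_sqrt_oper S A"
    by (simp add: is_sqrt_oper_def)
  then show ?thesis
    unfolding sqrt_oper_def by (rule someI)
qed

text \<open>Only the defining properties of a root are used, since \<open>SOME\<close> need not
  return the operator constructed above. The inverse \<open>Q\<close> of the root is bounded and is
  obtained as the root applied to the inverse of \<open>A\<close>; through it all later identities
  are between bounded operators.\<close>

lemma coercive_sqrt_oper_inverse:
  fixes A :: "'a::{real_inner,complete_space} oper"
  assumes A: "self_adjoint A" and a: "a > 0"
    and co: "\<And>u. u \<in> Dom A \<Longrightarrow> a * (app A u \<bullet> u) \<ge> (norm u)\<^sup>2"
  obtains Q where "bounded_linear Q" "\<And>x y. Q x \<bullet> y = x \<bullet> Q y"
    "\<And>x. Q x \<in> Dom (sqrt_oper A)" "\<And>x. app (sqrt_oper A) (Q x) = x"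
    "\<And>x. x \<in> Dom (sqrt_oper A) \<Longrightarrow> Q (app (sqrt_oper A) x) = x"
    "\<And>x. (norm (Q x))\<^sup>2 \<le> a * (norm x)\<^sup>2"
    "\<And>x. Q (Q x) \<in> Dom A" "\<And>x. app A (Q (Q x)) = x"
    "\<And>x. x \<in> Dom A \<Longrightarrow> Q (app A x) = app (sqrt_oper A) x"
    "\<And>x. x \<in> Dom A \<Longrightarrow> x \<in> Dom (sqrt_oper A)" "closure (Dom (sqrt_oper A)) = UNIV"
proof -
  obtain R where R: "bounded_linear R" and RD: "\<And>y. R y \<in> Dom A" and AR: "\<And>y. app A (R y) = y"
    and RA: "\<And>x. x \<in> Dom A \<Longrightarrow> R (app A x) = x" and Rsym: "\<And>x y. R x \<bullet> y = x \<bullet> R y"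
    and Rle: "\<And>y. (norm (R y))\<^sup>2 \<le> a * (y \<bullet> R y)" and Rbd: "\<And>y. norm (R y) \<le> a * norm y"
    by (rule coercive_self_adjoint_inverse[OF A a], erule co, rule that)
  define S where "S = sqrt_oper A"
  have S: "is_sqrt_oper S A"
    unfolding S_def by (rule coercive_sqrt_oper[OF A a co])
  then have Ssa: "self_adjoint S" and DA: "Dom A = {x \<in> Dom S. app S x \<in> Dom S}"
    and SS: "\<And>x. x \<in> Dom A \<Longrightarrow> app S (app S x) = app A x"
    by (auto simp: is_sqrt_oper_def)
  note lin = linear_operD[OF self_adjointD(1)[OF Ssa]]
  have z: "0 \<in> Dom S" "app S 0 = 0"
    using subspace_0[OF lin(1)] lin(5)[of 0 0] by auto
  \<comment> \<open>A vector in the kernel of \<open>S\<close> lies in \<open>Dom A\<close>, because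
    its image 0 is in \<open>Dom S\<close>; coercivity of \<open>A\<close> then makes it
    vanish.\<close>
  have inj: "x = y" if "x \<in> Dom S" "y \<in> Dom S" "app S x = app S y" for x y
  proof -
    have d: "x - y \<in> Dom S" "app S (x - y) = 0"
      using that by (auto simp: lin(6,7))
    then have dA: "x - y \<in> Dom A"
      using z by (simp add: DA)
    then have "app A (x - y) = 0"
      using SS[OF dA] d z by simp
    then have "(norm (x - y))\<^sup>2 \<le> 0"
      using co[OF dA] by simp
    then show ?thesis by simp
  qed
  define Q where "Q = (\<lambda>y. app S (R y))"
  have RS: "R y \<in> Dom S" for y
    using RD[of y] by (simp add: DA)
  have QD: "Q y \<in> Dom S" for y
    using RD[of y] by (simp add: DA Q_def)
  have SQ: "app S (Q y) = y" for y
    using SS[OF RD[of y]] by (simp add: Q_def AR)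
  have QS: "Q (app S x) = x" if "x \<in> Dom S" for x
    by (rule inj) (simp_all add: QD that SQ)
  have Qsym: "Q x \<bullet> y = x \<bullet> Q y" for x y
    using self_adjointD(3)[OF Ssa QD[of x] QD[of y]] by (simp add: SQ)
  have Qle: "(norm (Q x))\<^sup>2 \<le> a * (norm x)\<^sup>2" for x
  proof -
    have "(norm (Q x))\<^sup>2 = x \<bullet> R x"
      using self_adjointD(3)[OF Ssa QD[of x] RS[of x]] by (simp only: power2_norm_eq_inner SQ) (simp only: Q_def)
    also have "\<dots> \<le> norm x * (a * norm x)"
      using norm_cauchy_schwarz[of x "R x"] mult_left_mono[OF Rbd[of x] norm_ge_zero[of x]] by linarith
    finally show ?thesis by (simp add: power2_eq_square mult.left_commute)
  qed
  have "bounded_linear Q"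
  proof (rule bounded_linear_intro[where K="sqrt a"])
    show "Q (x + y) = Q x + Q y" for x y
      by (rule inj) (simp_all add: QD SQ lin(2,4))
    show "Q (r *\<^sub>R x) = r *\<^sub>R Q x" for r x
      by (rule inj) (simp_all add: QD SQ lin(3,5))
    show "norm (Q x) \<le> norm x * sqrt a" for x
      using real_sqrt_le_mono[OF Qle[of x]] by (simp add: real_sqrt_mult mult.commute)
  qed
  moreover have QQ: "Q (Q x) \<in> Dom A" for x
    by (simp add: DA QD SQ)
  moreover have "app A (Q (Q x)) = x" for x
    using SS[OF QQ[of x]] by (simp add: SQ)
  moreover have "Q (app A x) = app S x" if "x \<in> Dom A" for x
    by (simp add: Q_def RA that)
  moreover have "x \<in> Dom S" if "x \<in> Dom A" for x
    using that by (simp add: DA)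
  ultimately show thesis
    using Qsym QD SQ QS Qle self_adjointD(2)[OF Ssa] unfolding S_def by (intro that[of Q])
qed

section \<open>Convolutions\<close>

text \<open>Young's inequality for an integrable kernel and a square integrable function.
  Cauchy-Schwarz for the measure with density \<open>q\<close> bounds the squared convolution by the
  mass of \<open>q\<close> times the convolution of \<open>q\<close> with the square of
  \<open>F\<close>; Tonelli and translation invariance do the rest. Nonnegative Lebesgue integrals
  carry the argument, as \<open>q\<close> is merely integrable.\<close>

lemma young_square_core:
  fixes q F Y :: "real \<Rightarrow> real"
  assumes q: "q integrable_on {0<..}" and q0: "\<And>s. 0 \<le> s \<Longrightarrow> 0 \<le> q s"
    and F: "continuous_on {0..} F" and F0: "\<And>s. 0 \<le> s \<Longrightarrow> 0 \<le> F s"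
    and Y: "continuous_on {0..T} Y" and Y0: "\<And>t. t \<in> {0..T} \<Longrightarrow> 0 \<le> Y t"
    and le: "\<And>t. t \<in> {0..T} \<Longrightarrow> Y t \<le> integral {0..t} (\<lambda>s. q s * F (t - s))"
  shows "integral {0..T} (\<lambda>t. (Y t)\<^sup>2) \<le> (integral {0<..} q)\<^sup>2 * integral {0..T} (\<lambda>t. (F t)\<^sup>2)"
proof -
  define P where "P = integral {0<..} q"
  have P0: "0 \<le> P"
    unfolding P_def using q by (rule integral_nonneg) (auto intro: q0)
  have qP: "((\<lambda>s. indicator {0<..} s * q s) has_integral P) UNIV"
    using q unfolding P_def indicator_times_eq_if has_integral_restrict_UNIV by (rule integrable_integral)
  have qm: "(\<lambda>s. indicator {0<..} s * q s) \<in> lebesgue \<rightarrow>\<^sub>M borel"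
    and qn: "(\<integral>\<^sup>+s. ennreal (indicator {0<..} s * q s) \<partial>lebesgue) = P"
    using has_integral_iff_nn_integral_lebesgue[of "\<lambda>s. indicator {0<..} s * q s" P] qP q0
    by (auto simp: indicator_def)
  \<comment> \<open>Tonelli requires joint measurability, hence a Borel representative of
    \<open>q\<close>; the truncation in \<open>r\<close> makes it nonnegative everywhere.\<close>
  obtain q' where q'[measurable]: "q' \<in> borel_measurable borel"
    and eq': "AE s in lborel. indicator {0<..} s * q s = q' s"
    using completion_ex_borel_measurable_real[OF qm] by auto
  define r where "r s = max 0 (q' s)" for s
  have r[measurable]: "r \<in> borel_measurable borel"
    unfolding r_def by measurable
  have r0: "0 \<le> r s" for s
    by (simp add: r_def)
  have eq: "AE s in lborel. indicator {0<..} s * q s = r s"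
    using eq'
  proof eventually_elim
    case (elim s)
    have "0 \<le> indicator {0<..} s * q s"
      using q0[of s] by (auto simp: indicator_def)
    then show ?case
      by (simp only: elim r_def max_absorb2)
  qed
  have rP: "(\<integral>\<^sup>+s. ennreal (r s) \<partial>lborel) = P"
  proof -
    have "(\<integral>\<^sup>+s. ennreal (r s) \<partial>lborel) = (\<integral>\<^sup>+s. ennreal (indicator {0<..} s * q s) \<partial>lborel)"
      using eq by (intro nn_integral_cong_AE) auto
    with qn show ?thesis
      by (simp add: nn_integral_completion)
  qed
  define H where "H t = indicator {0..T} t * F t" for t
  have H[measurable]: "H \<in> borel_measurable borel"
    unfolding H_def real_scaleR_def[symmetric]
    by (rule borel_measurable_continuous_on_indicator) (auto intro: continuous_on_subset[OF F])
  have H0: "0 \<le> H t" for t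
    by (auto simp: H_def indicator_def F0)
  have Yle: "ennreal (Y t) \<le> (\<integral>\<^sup>+s. ennreal (r s * H (t - s)) \<partial>lborel)" if t: "t \<in> {0..T}" for t
  proof (cases "(\<lambda>s. q s * F (t - s)) integrable_on {0..t}")
    \<comment> \<open>A function that is not integrable has integral 0 by convention, so the
      hypothesis then forces \<open>Y t \<le> 0\<close>.\<close>
    case False
    then have "Y t \<le> 0"
      using le[OF t] by (simp add: not_integrable_integral)
    then show ?thesis
      by (simp add: ennreal_neg)
  next
    case True
    have "(\<integral>\<^sup>+s. ennreal (q s * F (t - s)) * indicator {0..t} s \<partial>lborel)
        = ennreal (integral {0..t} (\<lambda>s. q s * F (t - s)))"
      using True by (intro nn_integral_has_integral_lebesgue' integrable_integral) (auto intro!: mult_nonneg_nonneg q0 F0)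
    moreover have "(\<integral>\<^sup>+s. ennreal (q s * F (t - s)) * indicator {0..t} s \<partial>lborel)
        = (\<integral>\<^sup>+s. ennreal (r s * H (t - s)) \<partial>lborel)"
    proof (intro nn_integral_cong_AE)
      \<comment> \<open>The point 0 belongs to \<open>{0..t}\<close> but not to the set
        \<open>{0<..}\<close> on which \<open>r\<close> represents \<open>q\<close>; it is a null
        set.\<close>
      show "AE s in lborel. ennreal (q s * F (t - s)) * indicator {0..t} s = ennreal (r s * H (t - s))"
        using eq AE_lborel_singleton[of 0]
      proof eventually_elim
        case (elim s)
        show ?case
          unfolding elim(1)[symmetric] H_def using elim(2) t by (auto simp: indicator_def)
      qed
    qed
    ultimately show ?thesis
      using le[OF t] by (simp add: ennreal_leI)
  qed
  have CS: "(\<integral>\<^sup>+s. ennreal (r s * H (t - s)) \<partial>lborel)\<^sup>2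
      \<le> P * (\<integral>\<^sup>+s. ennreal (r s * (H (t - s))\<^sup>2) \<partial>lborel)" for t
  proof -
    have "(\<integral>\<^sup>+s. ennreal (r s * H (t - s)) \<partial>lborel)\<^sup>2
        = (\<integral>\<^sup>+s. ennreal (sqrt (r s)) * ennreal (sqrt (r s) * H (t - s)) \<partial>lborel)\<^sup>2"
      by (simp add: r0 H0 flip: ennreal_mult mult.assoc)
    also have "\<dots> \<le> (\<integral>\<^sup>+s. (ennreal (sqrt (r s)))\<^sup>2 \<partial>lborel) * (\<integral>\<^sup>+s. (ennreal (sqrt (r s) * H (t - s)))\<^sup>2 \<partial>lborel)"
      by (rule Cauchy_Schwarz_nn_integral) measurable
    also have "\<dots> = P * (\<integral>\<^sup>+s. ennreal (r s * (H (t - s))\<^sup>2) \<partial>lborel)"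
      by (simp add: r0 H0 ennreal_power power_mult_distrib rP)
    finally show ?thesis .
  qed
  have Y2: "((\<lambda>t. (Y t)\<^sup>2) has_integral integral {0..T} (\<lambda>t. (Y t)\<^sup>2)) {0..T}"
    by (intro integrable_integral integrable_continuous_interval continuous_intros Y)
  have F2: "((\<lambda>t. (F t)\<^sup>2) has_integral integral {0..T} (\<lambda>t. (F t)\<^sup>2)) {0..T}"
    by (intro integrable_integral integrable_continuous_interval continuous_intros continuous_on_subset[OF F]) auto
  have "ennreal (integral {0..T} (\<lambda>t. (Y t)\<^sup>2)) = (\<integral>\<^sup>+t. ennreal ((Y t)\<^sup>2) * indicator {0..T} t \<partial>lborel)"
    using Y2 by (intro nn_integral_has_integral_lebesgue'[symmetric]) auto
  also have "\<dots> \<le> (\<integral>\<^sup>+t. P * (\<integral>\<^sup>+s. ennreal (r s * (H (t - s))\<^sup>2) \<partial>lborel) \<partial>lborel)"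
  proof (intro nn_integral_mono)
    fix t
    show "ennreal ((Y t)\<^sup>2) * indicator {0..T} t \<le> P * (\<integral>\<^sup>+s. ennreal (r s * (H (t - s))\<^sup>2) \<partial>lborel)"
    proof (cases "t \<in> {0..T}")
      case True
      then have "ennreal ((Y t)\<^sup>2) \<le> (\<integral>\<^sup>+s. ennreal (r s * H (t - s)) \<partial>lborel)\<^sup>2"
        using Yle[OF True] Y0[OF True] by (simp add: power_mono flip: ennreal_power)
      with CS[of t] True show ?thesis by simp
    qed simp
  qed
  also have "\<dots> = P * (\<integral>\<^sup>+t. (\<integral>\<^sup>+s. ennreal (r s * (H (t - s))\<^sup>2) \<partial>lborel) \<partial>lborel)"
    by (rule nn_integral_cmult) measurable
  also have "(\<integral>\<^sup>+t. (\<integral>\<^sup>+s. ennreal (r s * (H (t - s))\<^sup>2) \<partial>lborel) \<partial>lborel)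
      = (\<integral>\<^sup>+s. (\<integral>\<^sup>+t. ennreal (r s * (H (t - s))\<^sup>2) \<partial>lborel) \<partial>lborel)"
    by (rule lborel_pair.Fubini') measurable
  also have "\<dots> = (\<integral>\<^sup>+s. ennreal (r s) * ennreal (integral {0..T} (\<lambda>t. (F t)\<^sup>2)) \<partial>lborel)"
  proof (intro nn_integral_cong)
    fix s
    have "(\<integral>\<^sup>+t. ennreal (r s * (H (t - s))\<^sup>2) \<partial>lborel) = ennreal (r s) * (\<integral>\<^sup>+t. ennreal ((H (t - s))\<^sup>2) \<partial>lborel)"
      by (simp add: ennreal_mult r0 nn_integral_cmult)
    also have "(\<integral>\<^sup>+t. ennreal ((H (t - s))\<^sup>2) \<partial>lborel) = (\<integral>\<^sup>+t. ennreal ((H t)\<^sup>2) \<partial>lborel)"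
      by (subst (2) nn_integral_real_affine[where c=1 and t="-s"]) (auto simp: add.commute)
    also have "\<dots> = (\<integral>\<^sup>+t. ennreal ((F t)\<^sup>2) * indicator {0..T} t \<partial>lborel)"
      by (intro nn_integral_cong) (auto simp: H_def indicator_def)
    also have "\<dots> = ennreal (integral {0..T} (\<lambda>t. (F t)\<^sup>2))"
      using F2 by (intro nn_integral_has_integral_lebesgue') auto
    finally show "(\<integral>\<^sup>+t. ennreal (r s * (H (t - s))\<^sup>2) \<partial>lborel) = ennreal (r s) * ennreal (integral {0..T} (\<lambda>t. (F t)\<^sup>2))" .
  qed
  also have "\<dots> = P * ennreal (integral {0..T} (\<lambda>t. (F t)\<^sup>2))"
    by (simp add: nn_integral_multc rP)
  also have "P * (P * ennreal (integral {0..T} (\<lambda>t. (F t)\<^sup>2))) = ennreal (P\<^sup>2 * integral {0..T} (\<lambda>t. (F t)\<^sup>2))"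
    using P0 has_integral_nonneg[OF F2] by (simp add: ennreal_mult' power2_eq_square mult.assoc)
  finally show ?thesis
    using P0 has_integral_nonneg[OF F2] unfolding P_def by (subst (asm) ennreal_le_iff) auto
qed

text \<open>Rests on \<open>t + 1 \<le> (s + 1) * (t - s + 1)\<close>. It distributes a weight over
  the two factors of a convolution.\<close>

lemma weight_submultiplicative:
  fixes m s t :: real
  assumes "0 \<le> m" "0 \<le> s" "s \<le> t"
  shows "(t + 1) powr m \<le> (s + 1) powr m * (t - s + 1) powr m"
proof -
  have "0 \<le> s * (t - s)" using assms by simp
  then have "t + 1 \<le> (s + 1) * (t - s + 1)"
    by (simp add: algebra_simps)
  then have "(t + 1) powr m \<le> ((s + 1) * (t - s + 1)) powr m"
    using assms by (intro powr_mono2) auto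
  then show ?thesis
    using assms by (simp add: powr_mult)
qed

lemma weight_integrable_product:
  fixes p f :: "real \<Rightarrow> real"
  assumes p: "p absolutely_integrable_on {0<..}" and f: "continuous_on {0..} f" and t: "0 \<le> t"
  shows "(\<lambda>s. \<bar>p s\<bar> * f (t - s)) integrable_on {0..t}" "(\<lambda>s. p s * f (t - s)) integrable_on {0..t}"
proof -
  have p': "p absolutely_integrable_on {0..t}"
  proof -
    have "p absolutely_integrable_on {0<..<t}"
      by (rule set_integrable_subset[OF p]) auto
    then show ?thesis
      by (simp add: absolutely_integrable_on_Icc_iff_Ioo)
  qed
  have ft: "continuous_on {0..t} (\<lambda>s. f (t - s))"
    by (rule continuous_on_compose2[OF f]) (auto intro!: continuous_intros)
  have ftm: "(\<lambda>s. f (t - s)) \<in> borel_measurable (lebesgue_on {0..t})"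
    by (rule continuous_imp_measurable_on_sets_lebesgue[OF ft]) auto
  have ftb: "bounded ((\<lambda>s. f (t - s)) ` {0..t})"
    by (rule compact_imp_bounded[OF compact_continuous_image[OF ft]]) auto
  have "(\<lambda>s. f (t - s) * p s) absolutely_integrable_on {0..t}"
    using absolutely_integrable_bounded_measurable_product_real[OF ftm _ ftb p'] by simp
  then show "(\<lambda>s. p s * f (t - s)) integrable_on {0..t}"
    using set_lebesgue_integral_eq_integral(1) by (simp add: mult.commute)
  have "(\<lambda>s. f (t - s) * \<bar>p s\<bar>) absolutely_integrable_on {0..t}"
    using absolutely_integrable_bounded_measurable_product_real[OF ftm _ ftb set_integrable_abs[OF p']] by simp
  then show "(\<lambda>s. \<bar>p s\<bar> * f (t - s)) integrable_on {0..t}"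
    using set_lebesgue_integral_eq_integral(1) by (simp add: mult.commute)
qed

lemma absolutely_integrable_lower_weight:
  fixes p :: "real \<Rightarrow> real"
  assumes p: "(\<lambda>t. (t + 1) powr n * p t) absolutely_integrable_on {0<..}" and mn: "m \<le> n"
  shows "(\<lambda>t. (t + 1) powr m * p t) absolutely_integrable_on {0<..}"
proof -
  have "(\<lambda>s. (s + 1) powr (m - n) * ((s + 1) powr n * p s)) absolutely_integrable_on {0<..}"
  proof (rule absolutely_integrable_bounded_measurable_product_real[OF _ _ _ p])
    show "(\<lambda>s::real. (s + 1) powr (m - n)) \<in> borel_measurable (lebesgue_on {0<..})"
      by (rule continuous_imp_measurable_on_sets_lebesgue) (auto intro!: continuous_intros)
    have "(s + 1) powr (m - n) \<le> 1" if "s > 0" for s :: real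
      using mn that powr_mono[of "m - n" 0 "s+1"] by simp
    then show "bounded ((\<lambda>s::real. (s + 1) powr (m - n)) ` {0<..})"
      by (auto simp: bounded_iff intro!: exI[of _ 1])
  qed auto
  then show ?thesis
    by (rule set_integrable_cong[OF refl refl, THEN iffD1, rotated])
      (simp only: mult.assoc[symmetric] powr_add[symmetric] diff_add_cancel)
qed

lemma absolutely_integrable_drop_weight:
  fixes p :: "real \<Rightarrow> real"
  assumes p: "(\<lambda>t. (t + 1) powr n * p t) absolutely_integrable_on {0<..}" and n: "0 \<le> n"
  shows "p absolutely_integrable_on {0<..}"
  using absolutely_integrable_lower_weight[OF p n]
  by (rule set_integrable_cong[OF refl refl, THEN iffD1, rotated]) auto

lemma weighted_abs_integrable:
  fixes p :: "real \<Rightarrow> real"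
  assumes "(\<lambda>t. (t + 1) powr n * p t) absolutely_integrable_on S"
  shows "(\<lambda>t. (t + 1) powr n * \<bar>p t\<bar>) integrable_on S"
proof -
  have "(\<lambda>s. \<bar>(s + 1) powr n * p s\<bar>) integrable_on S"
    using assms by (simp add: absolutely_integrable_on_def)
  then show ?thesis
    by (simp add: abs_mult)
qed

text \<open>The weight with exponent \<open>m\<close> on a square is the square of the weight with
  exponent \<open>m / 2\<close>, which \<open>weight_submultiplicative\<close> spreads over kernel
  and function. Domination of \<open>X\<close> by a scalar convolution is all that is asked, so
  norms of vector-valued convolutions and the discontinuous kernel \<open>g'\<close> are
  covered.\<close>

lemma weighted_young:
  fixes p f X :: "real \<Rightarrow> real"
  assumes m: "0 \<le> m" and p: "(\<lambda>s. (s + 1) powr (m / 2) * p s) absolutely_integrable_on {0<..}"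
    and f: "continuous_on {0..} f" and f0: "\<And>s. 0 \<le> s \<Longrightarrow> 0 \<le> f s"
    and X: "continuous_on {0..} X"
    and le: "\<And>t. 0 \<le> t \<Longrightarrow> \<bar>X t\<bar> \<le> integral {0..t} (\<lambda>s. \<bar>p s\<bar> * f (t - s))"
  shows "integral {0..T} (\<lambda>t. (t + 1) powr m * (X t)\<^sup>2)
    \<le> (integral {0<..} (\<lambda>s. (s + 1) powr (m / 2) * \<bar>p s\<bar>))\<^sup>2 * integral {0..T} (\<lambda>t. (t + 1) powr m * (f t)\<^sup>2)"
proof -
  let ?w = "\<lambda>t. (t + 1) powr (m / 2)"
  have cw: "continuous_on {0..} ?w"
    by (auto intro!: continuous_intros)
  have sq: "(t + 1) powr m * y\<^sup>2 = (?w t * y)\<^sup>2" if "0 \<le> t" for t y :: real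
    using that by (simp add: power_mult_distrib powr_power)
  have pw: "(\<lambda>s. ?w s * \<bar>p s\<bar>) integrable_on {0<..}"
  by (rule weighted_abs_integrable[OF p])
  have "integral {0..T} (\<lambda>t. (?w t * \<bar>X t\<bar>)\<^sup>2)
    \<le> (integral {0<..} (\<lambda>s. ?w s * \<bar>p s\<bar>))\<^sup>2 * integral {0..T} (\<lambda>t. (?w t * f t)\<^sup>2)"
  proof (rule young_square_core[OF pw])
    show "continuous_on {0..} (\<lambda>t. ?w t * f t)"
      by (intro continuous_intros cw f)
    show "continuous_on {0..T} (\<lambda>t. ?w t * \<bar>X t\<bar>)"
      by (intro continuous_intros continuous_on_subset[OF cw] continuous_on_subset[OF X]) auto
    show "?w t * \<bar>X t\<bar> \<le> integral {0..t} (\<lambda>s. ?w s * \<bar>p s\<bar> * (?w (t - s) * f (t - s)))"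
      if "t \<in> {0..T}" for t
    proof -
      have t: "0 \<le> t" using that by simp
      have p1: "p absolutely_integrable_on {0<..}"
        by (rule absolutely_integrable_drop_weight[OF p]) (use m in simp)
      have "?w t * \<bar>X t\<bar> \<le> ?w t * integral {0..t} (\<lambda>s. \<bar>p s\<bar> * f (t - s))"
        using le[OF t] by (intro mult_left_mono) auto
      also have "\<dots> = integral {0..t} (\<lambda>s. ?w t * (\<bar>p s\<bar> * f (t - s)))"
        by simp
      also have "\<dots> \<le> integral {0..t} (\<lambda>s. ?w s * \<bar>p s\<bar> * (?w (t - s) * f (t - s)))"
      proof (rule integral_le)
        show "(\<lambda>s. ?w t * (\<bar>p s\<bar> * f (t - s))) integrable_on {0..t}"
          using integrable_on_cmult_left[OF weight_integrable_product(1)[OF p1 f t], of "?w t"] by simp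
        have "(\<lambda>s. \<bar>?w s * p s\<bar> * (?w (t - s) * f (t - s))) integrable_on {0..t}"
          by (rule weight_integrable_product(1)[OF p _ t]) (intro continuous_intros cw f)
        then show "(\<lambda>s. ?w s * \<bar>p s\<bar> * (?w (t - s) * f (t - s))) integrable_on {0..t}"
          by (simp add: abs_mult)
        show "?w t * (\<bar>p s\<bar> * f (t - s)) \<le> ?w s * \<bar>p s\<bar> * (?w (t - s) * f (t - s))" if s: "s \<in> {0..t}" for s
        proof -
          have "?w t * (\<bar>p s\<bar> * f (t - s)) \<le> (?w s * ?w (t - s)) * (\<bar>p s\<bar> * f (t - s))"
            using s m f0 by (intro mult_right_mono weight_submultiplicative) auto
          then show ?thesis by (simp add: mult_ac)
        qed
      qed
      finally show ?thesis .
    qed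
  qed (auto intro!: mult_nonneg_nonneg f0)
  moreover have "integral {0..T} (\<lambda>t. (?w t * \<bar>X t\<bar>)\<^sup>2) = integral {0..T} (\<lambda>t. (t + 1) powr m * (X t)\<^sup>2)"
    by (rule integral_cong) (simp add: sq power_mult_distrib)
  moreover have "integral {0..T} (\<lambda>t. (?w t * f t)\<^sup>2) = integral {0..T} (\<lambda>t. (t + 1) powr m * (f t)\<^sup>2)"
    by (rule integral_cong) (simp add: sq)
  ultimately show ?thesis by simp
qed

section \<open>Convolutions with vector-valued functions: continuity, derivatives, partial
  integration\<close>

lemma convol_integrable:
  fixes w :: "real \<Rightarrow> 'a::{real_inner,complete_space}"
  assumes h: "continuous_on {0..} h" and w: "continuous_on {0..} w"
  shows "(\<lambda>s. h (t - s) *\<^sub>R w s) integrable_on {0..t}" "(\<lambda>s. h s *\<^sub>R w (t - s)) integrable_on {0..t}"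
proof -
  have *: "continuous_on {0..t} (\<lambda>s. h (t - s))" "continuous_on {0..t} (\<lambda>s. w (t - s))"
    by (auto intro!: continuous_on_compose2[OF h] continuous_on_compose2[OF w] continuous_intros)
  show "(\<lambda>s. h (t - s) *\<^sub>R w s) integrable_on {0..t}"
    by (intro integrable_continuous_hilbert continuous_intros * continuous_on_subset[OF w]) auto
  show "(\<lambda>s. h s *\<^sub>R w (t - s)) integrable_on {0..t}"
    by (intro integrable_continuous_hilbert continuous_intros * continuous_on_subset[OF h]) auto
qed

lemma convol_reflect:
  fixes w :: "real \<Rightarrow> 'a::{real_inner,complete_space}"
  assumes h: "continuous_on {0..} h" and w: "continuous_on {0..} w"
  shows "convol h w t = integral {0..t} (\<lambda>s. h s *\<^sub>R w (t - s))"
proof -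
  have "((\<lambda>s. h (t - s) *\<^sub>R w s) has_integral convol h w t) (cbox 0 t)"
    unfolding convol_def by (simp add: integrable_integral[OF convol_integrable(1)[OF h w]])
  from has_integral_affinity[OF this, of "-1" t]
  have "((\<lambda>s. h s *\<^sub>R w (t - s)) has_integral convol h w t) ((\<lambda>x. t - x) ` {0..t})"
    by simp
  moreover have "(\<lambda>x. t - x) ` {0..t} = {0..t}"
    by (auto simp: image_iff intro!: bexI[of _ "t - _"])
  ultimately show ?thesis
    by (simp add: integral_unique)
qed

lemma convol_bounded_linear:
  fixes w :: "real \<Rightarrow> 'a::{real_inner,complete_space}" and L :: "'a \<Rightarrow> 'b::real_normed_vector"
  assumes L: "bounded_linear L" and h: "continuous_on {0..} h" and w: "continuous_on {0..} w"
  shows "L (convol h w t) = convol h (\<lambda>s. L (w s)) t"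
  using integral_linear[OF convol_integrable(1)[OF h w] L, of t]
  by (simp add: convol_def o_def linear_scale[OF bounded_linear.linear[OF L]])

lemma norm_convol_le:
  fixes w :: "real \<Rightarrow> 'a::{real_inner,complete_space}"
  assumes h: "continuous_on {0..} h" and w: "continuous_on {0..} w"
  shows "norm (convol h w t) \<le> integral {0..t} (\<lambda>s. \<bar>h s\<bar> * norm (w (t - s)))"
  unfolding convol_reflect[OF h w]
proof (rule norm_integral_le_hilbert)
  have "continuous_on {0..t} (\<lambda>s. w (t - s))"
    by (rule continuous_on_compose2[OF w]) (auto intro!: continuous_intros)
  then show "(\<lambda>s. \<bar>h s\<bar> * norm (w (t - s))) integrable_on {0..t}"
    by (intro integrable_continuous_interval continuous_intros continuous_on_subset[OF h]) auto
qed (auto intro: convol_integrable(2)[OF h w])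

text \<open>The mean value inequality is applied to the pairing with the Taylor remainder itself.
  That test vector depends on \<open>y\<close>, but norm continuity of \<open>b'\<close> makes the
  estimate uniform in it. Derivatives of Hilbert-space-valued integrals thus follow from scalar
  calculus.\<close>

lemma has_vector_derivative_from_weak:
  fixes b b' :: "real \<Rightarrow> 'a::real_inner"
  assumes weak: "\<And>t x. 0 \<le> t \<Longrightarrow> ((\<lambda>s. b s \<bullet> x) has_real_derivative (b' t \<bullet> x)) (at t within {0..})"
    and cont: "continuous_on {0..} b'" and t: "0 \<le> t"
  shows "(b has_vector_derivative b' t) (at t within {0..})"
  unfolding has_vector_derivative_def has_derivative_within_alt
proof (intro conjI allI impI)
  show "bounded_linear (\<lambda>x. x *\<^sub>R b' t)"
    by (rule bounded_linear_scaleR_left)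
  fix e :: real assume e: "0 < e"
  obtain d where d: "d > 0" and dd: "\<And>s. s \<in> {0..} \<Longrightarrow> dist s t < d \<Longrightarrow> dist (b' s) (b' t) < e"
    using cont[unfolded continuous_on_iff, rule_format, of t e] t e by auto
  show "\<exists>d>0. \<forall>y\<in>{0..}. norm (y - t) < d \<longrightarrow> norm (b y - b t - (y - t) *\<^sub>R b' t) \<le> e * norm (y - t)"
  proof (intro exI[of _ d] conjI d ballI impI)
    fix y :: real assume y: "y \<in> {0..}" and yd: "norm (y - t) < d"
    define x where "x = b y - b t - (y - t) *\<^sub>R b' t"
    have "norm (b y \<bullet> x - b t \<bullet> x - (y - t) * (b' t \<bullet> x)) \<le> (e * norm x) * norm (y - t)"
    proof -
      define D where "D s = b s \<bullet> x - s * (b' t \<bullet> x)" for s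
      have D: "(D has_derivative (\<lambda>h. h * ((b' s - b' t) \<bullet> x))) (at s within closed_segment t y)"
        if "s \<in> closed_segment t y" for s
      proof -
        have s: "0 \<le> s" and sub: "closed_segment t y \<subseteq> {0..}"
          using that t y by (auto simp: closed_segment_eq_real_ivl split: if_splits)
        have "((\<lambda>s. b s \<bullet> x - s * (b' t \<bullet> x)) has_real_derivative (b' s - b' t) \<bullet> x) (at s within closed_segment t y)"
          by (auto intro!: derivative_eq_intros DERIV_subset[OF weak[OF s] sub] simp: inner_diff_left)
        then show ?thesis
          unfolding D_def has_field_derivative_def by (simp add: mult_commute_abs)
      qed
      have "norm (D y - D t) \<le> e * norm x * norm (y - t)"
      proof (rule differentiable_bound[OF convex_closed_segment D])
        fix s assume s: "s \<in> closed_segment t y"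
        have "dist s t \<le> dist y t"
          using s by (auto simp: closed_segment_eq_real_ivl dist_real_def split: if_splits)
        then have "dist s t < d" "s \<in> {0..}"
          using yd s t y by (auto simp: closed_segment_eq_real_ivl dist_real_def split: if_splits)
        then have "norm (b' s - b' t) \<le> e"
          using dd[of s] by (simp add: dist_norm)
        have "\<bar>(b' s - b' t) \<bullet> x\<bar> \<le> e * norm x"
          using Cauchy_Schwarz_ineq2[of "b' s - b' t" x] mult_right_mono[OF \<open>norm (b' s - b' t) \<le> e\<close>, of "norm x"]
          by simp
        then show "onorm (\<lambda>h. h * ((b' s - b' t) \<bullet> x)) \<le> e * norm x"
          by (intro onorm_le) (simp add: abs_mult mult_left_mono mult.commute[of "e * norm x"])
      qed auto
      then show ?thesis
        by (simp add: D_def algebra_simps)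
    qed
    then have "norm (x \<bullet> x) \<le> (e * norm x) * norm (y - t)"
      by (simp add: x_def inner_diff_left)
    then have "norm x * norm x \<le> (e * norm (y - t)) * norm x"
      by (simp add: power2_norm_eq_inner[symmetric] power2_eq_square mult_ac)
    then have "norm x \<le> e * norm (y - t)"
      by (cases "x = 0") (use e in auto)
    then show "norm (b y - b t - (y - t) *\<^sub>R b' t) \<le> e * norm (y - t)"
      by (simp add: x_def)
  qed
qed

lemma integral_has_real_derivative_within:
  fixes f :: "real \<Rightarrow> real"
  assumes f: "continuous_on {0..} f" and t: "0 \<le> t"
  shows "((\<lambda>s. integral {0..s} f) has_real_derivative f t) (at t within {0..})"
proof -
  have "((\<lambda>s. integral {0..s} f) has_real_derivative f t) (at t within {0..t+1})"
    by (rule integral_has_real_derivative[OF continuous_on_subset[OF f]]) (use t in auto)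
  moreover have "at t within {0..t+1} = at t within {0..}"
    by (rule at_within_nhd[of _ "{..<t+1}"]) auto
  ultimately show ?thesis by simp
qed

lemma integral_has_vector_derivative_hilbert:
  fixes f :: "real \<Rightarrow> 'a::{real_inner,complete_space}"
  assumes f: "continuous_on {0..} f" and t: "0 \<le> t"
  shows "((\<lambda>s. integral {0..s} f) has_vector_derivative f t) (at t within {0..})"
proof (rule has_vector_derivative_from_weak[OF _ f t])
  fix t :: real and x assume t: "0 \<le> t"
  have "((\<lambda>s. integral {0..s} (\<lambda>r. f r \<bullet> x)) has_real_derivative f t \<bullet> x) (at t within {0..})"
    by (intro integral_has_real_derivative_within t continuous_intros f)
  moreover have "integral {0..s} (\<lambda>r. f r \<bullet> x) = integral {0..s} f \<bullet> x" for s
    by (intro integral_inner_left integrable_continuous_hilbert continuous_on_subset[OF f]) auto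
  ultimately show "((\<lambda>s. integral {0..s} f \<bullet> x) has_real_derivative f t \<bullet> x) (at t within {0..})"
    by simp
qed

lemma continuous_on_halfline:
  fixes f :: "real \<Rightarrow> 'a::topological_space"
  assumes "\<And>T. 0 < T \<Longrightarrow> continuous_on {0..T} f"
  shows "continuous_on {0..} f"
  unfolding continuous_on_eq_continuous_within
proof
  fix t :: real assume t: "t \<in> {0..}"
  have "continuous (at t within {0..t+1}) f"
    using assms[of "t+1"] t by (auto simp: continuous_on_eq_continuous_within)
  moreover have "at t within {0..t+1} = at t within {0..}"
    by (rule at_within_nhd[of _ "{..<t+1}"]) auto
  ultimately show "continuous (at t within {0..}) f"
    by (simp add: continuous_within)
qed

text \<open>After subtraction of \<open>w 0\<close> the function \<open>w\<close> extends continuously by \<open>0\<close> to negative times, and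
  the convolution becomes an integral over a fixed interval.\<close>

lemma convol_continuous:
  fixes w :: "real \<Rightarrow> 'a::{real_inner,complete_space}"
  assumes h: "continuous_on {0..} h" and w: "continuous_on {0..} w"
  shows "continuous_on {0..} (convol h w)"
proof (rule continuous_on_halfline)
  fix T :: real assume T: "0 < T"
  define e where "e r = w (max 0 r) - w 0" for r
  have e: "continuous_on UNIV e"
    unfolding e_def by (intro continuous_intros continuous_on_compose2[OF w]) auto
  have e0: "e r = 0" if "r \<le> 0" for r
    using that by (simp add: e_def max_def)
  have hT: "continuous_on {0..T} h"
    by (rule continuous_on_subset[OF h]) auto
  have eT: "continuous_on S (\<lambda>s. e (t - s))" for S t
    by (rule continuous_on_compose2[OF e]) (auto intro!: continuous_intros)
  have int: "(\<lambda>s. h s *\<^sub>R e (t - s)) integrable_on {0..T}" for t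
    by (intro integrable_continuous_hilbert continuous_intros hT eT)
  have eq: "convol h w t = integral {0..t} h *\<^sub>R w 0 + integral {0..T} (\<lambda>s. h s *\<^sub>R e (t - s))"
    if t: "t \<in> {0..T}" for t
  proof (rule vector_eq_rdot[THEN iffD1, OF allI])
    fix x
    have ht: "continuous_on {0..t} h" by (rule continuous_on_subset[OF h]) auto
    have "convol h w t \<bullet> x = integral {0..t} (\<lambda>s. h s * (w (t - s) \<bullet> x))"
      unfolding convol_reflect[OF h w] using integral_inner_left[OF convol_integrable(2)[OF h w], of t x] by simp
    also have "\<dots> = integral {0..t} (\<lambda>s. h s * (w 0 \<bullet> x) + h s * (e (t - s) \<bullet> x))"
      by (rule integral_cong) (auto simp: e_def inner_diff_left algebra_simps)
    also have "\<dots> = integral {0..t} (\<lambda>s. h s * (w 0 \<bullet> x)) + integral {0..t} (\<lambda>s. h s * (e (t - s) \<bullet> x))"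
      by (intro integral_add integrable_continuous_interval continuous_intros ht eT)
    also have "integral {0..t} (\<lambda>s. h s * (e (t - s) \<bullet> x)) = integral {0..T} (\<lambda>s. h s * (e (t - s) \<bullet> x))"
    proof -
      have "integral {0..t} (\<lambda>s. h s * (e (t - s) \<bullet> x)) + integral {t..T} (\<lambda>s. h s * (e (t - s) \<bullet> x))
          = integral {0..T} (\<lambda>s. h s * (e (t - s) \<bullet> x))"
        by (rule Henstock_Kurzweil_Integration.integral_combine) (use t in \<open>auto intro!: integrable_continuous_interval continuous_intros hT eT\<close>)
      moreover have "integral {t..T} (\<lambda>s. h s * (e (t - s) \<bullet> x)) = integral {t..T} (\<lambda>s. 0)"
        by (rule integral_cong) (simp add: e0)
      ultimately show ?thesis by simp
    qed
    also have "\<dots> = integral {0..T} (\<lambda>s. h s *\<^sub>R e (t - s)) \<bullet> x"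
      using integral_inner_left[OF int, of t x] by simp
    finally show "convol h w t \<bullet> x = (integral {0..t} h *\<^sub>R w 0 + integral {0..T} (\<lambda>s. h s *\<^sub>R e (t - s))) \<bullet> x"
      by (simp add: inner_add_left)
  qed
  have "continuous_on {0..T} (\<lambda>t. integral {0..T} (\<lambda>s. h s *\<^sub>R e (t - s)))"
    unfolding continuous_on_def
  proof
    fix t0 assume t0: "t0 \<in> {0..T}"
    \<comment> \<open>A scalar parametric integral, hence continuous in \<open>t\<close>; it
      majorizes the increment of the vector-valued integral and vanishes at
      \<open>t0\<close>.\<close>
    define k where "k t = integral {0..T} (\<lambda>s. \<bar>h s\<bar> * norm (e (t - s) - e (t0 - s)))" for t
    have c2: "continuous_on ({0..T} \<times> cbox 0 T) (\<lambda>p. \<bar>h (snd p)\<bar> * norm (e (fst p - snd p) - e (t0 - snd p)))"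
      by (intro continuous_intros continuous_on_compose2[OF h] continuous_on_compose2[OF e]) auto
    have "continuous_on {0..T} k"
      unfolding k_def using integral_continuous_on_param[of "{0..T}" 0 T "\<lambda>t s. \<bar>h s\<bar> * norm (e (t - s) - e (t0 - s))"] c2
      by (simp add: case_prod_unfold)
    then have k: "(k \<longlongrightarrow> k t0) (at t0 within {0..T})"
      using t0 by (simp add: continuous_on_def)
    have "k t0 = 0"
      by (simp add: k_def)
    have "((\<lambda>t. integral {0..T} (\<lambda>s. h s *\<^sub>R e (t - s)) - integral {0..T} (\<lambda>s. h s *\<^sub>R e (t0 - s))) \<longlongrightarrow> 0) (at t0 within {0..T})"
    proof (rule Lim_null_comparison)
      show "(k \<longlongrightarrow> 0) (at t0 within {0..T})"
        using k \<open>k t0 = 0\<close> by simp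
      show "\<forall>\<^sub>F t in at t0 within {0..T}. norm (integral {0..T} (\<lambda>s. h s *\<^sub>R e (t - s)) - integral {0..T} (\<lambda>s. h s *\<^sub>R e (t0 - s))) \<le> k t"
      proof (intro always_eventually allI)
        fix t
        have "integral {0..T} (\<lambda>s. h s *\<^sub>R e (t - s)) - integral {0..T} (\<lambda>s. h s *\<^sub>R e (t0 - s))
            = integral {0..T} (\<lambda>s. h s *\<^sub>R e (t - s) - h s *\<^sub>R e (t0 - s))"
          by (rule integral_diff[symmetric, OF int int])
        also have "norm \<dots> \<le> k t"
          unfolding k_def
        proof (rule norm_integral_le_hilbert)
          show "(\<lambda>s. h s *\<^sub>R e (t - s) - h s *\<^sub>R e (t0 - s)) integrable_on {0..T}"
            by (rule integrable_diff[OF int int])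
          show "(\<lambda>s. \<bar>h s\<bar> * norm (e (t - s) - e (t0 - s))) integrable_on {0..T}"
            by (intro integrable_continuous_interval continuous_intros hT eT)
          show "norm (h s *\<^sub>R e (t - s) - h s *\<^sub>R e (t0 - s)) \<le> \<bar>h s\<bar> * norm (e (t - s) - e (t0 - s))" for s
            by (simp flip: scaleR_diff_right)
        qed
        finally show "norm (integral {0..T} (\<lambda>s. h s *\<^sub>R e (t - s)) - integral {0..T} (\<lambda>s. h s *\<^sub>R e (t0 - s))) \<le> k t" .
      qed
    qed
    then show "((\<lambda>t. integral {0..T} (\<lambda>s. h s *\<^sub>R e (t - s))) \<longlongrightarrow> integral {0..T} (\<lambda>s. h s *\<^sub>R e (t0 - s))) (at t0 within {0..T})"
      by (rule LIM_zero_cancel)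
  qed
  then have "continuous_on {0..T} (\<lambda>t. integral {0..t} h *\<^sub>R w 0 + integral {0..T} (\<lambda>s. h s *\<^sub>R e (t - s)))"
    by (intro continuous_intros indefinite_integral_continuous_1 integrable_continuous_interval hT)
  then show "continuous_on {0..T} (convol h w)"
    by (rule continuous_on_eq) (simp add: eq)
qed

text \<open>The kernel is only continuous, so the derivative has to fall on \<open>F\<close>. After
  subtraction of the affine part \<open>F 0 + r * F' 0\<close> the function extends by 0 to a
  continuously differentiable function on the line; the convolution becomes an integral over a fixed
  interval and the Leibniz rule applies. The affine part is differentiated explicitly.\<close>

lemma scalar_convol_derivative:
  fixes h F F' :: "real \<Rightarrow> real"
  assumes h: "continuous_on {0..} h"
    and F: "\<And>t. 0 \<le> t \<Longrightarrow> (F has_real_derivative F' t) (at t within {0..})"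
    and F': "continuous_on {0..} F'" and t: "0 \<le> t"
  shows "((\<lambda>t. integral {0..t} (\<lambda>s. h s * F (t - s))) has_real_derivative
    h t * F 0 + integral {0..t} (\<lambda>s. h s * F' (t - s))) (at t within {0..})"
proof -
  \<comment> \<open>The margin beyond \<open>t\<close> makes \<open>{0..T}\<close> and
    \<open>{0..}\<close> agree near \<open>t\<close>.\<close>
  define T where "T = t + 1"
  have T: "0 < T" "t < T" using t by (auto simp: T_def)
  define f where "f r = F' (max 0 r) - F' 0" for r
  define e where "e r = (if r \<le> 0 then 0 else F r - F 0 - r * F' 0)" for r
  have f: "continuous_on UNIV f"
    unfolding f_def by (intro continuous_intros continuous_on_compose2[OF F']) auto
  have e: "(e has_real_derivative f r) (at r)" for r
  proof -
    have nonneg: "((\<lambda>r. F r - F 0 - r * F' 0) has_real_derivative f r) (at r within {0..})" if "0 \<le> r" for r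
      using that by (auto intro!: derivative_eq_intros F simp: f_def max_def)
    have "((\<lambda>r. if r \<in> {..0} then 0 else F r - F 0 - r * F' 0) has_vector_derivative (if r \<in> {..0} then 0 else f r)) (at r within {..0} \<union> {0..})"
    proof (rule has_vector_derivative_If_within_closures)
      show "((\<lambda>r. F r - F 0 - r * F' 0) has_vector_derivative f r) (at r within {0..} \<union> closure {..0} \<inter> closure {0..})"
        if "r \<in> {0..} \<union> closure {..0} \<inter> closure {0..}"
        using nonneg[of r] that by (simp add: has_real_derivative_iff_has_vector_derivative closure_closed Un_absorb2)
    qed (auto simp: f_def max_def)
    moreover have "{..0} \<union> {0::real..} = UNIV" by auto
    moreover have "(if r \<in> {..0} then 0 else f r) = f r" by (auto simp: f_def max_def)
    ultimately show ?thesis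
      by (simp add: e_def[abs_def] has_real_derivative_iff_has_vector_derivative)
  qed
  have ec: "continuous_on UNIV e"
    using e by (meson DERIV_isCont continuous_at_imp_continuous_on)
  have hT: "continuous_on {0..T} h"
    by (rule continuous_on_subset[OF h]) auto
  have eT: "continuous_on S (\<lambda>s. e (t - s))" for S t
    by (rule continuous_on_compose2[OF ec]) (auto intro!: continuous_intros)
  have fT: "continuous_on S (\<lambda>s. f (t - s))" for S t
    by (rule continuous_on_compose2[OF f]) (auto intro!: continuous_intros)
  have cut: "integral {0..t} (\<lambda>s. h s * k (t - s)) = integral {0..T} (\<lambda>s. h s * k (t - s))"
    if "0 \<le> t" "t \<le> T" and k: "continuous_on UNIV k" and k0: "\<And>r. r \<le> 0 \<Longrightarrow> k r = 0" for t k
  proof -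
    have kT: "continuous_on S (\<lambda>s. k (t - s))" for S t
      by (rule continuous_on_compose2[OF k]) (auto intro!: continuous_intros)
    have "integral {0..t} (\<lambda>s. h s * k (t - s)) + integral {t..T} (\<lambda>s. h s * k (t - s))
        = integral {0..T} (\<lambda>s. h s * k (t - s))"
      by (rule Henstock_Kurzweil_Integration.integral_combine) (use that in \<open>auto intro!: integrable_continuous_interval continuous_intros hT kT\<close>)
    moreover have "integral {t..T} (\<lambda>s. h s * k (t - s)) = integral {t..T} (\<lambda>s. 0)"
      by (rule integral_cong) (simp add: k0)
    ultimately show ?thesis by simp
  qed
  have eq: "integral {0..r} (\<lambda>s. h s * F (r - s)) = F 0 * integral {0..r} h
      + F' 0 * (r * integral {0..r} h - integral {0..r} (\<lambda>s. s * h s)) + integral {0..T} (\<lambda>s. h s * e (r - s))"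
    if r: "0 \<le> r" "r \<le> T" for r
  proof -
    have hr: "continuous_on {0..r} h" by (rule continuous_on_subset[OF h]) auto
    have "integral {0..r} (\<lambda>s. h s * F (r - s))
        = integral {0..r} (\<lambda>s. (F 0 * h s + (F' 0 * (r * h s) - F' 0 * (s * h s))) + h s * e (r - s))"
      by (rule integral_cong) (auto simp: e_def algebra_simps)
    also have "\<dots> = integral {0..r} (\<lambda>s. F 0 * h s + (F' 0 * (r * h s) - F' 0 * (s * h s))) + integral {0..r} (\<lambda>s. h s * e (r - s))"
      by (intro integral_add integrable_continuous_interval continuous_intros hr eT)
    also have "integral {0..r} (\<lambda>s. F 0 * h s + (F' 0 * (r * h s) - F' 0 * (s * h s)))
        = integral {0..r} (\<lambda>s. F 0 * h s) + integral {0..r} (\<lambda>s. F' 0 * (r * h s) - F' 0 * (s * h s))"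
      by (intro integral_add integrable_continuous_interval continuous_intros hr)
    also have "integral {0..r} (\<lambda>s. F' 0 * (r * h s) - F' 0 * (s * h s))
        = integral {0..r} (\<lambda>s. F' 0 * (r * h s)) - integral {0..r} (\<lambda>s. F' 0 * (s * h s))"
      by (intro integral_diff integrable_continuous_interval continuous_intros hr)
    also have "integral {0..r} (\<lambda>s. h s * e (r - s)) = integral {0..T} (\<lambda>s. h s * e (r - s))"
      using r ec by (intro cut) (auto simp: e_def)
    finally show ?thesis
      by (simp only: integral_mult_right right_diff_distrib)
  qed
  have D: "((\<lambda>r. integral (cbox 0 T) (\<lambda>s. h s * e (r - s))) has_field_derivative
      integral (cbox 0 T) (\<lambda>s. h s * f (t - s))) (at t within {0..T})"
  proof (rule leibniz_rule_field_derivative)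
    show "((\<lambda>r. h s * e (r - s)) has_real_derivative h s * f (r - s)) (at r within {0..T})" for r s
    proof -
      have "((\<lambda>r. e (r - s)) has_real_derivative f (r - s) * (1 - 0)) (at r within {0..T})"
        by (rule DERIV_chain2[OF e]) (auto intro!: derivative_eq_intros)
      from DERIV_cmult[OF this, of "h s"] show ?thesis
        by simp
    qed
    show "(\<lambda>s. h s * e (r - s)) integrable_on cbox 0 T" for r
      by (simp only: cbox_interval) (intro integrable_continuous_interval continuous_intros hT eT)
    show "continuous_on ({0..T} \<times> cbox 0 T) (\<lambda>(r, s). h s * f (r - s))"
      unfolding case_prod_unfold
      by (intro continuous_intros continuous_on_compose2[OF h] continuous_on_compose2[OF f]) auto
  qed (use t T in auto)
  have w: "at t within {0..T} = at t within {0..}"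
    by (rule at_within_nhd[of _ "{..<T}"]) (use T in auto)
  have sh: "continuous_on {0..} (\<lambda>s. s * h s)"
    by (intro continuous_intros h)
  have "((\<lambda>r. F 0 * integral {0..r} h
      + F' 0 * (r * integral {0..r} h - integral {0..r} (\<lambda>s. s * h s)) + integral {0..T} (\<lambda>s. h s * e (r - s)))
    has_real_derivative F 0 * h t + F' 0 * integral {0..t} h + integral {0..T} (\<lambda>s. h s * f (t - s))) (at t within {0..})"
    using D unfolding w
    by (auto intro!: derivative_eq_intros integral_has_real_derivative_within[OF h t]
        integral_has_real_derivative_within[OF sh t] simp: algebra_simps)
  then have "((\<lambda>t. integral {0..t} (\<lambda>s. h s * F (t - s))) has_real_derivative
     F 0 * h t + F' 0 * integral {0..t} h + integral {0..T} (\<lambda>s. h s * f (t - s))) (at t within {0..})"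
  proof (rule has_field_derivative_transform_within[where d=1])
    show "F 0 * integral {0..r} h + F' 0 * (r * integral {0..r} h - integral {0..r} (\<lambda>s. s * h s))
        + integral {0..T} (\<lambda>s. h s * e (r - s)) = integral {0..r} (\<lambda>s. h s * F (r - s))"
      if "r \<in> {0..}" "dist r t < 1" for r
      using that by (intro eq[symmetric]) (auto simp: T_def dist_real_def)
  qed (use t in auto)
  moreover have "integral {0..T} (\<lambda>s. h s * f (t - s)) = integral {0..t} (\<lambda>s. h s * F' (t - s)) - F' 0 * integral {0..t} h"
  proof -
    have ht: "continuous_on {0..t} h" by (rule continuous_on_subset[OF h]) auto
    have F't: "continuous_on {0..t} (\<lambda>s. F' (t - s))"
      by (rule continuous_on_compose2[OF F']) (auto intro!: continuous_intros)
    have "integral {0..T} (\<lambda>s. h s * f (t - s)) = integral {0..t} (\<lambda>s. h s * f (t - s))"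
      using t T f by (intro cut[symmetric]) (auto simp: f_def max_def)
    also have "\<dots> = integral {0..t} (\<lambda>s. h s * F' (t - s) - F' 0 * h s)"
      by (rule integral_cong) (auto simp: f_def max_def algebra_simps)
    also have "\<dots> = integral {0..t} (\<lambda>s. h s * F' (t - s)) - integral {0..t} (\<lambda>s. F' 0 * h s)"
      by (intro integral_diff integrable_continuous_interval continuous_intros ht F't)
    finally show ?thesis by simp
  qed
  ultimately show ?thesis
    by (simp add: algebra_simps)
qed

lemma convol_has_vector_derivative:
  fixes U W :: "real \<Rightarrow> 'a::{real_inner,complete_space}"
  assumes h: "continuous_on {0..} h"
    and U: "\<And>t. 0 \<le> t \<Longrightarrow> (U has_vector_derivative W t) (at t within {0..})"
    and W: "continuous_on {0..} W" and t: "0 \<le> t"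
  shows "(convol h U has_vector_derivative convol h W t + h t *\<^sub>R U 0) (at t within {0..})"
proof (rule has_vector_derivative_from_weak[OF _ _ t])
  have Uc: "continuous_on {0..} U"
    using U by (meson atLeast_iff continuous_on_vector_derivative)
  show "continuous_on {0..} (\<lambda>t. convol h W t + h t *\<^sub>R U 0)"
    by (intro continuous_intros convol_continuous h W)
  fix t :: real and x :: 'a assume t: "0 \<le> t"
  have in_x: "convol h w t \<bullet> x = integral {0..t} (\<lambda>s. h s * (w (t - s) \<bullet> x))"
    if w: "continuous_on {0..} w" for w t
    unfolding convol_reflect[OF h w] using integral_inner_left[OF convol_integrable(2)[OF h w], of t x] by simp
  have "((\<lambda>t. integral {0..t} (\<lambda>s. h s * (U (t - s) \<bullet> x))) has_real_derivative
    h t * (U 0 \<bullet> x) + integral {0..t} (\<lambda>s. h s * (W (t - s) \<bullet> x))) (at t within {0..})"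
  proof (rule scalar_convol_derivative[OF h _ _ t])
    show "((\<lambda>t. U t \<bullet> x) has_real_derivative W t \<bullet> x) (at t within {0..})" if "0 \<le> t" for t
      using bounded_linear.has_vector_derivative[OF bounded_linear_inner_left U[OF that], of x]
      by (simp add: has_real_derivative_iff_has_vector_derivative)
    show "continuous_on {0..} (\<lambda>t. W t \<bullet> x)"
      by (intro continuous_intros W)
  qed
  then show "((\<lambda>s. convol h U s \<bullet> x) has_real_derivative (convol h W t + h t *\<^sub>R U 0) \<bullet> x) (at t within {0..})"
    by (simp add: in_x[OF Uc] in_x[OF W] inner_add_left add.commute)
qed

lemma convol_exp_has_vector_derivative:
  fixes w :: "real \<Rightarrow> 'a::{real_inner,complete_space}"
  assumes w: "continuous_on {0..} w" and t: "0 \<le> t"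
  shows "(convol (\<lambda>t. exp (- N * t)) w has_vector_derivative w t - N *\<^sub>R convol (\<lambda>t. exp (- N * t)) w t) (at t within {0..})"
proof -
  have eq: "convol (\<lambda>t. exp (- N * t)) w = (\<lambda>t. exp (- N * t) *\<^sub>R integral {0..t} (\<lambda>s. exp (N * s) *\<^sub>R w s))"
  proof
    fix t
    have "(\<lambda>s. exp (N * s) *\<^sub>R w s) integrable_on {0..t}"
      by (intro integrable_continuous_hilbert continuous_intros continuous_on_subset[OF w]) auto
    from integral_linear[OF this bounded_linear_scaleR_right[of "exp (- N * t)"]]
    show "convol (\<lambda>t. exp (- N * t)) w t = exp (- N * t) *\<^sub>R integral {0..t} (\<lambda>s. exp (N * s) *\<^sub>R w s)"
      by (simp add: convol_def o_def exp_add[symmetric] algebra_simps)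
  qed
  have "((\<lambda>t. integral {0..t} (\<lambda>s. exp (N * s) *\<^sub>R w s)) has_vector_derivative exp (N * t) *\<^sub>R w t) (at t within {0..})"
    by (rule integral_has_vector_derivative_hilbert[OF _ t]) (intro continuous_intros w)
  moreover have "((\<lambda>t. exp (- N * t)) has_real_derivative - N * exp (- N * t)) (at t within {0..})"
    by (auto intro!: derivative_eq_intros)
  ultimately have "((\<lambda>t. exp (- N * t) *\<^sub>R integral {0..t} (\<lambda>s. exp (N * s) *\<^sub>R w s)) has_vector_derivative
    exp (- N * t) *\<^sub>R exp (N * t) *\<^sub>R w t + (- N * exp (- N * t)) *\<^sub>R integral {0..t} (\<lambda>s. exp (N * s) *\<^sub>R w s)) (at t within {0..})"
    by (intro has_vector_derivative_scaleR)
  then show ?thesis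
    unfolding eq by (simp add: exp_add[symmetric])
qed

text \<open>Partial integration with \<open>G' = - g\<close>. For \<open>U\<close> it expresses the
  memory term through the convolution of \<open>G\<close> with \<open>W\<close>; for
  \<open>z\<close>, with \<open>z 0 = 0\<close>, it removes the derivative of \<open>z\<close> from
  under the convolution.\<close>

lemma convol_parts:
  fixes U W :: "real \<Rightarrow> 'a::{real_inner,complete_space}"
  assumes g: "continuous_on {0..} g"
    and G: "\<And>t. 0 \<le> t \<Longrightarrow> (G has_real_derivative - g t) (at t within {0..})"
    and U: "\<And>t. 0 \<le> t \<Longrightarrow> (U has_vector_derivative W t) (at t within {0..})"
    and W: "continuous_on {0..} W" and t: "0 \<le> t"
  shows "convol G W t = G 0 *\<^sub>R U t - G t *\<^sub>R U 0 - convol g U t"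
proof (rule vector_eq_rdot[THEN iffD1, OF allI])
  fix x :: 'a
  have Uc: "continuous_on {0..} U"
    using U by (meson atLeast_iff continuous_on_vector_derivative)
  have Gc: "continuous_on {0..} G"
    using G by (meson DERIV_continuous_on atLeast_iff)
  have in_x: "convol h w t \<bullet> x = integral {0..t} (\<lambda>s. h (t - s) * (w s \<bullet> x))"
    if "continuous_on {0..} h" "continuous_on {0..} w" for h w
    unfolding convol_def using integral_inner_left[OF convol_integrable(1)[OF that], of t x] by simp
  have ct: "continuous_on {0..t} (\<lambda>s. h (t - s))" if "continuous_on {0..} h" for h :: "real \<Rightarrow> real"
    by (rule continuous_on_compose2[OF that]) (auto intro!: continuous_intros)
  have sub: "continuous_on {0..t} w" if "continuous_on {0..} w" for w :: "real \<Rightarrow> 'a"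
    by (rule continuous_on_subset[OF that]) auto
  have "((\<lambda>s. g (t - s) * (U s \<bullet> x) + G (t - s) * (W s \<bullet> x)) has_integral
      G (t - t) * (U t \<bullet> x) - G (t - 0) * (U 0 \<bullet> x)) {0..t}"
  proof (rule fundamental_theorem_of_calculus[OF t])
    fix s assume s: "s \<in> {0..t}"
    have 1: "((\<lambda>s. U s \<bullet> x) has_real_derivative W s \<bullet> x) (at s within {0..t})"
      using bounded_linear.has_vector_derivative[OF bounded_linear_inner_left U, of s x] s
      by (auto simp: has_real_derivative_iff_has_vector_derivative intro: has_vector_derivative_within_subset)
    have "(G \<circ> (\<lambda>s. t - s) has_real_derivative (- g (t - s)) * (0 - 1)) (at s within {0..t})"
    proof (rule DERIV_image_chain)
      show "((\<lambda>s. t - s) has_real_derivative 0 - 1) (at s within {0..t})"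
        by (intro derivative_intros)
      show "(G has_real_derivative - g (t - s)) (at (t - s) within (\<lambda>s. t - s) ` {0..t})"
        by (rule DERIV_subset[OF G]) (use s in auto)
    qed
    then have 2: "((\<lambda>s. G (t - s)) has_real_derivative (- g (t - s)) * (0 - 1)) (at s within {0..t})"
      by (simp add: o_def)
    from DERIV_mult[OF 2 1]
    show "((\<lambda>s. G (t - s) * (U s \<bullet> x)) has_vector_derivative g (t - s) * (U s \<bullet> x) + G (t - s) * (W s \<bullet> x)) (at s within {0..t})"
      by (simp add: has_real_derivative_iff_has_vector_derivative algebra_simps)
  qed
  from integral_unique[OF this]
  have "integral {0..t} (\<lambda>s. g (t - s) * (U s \<bullet> x) + G (t - s) * (W s \<bullet> x)) = G 0 * (U t \<bullet> x) - G t * (U 0 \<bullet> x)"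
    by simp
  moreover have "integral {0..t} (\<lambda>s. g (t - s) * (U s \<bullet> x) + G (t - s) * (W s \<bullet> x))
      = convol g U t \<bullet> x + convol G W t \<bullet> x"
    unfolding in_x[OF g Uc] in_x[OF Gc W]
    by (intro integral_add integrable_continuous_interval continuous_intros ct g Gc sub Uc W)
  ultimately show "convol G W t \<bullet> x = (G 0 *\<^sub>R U t - G t *\<^sub>R U 0 - convol g U t) \<bullet> x"
    by (simp add: inner_diff_left)
qed


text \<open>With \<open>g\<close> merely absolutely continuous, the product need not be
  differentiable everywhere. Instead, the increment of the defect \<open>D\<close> over an interval
  is bounded by a constant times the length times the increment of the variation \<open>V\<close>.
  As \<open>V\<close> is continuous, the difference quotients of \<open>D\<close> tend to 0 and
  \<open>D\<close> is constant.\<close>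

lemma absolutely_continuous_parts:
  fixes g g' F F' :: "real \<Rightarrow> real"
  assumes g: "\<And>t. 0 \<le> t \<Longrightarrow> g t = g 0 + integral {0..t} g'"
    and g': "g' absolutely_integrable_on {0<..}"
    and F: "\<And>t. 0 \<le> t \<Longrightarrow> (F has_real_derivative F' t) (at t within {0..})"
    and F': "continuous_on {0..} F'" and t: "0 \<le> t"
  shows "integral {0..t} (\<lambda>s. g s * F' (t - s)) = g 0 * F t - g t * F 0 + integral {0..t} (\<lambda>s. g' s * F (t - s))"
proof -
  have g'i: "g' integrable_on {a..b}" "(\<lambda>s. \<bar>g' s\<bar>) integrable_on {a..b}" if "0 \<le> a" for a b
  proof -
    have "g' absolutely_integrable_on {a<..<b}"
      by (rule set_integrable_subset[OF g']) (use that in auto)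
    then have "g' absolutely_integrable_on {a..b}"
      by (simp add: absolutely_integrable_on_Icc_iff_Ioo)
    then show "g' integrable_on {a..b}" "(\<lambda>s. \<bar>g' s\<bar>) integrable_on {a..b}"
      by (auto simp: absolutely_integrable_on_def)
  qed
  define V where "V r = integral {0..r} (\<lambda>s. \<bar>g' s\<bar>)" for r
  have gc: "continuous_on {0..t} g"
  proof (rule continuous_on_eq)
    show "continuous_on {0..t} (\<lambda>r. g 0 + integral {0..r} g')"
      by (intro continuous_intros indefinite_integral_continuous_1 g'i) simp
  qed (simp add: g[symmetric])
  have Vc: "continuous_on {0..t} V"
    unfolding V_def by (intro indefinite_integral_continuous_1 g'i) simp
  have Fc: "continuous_on {0..} F"
    using F by (meson DERIV_continuous_on atLeast_iff)
  define f f' where "f r = F (t - r)" and "f' r = - F' (t - r)" for r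
  have fc: "continuous_on {0..t} f" "continuous_on {0..t} f'"
    unfolding f_def f'_def
    by (auto intro!: continuous_intros continuous_on_compose2[OF Fc] continuous_on_compose2[OF F'])
  have f: "(f has_real_derivative f' r) (at r within {0..t})" if r: "r \<in> {0..t}" for r
  proof -
    have "(F \<circ> (\<lambda>s. t - s) has_real_derivative F' (t - r) * (0 - 1)) (at r within {0..t})"
    proof (rule DERIV_image_chain)
      show "((\<lambda>s. t - s) has_real_derivative 0 - 1) (at r within {0..t})"
        by (intro derivative_intros)
      show "(F has_real_derivative F' (t - r)) (at (t - r) within (\<lambda>s. t - s) ` {0..t})"
        by (rule DERIV_subset[OF F]) (use r in auto)
    qed
    then show ?thesis
      by (simp add: o_def f_def[abs_def] f'_def)
  qed
  have gf'i: "(\<lambda>s. g s * f' s) integrable_on {a..b}" if "0 \<le> a" "b \<le> t" for a b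
    using that by (intro integrable_continuous_interval continuous_intros continuous_on_subset[OF gc] continuous_on_subset[OF fc(2)]) auto
  have g'fi: "(\<lambda>s. g' s * f s) integrable_on {a..b}" if ab: "0 \<le> a" "b \<le> t" for a b
  proof -
    have "(\<lambda>s. g' s * f s) integrable_on {0..t}"
      unfolding f_def by (rule weight_integrable_product(2)[OF g' Fc t])
    then show ?thesis
      by (rule integrable_on_subinterval) (use ab in auto)
  qed
  obtain M where M: "\<And>r. r \<in> {0..t} \<Longrightarrow> \<bar>f' r\<bar> \<le> M"
    using compact_imp_bounded[OF compact_continuous_image[OF fc(2) compact_Icc]]
    unfolding bounded_iff by (metis imageI real_norm_def)
  have M0: "0 \<le> M"
    using M[of 0] t by force
  define D where "D r = g r * f r - integral {0..r} (\<lambda>s. g s * f' s) - integral {0..r} (\<lambda>s. g' s * f s)" for r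
  have est: "\<bar>D b - D a\<bar> \<le> 2 * M * (b - a) * (V b - V a)" if ab: "0 \<le> a" "a \<le> b" "b \<le> t" for a b
  proof -
    have comb: "integral {0..b} k = integral {0..a} k + integral {a..b} k"
      if "k integrable_on {0..b}" for k :: "real \<Rightarrow> real"
      by (rule Henstock_Kurzweil_Integration.integral_combine[symmetric]) (use ab that in auto)
    have Vab: "V b - V a = integral {a..b} (\<lambda>s. \<bar>g' s\<bar>)"
      unfolding V_def by (subst comb) (use ab g'i in auto)
    have gab: "g d - g c = integral {c..d} g'" if "0 \<le> c" "c \<le> d" for c d
    proof -
      have "integral {0..c} g' + integral {c..d} g' = integral {0..d} g'"
        by (rule Henstock_Kurzweil_Integration.integral_combine) (use that g'i in auto)
      then show ?thesis
        using g[of c] g[of d] that by simp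
    qed
    have fab: "(f' has_integral (f d - f c)) {c..d}" if "0 \<le> c" "c \<le> d" "d \<le> t" for c d
      using that by (intro fundamental_theorem_of_calculus)
        (auto simp flip: has_real_derivative_iff_has_vector_derivative intro: DERIV_subset[OF f])
    have flip: "\<bar>f b - f s\<bar> \<le> M * (b - a)" if s: "s \<in> {a..b}" for s
    proof -
      have "norm (f b - f s) \<le> M * measure lborel (cbox s b)"
        by (rule has_integral_bound[OF M0]) (use fab[of s b] s ab M in auto)
      also have "\<dots> \<le> M * (b - a)"
        using s M0 by (auto intro!: mult_left_mono)
      finally show ?thesis by simp
    qed
    have glip: "\<bar>g a - g s\<bar> \<le> V b - V a" if s: "s \<in> {a..b}" for s
    proof -
      have "\<bar>g s - g a\<bar> \<le> integral {a..s} (\<lambda>s. \<bar>g' s\<bar>)"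
        using gab[of a s] s ab integral_norm_bound_integral[of g' "{a..s}" "\<lambda>s. \<bar>g' s\<bar>"] g'i by auto
      also have "\<dots> \<le> integral {a..b} (\<lambda>s. \<bar>g' s\<bar>)"
        by (rule integral_subset_le) (use s ab g'i in auto)
      finally show ?thesis
        by (simp add: Vab abs_minus_commute)
    qed
    have "D b - D a = (g b * f b - g a * f a) - integral {a..b} (\<lambda>s. g s * f' s) - integral {a..b} (\<lambda>s. g' s * f s)"
      unfolding D_def using comb[OF gf'i[of 0 b]] comb[OF g'fi[of 0 b]] ab by simp
    \<comment> \<open>Freezing \<open>f\<close> at \<open>b\<close> and \<open>g\<close> at
      \<open>a\<close> makes the increment of the product exact, so that each integrand left over
      contains one small difference.\<close>
    also have "g b * f b - g a * f a = integral {a..b} (\<lambda>s. g' s * f b) + integral {a..b} (\<lambda>s. g a * f' s)"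
    proof -
      have "integral {a..b} (\<lambda>s. g' s * f b) = (g b - g a) * f b"
        using gab[of a b] ab by simp
      moreover have "integral {a..b} (\<lambda>s. g a * f' s) = g a * (f b - f a)"
        using integral_unique[OF fab[of a b]] ab by simp
      ultimately show ?thesis
        by (simp add: algebra_simps)
    qed
    finally have "D b - D a = (integral {a..b} (\<lambda>s. g' s * f b) - integral {a..b} (\<lambda>s. g' s * f s))
        + (integral {a..b} (\<lambda>s. g a * f' s) - integral {a..b} (\<lambda>s. g s * f' s))"
      by simp
    also have "integral {a..b} (\<lambda>s. g' s * f b) - integral {a..b} (\<lambda>s. g' s * f s) = integral {a..b} (\<lambda>s. g' s * f b - g' s * f s)"
      using ab g'i by (intro integral_diff[symmetric] g'fi integrable_on_mult_left) auto
    also have "integral {a..b} (\<lambda>s. g a * f' s) - integral {a..b} (\<lambda>s. g s * f' s) = integral {a..b} (\<lambda>s. g a * f' s - g s * f' s)"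
      using ab fab[of a b] by (intro integral_diff[symmetric] gf'i integrable_on_mult_right) auto
    finally have Dab: "D b - D a = integral {a..b} (\<lambda>s. g' s * f b - g' s * f s) + integral {a..b} (\<lambda>s. g a * f' s - g s * f' s)" .
    have "norm (integral {a..b} (\<lambda>s. g' s * f b - g' s * f s)) \<le> integral {a..b} (\<lambda>s. (M * (b - a)) * \<bar>g' s\<bar>)"
    proof (rule integral_norm_bound_integral)
      show "(\<lambda>s. g' s * f b - g' s * f s) integrable_on {a..b}"
        using ab g'i by (intro integrable_diff g'fi integrable_on_mult_left) auto
      show "(\<lambda>s. (M * (b - a)) * \<bar>g' s\<bar>) integrable_on {a..b}"
        using ab g'i by (intro integrable_on_mult_right) auto
      show "norm (g' s * f b - g' s * f s) \<le> (M * (b - a)) * \<bar>g' s\<bar>" if "s \<in> {a..b}" for s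
      proof -
        have "norm (g' s * f b - g' s * f s) = \<bar>f b - f s\<bar> * \<bar>g' s\<bar>"
          by (subst mult.commute) (simp only: real_norm_def flip: abs_mult right_diff_distrib)
        with mult_right_mono[OF flip[OF that], of "\<bar>g' s\<bar>"] show ?thesis
          by simp
      qed
    qed
    then have 1: "\<bar>integral {a..b} (\<lambda>s. g' s * f b - g' s * f s)\<bar> \<le> M * (b - a) * (V b - V a)"
      by (simp add: Vab)
    have "norm (integral {a..b} (\<lambda>s. g a * f' s - g s * f' s)) \<le> integral {a..b} (\<lambda>s. (V b - V a) * M)"
    proof (rule integral_norm_bound_integral)
      show "(\<lambda>s. g a * f' s - g s * f' s) integrable_on {a..b}"
        using ab fab[of a b] by (intro integrable_diff gf'i integrable_on_mult_right) auto
      show "(\<lambda>s. (V b - V a) * M) integrable_on {a..b}"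
        by (rule integrable_const_ivl)
      show "norm (g a * f' s - g s * f' s) \<le> (V b - V a) * M" if s: "s \<in> {a..b}" for s
      proof -
        have "\<bar>g a - g s\<bar> * \<bar>f' s\<bar> \<le> (V b - V a) * M"
          using glip[OF s] M[of s] s ab by (intro mult_mono) auto
        then show ?thesis
          by (simp add: abs_mult flip: left_diff_distrib)
      qed
    qed
    then have 2: "\<bar>integral {a..b} (\<lambda>s. g a * f' s - g s * f' s)\<bar> \<le> M * (b - a) * (V b - V a)"
      using ab by (simp add: mult_ac)
    show ?thesis
      unfolding Dab using 1 2 by linarith
  qed
  have "(D has_real_derivative 0) (at r within {0..t})" if r: "r \<in> {0..t}" for r
    unfolding has_field_derivative_iff
  proof (rule Lim_null_comparison)
    show "((\<lambda>y. 2 * M * \<bar>V y - V r\<bar>) \<longlongrightarrow> 0) (at r within {0..t})"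
      using Vc r by (auto simp: continuous_on_def intro!: tendsto_mult_right_zero tendsto_rabs_zero LIM_zero)
    show "\<forall>\<^sub>F y in at r within {0..t}. norm ((D y - D r) / (y - r)) \<le> 2 * M * \<bar>V y - V r\<bar>"
      unfolding eventually_at
    proof (intro exI[of _ 1] conjI ballI impI)
      fix y assume y: "y \<in> {0..t}" "y \<noteq> r \<and> dist y r < 1"
      have "\<bar>D y - D r\<bar> \<le> 2 * M * \<bar>y - r\<bar> * \<bar>V y - V r\<bar>"
      proof (cases "r \<le> y")
        case True
        then show ?thesis
          using est[of r y] r y M0 mult_left_mono[OF abs_ge_self[of "V y - V r"], of "2 * M * (y - r)"] by auto
      next
        case False
        then show ?thesis
          using est[of y r] r y M0 mult_left_mono[OF abs_ge_self[of "V r - V y"], of "2 * M * (r - y)"]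
          by (auto simp: abs_minus_commute)
      qed
      then show "norm ((D y - D r) / (y - r)) \<le> 2 * M * \<bar>V y - V r\<bar>"
        using y by (simp add: divide_simps mult_ac)
    qed simp
  qed
  then have "D t = D 0"
    using has_field_derivative_zero_constant[of "{0..t}" D] t by fastforce
  then have "g t * f t - integral {0..t} (\<lambda>s. g s * f' s) - integral {0..t} (\<lambda>s. g' s * f s) = g 0 * f 0"
    by (simp add: D_def)
  then show ?thesis
    by (simp add: f_def f'_def)
qed

text \<open>The left side is the norm of the derivative of g*U. Since \<open>W\<close> is not
  controlled by the energy, the derivative is moved from \<open>U\<close> to the kernel. Testing
  with the vector \<open>X\<close> itself involves only scalar integrals against the merely
  integrable \<open>g'\<close>.\<close>

lemma norm_convol_derivative_le:
  fixes U W :: "real \<Rightarrow> 'a::{real_inner,complete_space}"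
  assumes g: "\<And>t. 0 \<le> t \<Longrightarrow> g t = g 0 + integral {0..t} g'"
    and gc: "continuous_on {0..} g" and g': "g' absolutely_integrable_on {0<..}"
    and U: "\<And>t. 0 \<le> t \<Longrightarrow> (U has_vector_derivative W t) (at t within {0..})"
    and W: "continuous_on {0..} W" and t: "0 \<le> t"
  shows "norm (convol g W t + g t *\<^sub>R U 0) \<le> \<bar>g 0\<bar> * norm (U t) + integral {0..t} (\<lambda>s. \<bar>g' s\<bar> * norm (U (t - s)))"
proof -
  have Uc: "continuous_on {0..} U"
    using U by (meson atLeast_iff continuous_on_vector_derivative)
  define X where "X = convol g W t + g t *\<^sub>R U 0"
  define I where "I = integral {0..t} (\<lambda>s. \<bar>g' s\<bar> * norm (U (t - s)))"
  have int: "(\<lambda>s. \<bar>g' s\<bar> * norm (U (t - s))) integrable_on {0..t}"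
    by (rule weight_integrable_product(1)[OF g' _ t]) (intro continuous_intros Uc)
  have "X \<bullet> X \<le> (\<bar>g 0\<bar> * norm (U t) + I) * norm X"
  proof -
    have "convol g W t \<bullet> X = integral {0..t} (\<lambda>s. g s * (W (t - s) \<bullet> X))"
      unfolding convol_reflect[OF gc W] using integral_inner_left[OF convol_integrable(2)[OF gc W], of t X] by simp
    also have "\<dots> = g 0 * (U t \<bullet> X) - g t * (U 0 \<bullet> X) + integral {0..t} (\<lambda>s. g' s * (U (t - s) \<bullet> X))"
    proof (rule absolutely_continuous_parts[OF g g' _ _ t])
      show "((\<lambda>t. U t \<bullet> X) has_real_derivative W t \<bullet> X) (at t within {0..})" if "0 \<le> t" for t
        using bounded_linear.has_vector_derivative[OF bounded_linear_inner_left U[OF that], of X]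
        by (simp add: has_real_derivative_iff_has_vector_derivative)
    qed (auto intro!: continuous_intros W)
    finally have "X \<bullet> X = g 0 * (U t \<bullet> X) + integral {0..t} (\<lambda>s. g' s * (U (t - s) \<bullet> X))"
      by (subst X_def) (simp add: inner_add_left)
    moreover have "g 0 * (U t \<bullet> X) \<le> \<bar>g 0\<bar> * (norm (U t) * norm X)"
      using mult_left_mono[OF Cauchy_Schwarz_ineq2[of "U t" X], of "\<bar>g 0\<bar>"]
        abs_ge_self[of "g 0 * (U t \<bullet> X)"] by (simp add: abs_mult)
    moreover have "integral {0..t} (\<lambda>s. g' s * (U (t - s) \<bullet> X)) \<le> integral {0..t} (\<lambda>s. (\<bar>g' s\<bar> * norm (U (t - s))) * norm X)"
    proof (rule integral_le)
      show "(\<lambda>s. g' s * (U (t - s) \<bullet> X)) integrable_on {0..t}"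
        by (rule weight_integrable_product(2)[OF g' _ t]) (intro continuous_intros Uc)
      show "(\<lambda>s. (\<bar>g' s\<bar> * norm (U (t - s))) * norm X) integrable_on {0..t}"
        by (rule integrable_on_mult_left[OF int])
      show "g' s * (U (t - s) \<bullet> X) \<le> (\<bar>g' s\<bar> * norm (U (t - s))) * norm X" for s
        using mult_left_mono[OF Cauchy_Schwarz_ineq2[of "U (t - s)" X], of "\<bar>g' s\<bar>"]
          abs_ge_self[of "g' s * (U (t - s) \<bullet> X)"] by (simp add: abs_mult mult.assoc)
    qed
    ultimately show ?thesis
      by (simp add: I_def algebra_simps)
  qed
  moreover have "0 \<le> I"
    unfolding I_def using int by (rule integral_nonneg) auto
  ultimately have "norm X \<le> \<bar>g 0\<bar> * norm (U t) + I"
    by (cases "X = 0") (auto simp: power2_norm_eq_inner[symmetric] power2_eq_square)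
  then show ?thesis
    by (simp add: X_def I_def)
qed

section \<open>Weighted integrals up to an arbitrarily small multiple of the energy\<close>

definition wint :: "real \<Rightarrow> (real \<Rightarrow> real) \<Rightarrow> real \<Rightarrow> real" where
  "wint m f T = integral {0..T} (\<lambda>t. (t + 1) powr m * f t)"

lemma continuous_on_weight: "continuous_on {0..} (\<lambda>t::real. (t + 1) powr m)" for m :: real
  by (auto intro!: continuous_intros)

lemma wint_integrable:
  fixes f :: "real \<Rightarrow> real"
  assumes "continuous_on {0..} f"
  shows "(\<lambda>t. (t + 1) powr m * f t) integrable_on {0..T}"
  by (intro integrable_continuous_interval continuous_on_mult continuous_on_subset[OF continuous_on_weight]
    continuous_on_subset[OF assms]) auto

lemma wint_add:
  assumes "continuous_on {0..} f" "continuous_on {0..} h"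
  shows "wint m (\<lambda>t. f t + h t) T = wint m f T + wint m h T"
  unfolding wint_def distrib_left by (intro integral_add wint_integrable assms)

lemma wint_cmult: "wint m (\<lambda>t. c * f t) T = c * wint m f T"
  unfolding wint_def by (simp add: mult.left_commute)

lemma wint_mono:
  assumes "continuous_on {0..} f" "continuous_on {0..} h" "\<And>t. 0 \<le> t \<Longrightarrow> f t \<le> h t"
  shows "wint m f T \<le> wint m h T"
  unfolding wint_def by (intro integral_le wint_integrable assms mult_left_mono) auto

lemma wint_nonneg:
  assumes "continuous_on {0..} f" "\<And>t. 0 \<le> t \<Longrightarrow> 0 \<le> f t"
  shows "0 \<le> wint m f T"
  unfolding wint_def by (intro integral_nonneg wint_integrable assms mult_nonneg_nonneg) auto

lemma wint_mono_time:
  assumes "continuous_on {0..} f" "\<And>t. 0 \<le> t \<Longrightarrow> 0 \<le> f t" "S \<le> T"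
  shows "wint m f S \<le> wint m f T"
  unfolding wint_def using assms by (intro integral_subset_le wint_integrable) auto

lemma wint_mono_weight:
  assumes "continuous_on {0..} f" "\<And>t. 0 \<le> t \<Longrightarrow> 0 \<le> f t" "m \<le> n"
  shows "wint m f T \<le> wint n f T"
  unfolding wint_def using assms by (intro integral_le wint_integrable assms mult_right_mono powr_mono) auto

lemma weight_derivative:
  "0 \<le> t \<Longrightarrow> ((\<lambda>t::real. (t + 1) powr m) has_real_derivative m * (t + 1) powr (m - 1)) (at t within {0..})"
  by (auto intro!: derivative_eq_intros simp: powr_diff)

lemma wint_by_parts:
  assumes f: "\<And>t. 0 \<le> t \<Longrightarrow> (f has_real_derivative f' t) (at t within {0..})"
    and f': "continuous_on {0..} f'" and T: "0 \<le> T"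
  shows "wint m f' T = (T + 1) powr m * f T - f 0 - m * wint (m - 1) f T"
proof -
  have fc: "continuous_on {0..} f"
    using f by (meson DERIV_continuous_on atLeast_iff)
  have "((\<lambda>t. m * ((t + 1) powr (m - 1) * f t) + (t + 1) powr m * f' t) has_integral (T + 1) powr m * f T - (0 + 1) powr m * f 0) {0..T}"
  proof (rule fundamental_theorem_of_calculus[OF T])
    fix t assume t: "t \<in> {0..T}"
    have "((\<lambda>t. (t + 1) powr m * f t) has_real_derivative m * (t + 1) powr (m - 1) * f t + f' t * (t + 1) powr m) (at t within {0..})"
      using t by (intro DERIV_mult weight_derivative f) auto
    then have "((\<lambda>t. (t + 1) powr m * f t) has_real_derivative m * (t + 1) powr (m - 1) * f t + f' t * (t + 1) powr m) (at t within {0..T})"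
      by (rule DERIV_subset) auto
    then show "((\<lambda>t. (t + 1) powr m * f t) has_vector_derivative m * ((t + 1) powr (m - 1) * f t) + (t + 1) powr m * f' t) (at t within {0..T})"
      by (simp add: has_real_derivative_iff_has_vector_derivative mult_ac)
  qed
  from integral_unique[OF this]
  have "integral {0..T} (\<lambda>t. m * ((t + 1) powr (m - 1) * f t)) + wint m f' T = (T + 1) powr m * f T - f 0"
    unfolding wint_def
    by (subst integral_add[symmetric]) (simp_all add: wint_integrable[OF fc] wint_integrable[OF f'] integrable_on_mult_right)
  then show ?thesis
    by (simp add: wint_def)
qed

text \<open>From the time \<open>m / e\<close> on, the derivative of the weight is at most
  \<open>e\<close> times the weight; the integral up to this fixed time is a constant.\<close>

lemma weight_derivative_absorb:
  assumes f: "continuous_on {0..} f" and f0: "\<And>t. 0 \<le> t \<Longrightarrow> 0 \<le> f t" and e: "0 < e" and m: "0 \<le> m"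
  shows "\<exists>C. \<forall>T\<ge>0. m * wint (m - 1) f T \<le> C + e * wint m f T"
proof -
  define S where "S = m / e"
  have S: "0 \<le> S" using m e by (simp add: S_def)
  have "m * wint (m - 1) f T \<le> m * wint (m - 1) f S + e * wint m f T" if T: "0 \<le> T" for T
  proof (cases "T \<le> S")
    case True
    have "m * wint (m - 1) f T \<le> m * wint (m - 1) f S"
      by (intro mult_left_mono m wint_mono_time f f0 True)
    moreover have "0 \<le> e * wint m f T"
      using e by (intro mult_nonneg_nonneg wint_nonneg f f0) auto
    ultimately show ?thesis by simp
  next
    case False
    let ?h = "\<lambda>n t. (t + 1) powr n * f t"
    have hi: "?h n integrable_on {a..b}" if "0 \<le> a" for a b n
      using wint_integrable[OF f, of n b] by (rule integrable_on_subinterval) (use that in auto)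
    have split: "wint n f T = wint n f S + integral {S..T} (?h n)" for n
      unfolding wint_def
      by (rule Henstock_Kurzweil_Integration.integral_combine[symmetric]) (use False S hi in auto)
    have "m * integral {S..T} (?h (m - 1)) = integral {S..T} (\<lambda>t. m * ?h (m - 1) t)"
      by simp
    also have "\<dots> \<le> integral {S..T} (\<lambda>t. e * ?h m t)"
    proof (rule integral_le)
      show "m * ?h (m - 1) t \<le> e * ?h m t" if t: "t \<in> {S..T}" for t
      proof -
        have "m \<le> e * (t + 1)"
          using t e by (simp add: S_def field_simps)
        then have "m * (t + 1) powr (m - 1) \<le> e * ((t + 1) * (t + 1) powr (m - 1))"
          using mult_right_mono[of m "e * (t + 1)" "(t + 1) powr (m - 1)"] by (simp add: mult.assoc)
        also have "(t + 1) * (t + 1) powr (m - 1) = (t + 1) powr m"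
          using t S by (simp add: powr_mult_base)
        finally show ?thesis
          using mult_right_mono[of "m * (t + 1) powr (m - 1)" "e * (t + 1) powr m" "f t"] f0[of t] t S
          by (simp add: mult.assoc)
      qed
    qed (use S hi in \<open>auto intro!: integrable_on_mult_right\<close>)
    finally have "m * integral {S..T} (?h (m - 1)) \<le> e * integral {S..T} (?h m)"
      by simp
    moreover have "0 \<le> e * wint m f S"
      using e by (intro mult_nonneg_nonneg wint_nonneg f f0) auto
    ultimately show ?thesis
      by (simp add: split distrib_left)
  qed
  then show ?thesis by blast
qed

text \<open>Bookkeeping for absorption. The integral of \<open>e\<close> is to be bounded, while
  \<open>eh\<close> is a larger quantity that dominates the boundary terms of all partial
  integrations. The weighted integral of \<open>eh\<close> may cost any multiple of that of
  \<open>e\<close>, but its weighted boundary values only an arbitrarily small one.\<close>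

locale weighted_energy =
  fixes m :: real and e eh :: "real \<Rightarrow> real"
  assumes m: "0 \<le> m"
    and e: "continuous_on {0..} e" and e0: "\<And>t. 0 \<le> t \<Longrightarrow> 0 \<le> e t"
    and eh: "continuous_on {0..} eh" and eh0: "\<And>t. 0 \<le> t \<Longrightarrow> 0 \<le> eh t"
    and eh_int: "\<exists>K\<ge>0. \<exists>C. \<forall>T\<ge>0. wint m eh T \<le> C + K * wint m e T"
    and eh_bdry: "\<And>\<epsilon>. 0 < \<epsilon> \<Longrightarrow> \<exists>C. \<forall>T\<ge>0. (T + 1) powr m * eh T \<le> C + \<epsilon> * wint m e T"
begin

text \<open>The constant may depend on \<epsilon> but not on \<open>T\<close>. The bound is
  one-sided, so smallness does not pass to the negative of a function; this is why later lemmas list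
  both signs.\<close>

definition small :: "(real \<Rightarrow> real) \<Rightarrow> bool" where
  "small f \<longleftrightarrow> continuous_on {0..} f \<and> (\<forall>\<epsilon>>0. \<exists>C. \<forall>T\<ge>0. wint m f T \<le> C + \<epsilon> * wint m e T)"

definition big :: "(real \<Rightarrow> real) \<Rightarrow> bool" where
  "big f \<longleftrightarrow> continuous_on {0..} f \<and> (\<exists>K\<ge>0. \<exists>C. \<forall>T\<ge>0. wint m f T \<le> C + K * wint m e T)"

lemma e_wint_nonneg: "0 \<le> wint m e T"
  by (rule wint_nonneg[OF e e0])

lemma big_eh: "big eh"
  unfolding big_def using eh eh_int by blast

lemma big_add:
  assumes "big f" "big h"
  shows "big (\<lambda>t. f t + h t)"
proof -
  obtain K C where 1: "0 \<le> K" "\<And>T. 0 \<le> T \<Longrightarrow> wint m f T \<le> C + K * wint m e T"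
    using assms unfolding big_def by blast
  obtain K' C' where 2: "0 \<le> K'" "\<And>T. 0 \<le> T \<Longrightarrow> wint m h T \<le> C' + K' * wint m e T"
    using assms unfolding big_def by blast
  have c: "continuous_on {0..} f" "continuous_on {0..} h"
    using assms by (auto simp: big_def)
  have "wint m (\<lambda>t. f t + h t) T \<le> (C + C') + (K + K') * wint m e T" if "0 \<le> T" for T
    unfolding wint_add[OF c] using 1(2)[OF that] 2(2)[OF that] by (simp add: distrib_right)
  then show ?thesis
    unfolding big_def using 1(1) 2(1) c by (intro conjI continuous_intros exI[of _ "K + K'"] exI[of _ "C + C'"]) auto
qed

lemma big_cmult:
  assumes "big f" "0 \<le> c"
  shows "big (\<lambda>t. c * f t)"
proof -
  obtain K C where 1: "0 \<le> K" "\<And>T. 0 \<le> T \<Longrightarrow> wint m f T \<le> C + K * wint m e T"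
    using assms unfolding big_def by blast
  have "wint m (\<lambda>t. c * f t) T \<le> c * C + (c * K) * wint m e T" if "0 \<le> T" for T
    unfolding wint_cmult using mult_left_mono[OF 1(2)[OF that] assms(2)] by (simp add: algebra_simps)
  then show ?thesis
    using assms 1(1) unfolding big_def by (intro conjI continuous_intros exI[of _ "c * K"] exI[of _ "c * C"]) auto
qed

lemma big_mono:
  assumes "big h" "continuous_on {0..} f" "\<And>t. 0 \<le> t \<Longrightarrow> f t \<le> h t"
  shows "big f"
proof -
  have "wint m f T \<le> wint m h T" for T
    using assms by (intro wint_mono) (auto simp: big_def)
  then show ?thesis
    using assms(1,2) unfolding big_def by (meson order_trans)
qed

lemma small_add:
  assumes "small f" "small h"
  shows "small (\<lambda>t. f t + h t)"
  unfolding small_def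
proof (intro conjI allI impI)
  have c: "continuous_on {0..} f" "continuous_on {0..} h"
    using assms by (auto simp: small_def)
  then show "continuous_on {0..} (\<lambda>t. f t + h t)"
    by (intro continuous_intros)
  fix \<epsilon> :: real assume "\<epsilon> > 0"
  then have "\<epsilon> / 2 > 0" by simp
  then obtain C C' where "\<And>T. 0 \<le> T \<Longrightarrow> wint m f T \<le> C + \<epsilon> / 2 * wint m e T"
    "\<And>T. 0 \<le> T \<Longrightarrow> wint m h T \<le> C' + \<epsilon> / 2 * wint m e T"
    using assms unfolding small_def by meson
  then have "wint m (\<lambda>t. f t + h t) T \<le> (C + C') + \<epsilon> * wint m e T" if "0 \<le> T" for T
    unfolding wint_add[OF c] using that by fastforce
  then show "\<exists>C. \<forall>T\<ge>0. wint m (\<lambda>t. f t + h t) T \<le> C + \<epsilon> * wint m e T"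
    by blast
qed

text \<open>Errors of the form \<open>\<eta> * h\<close> with \<open>h\<close> merely big do not
  destroy smallness. This is what makes Young's inequality with a parameter usable: the factor that
  grows as \<eta> shrinks falls on the small function.\<close>

lemma small_limit:
  assumes h: "big h" and f: "continuous_on {0..} f"
    and le: "\<And>\<eta>. 0 < \<eta> \<Longrightarrow> \<exists>k. small k \<and> (\<forall>t\<ge>0. f t \<le> k t + \<eta> * h t)"
  shows "small f"
  unfolding small_def
proof (intro conjI f allI impI)
  fix \<epsilon> :: real assume \<epsilon>: "\<epsilon> > 0"
  obtain K C where K: "0 \<le> K" "\<And>T. 0 \<le> T \<Longrightarrow> wint m h T \<le> C + K * wint m e T"
    using h unfolding big_def by blast
  \<comment> \<open>The error thus spends at most half of \<epsilon>; the added 1 covers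
    \<open>K = 0\<close>.\<close>
  define \<eta> where "\<eta> = \<epsilon> / (2 * (K + 1))"
  have \<eta>: "\<eta> > 0" "\<eta> * K \<le> \<epsilon> / 2"
    using \<epsilon> K(1) by (auto simp: \<eta>_def field_simps add_pos_nonneg)
  obtain k where k: "small k" "\<And>t. 0 \<le> t \<Longrightarrow> f t \<le> k t + \<eta> * h t"
    using le[OF \<eta>(1)] by blast
  obtain C' where C': "\<And>T. 0 \<le> T \<Longrightarrow> wint m k T \<le> C' + \<epsilon> / 2 * wint m e T"
    using k(1) \<epsilon> unfolding small_def by (meson half_gt_zero)
  have c: "continuous_on {0..} k" "continuous_on {0..} (\<lambda>t. \<eta> * h t)"
    using k(1) h by (auto simp: small_def big_def intro!: continuous_intros)
  have "wint m f T \<le> (C' + \<eta> * C) + \<epsilon> * wint m e T" if T: "0 \<le> T" for T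
  proof -
    have "wint m f T \<le> wint m (\<lambda>t. k t + \<eta> * h t) T"
      using k(2) by (intro wint_mono f continuous_on_add c)
    also have "\<dots> = wint m k T + \<eta> * wint m h T"
      unfolding wint_add[OF c] wint_cmult ..
    also have "\<dots> \<le> (C' + \<epsilon> / 2 * wint m e T) + \<eta> * (C + K * wint m e T)"
      using C'[OF T] K(2)[OF T] \<eta>(1) by (intro add_mono mult_left_mono) auto
    also have "\<dots> = (C' + \<eta> * C) + (\<epsilon> / 2 + \<eta> * K) * wint m e T"
      by (simp add: algebra_simps)
    also have "\<dots> \<le> (C' + \<eta> * C) + \<epsilon> * wint m e T"
      using \<eta>(2) e_wint_nonneg[of T] by (intro add_left_mono mult_right_mono) auto
    finally show ?thesis .
  qed
  then show "\<exists>C. \<forall>T\<ge>0. wint m f T \<le> C + \<epsilon> * wint m e T"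
    by blast
qed

lemma small_mono:
  assumes "small h" "continuous_on {0..} f" "\<And>t. 0 \<le> t \<Longrightarrow> f t \<le> h t"
  shows "small f"
proof -
  have "wint m f T \<le> wint m h T" for T
    using assms by (intro wint_mono) (auto simp: small_def)
  then show ?thesis
    using assms(1,2) unfolding small_def by (meson order_trans)
qed

lemma small_cmult:
  assumes "small f" "0 \<le> c"
  shows "small (\<lambda>t. c * f t)"
  unfolding small_def
proof (intro conjI allI impI)
  show "continuous_on {0..} (\<lambda>t. c * f t)"
    using assms by (auto simp: small_def intro!: continuous_intros)
  fix \<epsilon> :: real assume \<epsilon>: "\<epsilon> > 0"
  then have "\<epsilon> / (c + 1) > 0" using assms(2) by simp
  then obtain C where C: "\<And>T. 0 \<le> T \<Longrightarrow> wint m f T \<le> C + \<epsilon> / (c + 1) * wint m e T"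
    using assms unfolding small_def by meson
  have "c * (\<epsilon> / (c + 1)) \<le> \<epsilon>"
    using assms(2) \<epsilon> by (simp add: field_simps)
  then have "wint m (\<lambda>t. c * f t) T \<le> c * C + \<epsilon> * wint m e T" if "0 \<le> T" for T
    unfolding wint_cmult
    using mult_left_mono[OF C[OF that] assms(2)] mult_right_mono[of "c * (\<epsilon> / (c + 1))" \<epsilon> "wint m e T"] e_wint_nonneg[of T]
    by (simp add: distrib_left)
  then show "\<exists>C. \<forall>T\<ge>0. wint m (\<lambda>t. c * f t) T \<le> C + \<epsilon> * wint m e T"
    by blast
qed

lemma small_product:
  assumes "small (\<lambda>t. (f t)\<^sup>2)" "big (\<lambda>t. (h t)\<^sup>2)" "continuous_on {0..} k"
    and "0 \<le> c" "\<And>t. 0 \<le> t \<Longrightarrow> k t \<le> c * (f t * h t)"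
  shows "small k"
proof (rule small_limit[OF assms(2,3)])
  fix \<eta> :: real assume \<eta>: "\<eta> > 0"
  have "k t \<le> c\<^sup>2 / \<eta> * (f t)\<^sup>2 + \<eta> * (h t)\<^sup>2" if "0 \<le> t" for t
  proof -
    have "0 \<le> (c * f t / 2 - \<eta> * h t)\<^sup>2" by simp
    then have "\<eta> * (c * (f t * h t)) \<le> (c * f t)\<^sup>2 / 4 + \<eta>\<^sup>2 * (h t)\<^sup>2"
      by (simp add: power2_eq_square field_simps)
    also have "\<dots> \<le> (c * f t)\<^sup>2 + \<eta>\<^sup>2 * (h t)\<^sup>2"
      by simp
    finally have "c * (f t * h t) \<le> ((c * f t)\<^sup>2 + \<eta>\<^sup>2 * (h t)\<^sup>2) / \<eta>"
      using \<eta> by (simp add: field_simps)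
    also have "\<dots> = c\<^sup>2 / \<eta> * (f t)\<^sup>2 + \<eta> * (h t)\<^sup>2"
      using \<eta> by (simp add: field_simps power2_eq_square)
    finally show ?thesis
      using assms(5)[OF that] by linarith
  qed
  moreover have "small (\<lambda>t. c\<^sup>2 / \<eta> * (f t)\<^sup>2)"
    using \<eta> by (intro small_cmult assms(1)) auto
  ultimately show "\<exists>k'. small k' \<and> (\<forall>t\<ge>0. k t \<le> k' t + \<eta> * (h t)\<^sup>2)"
    by blast
qed

text \<open>Partial integration leaves the boundary value of \<open>F\<close>, absorbed by
  \<open>eh_bdry\<close>, and the derivative of the weight against \<open>F\<close>, absorbed by
  \<open>weight_derivative_absorb\<close>. No bound on \<open>F'\<close> enters, so it may contain
  \<open>W\<close> and second derivatives.\<close>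

lemma small_derivative:
  assumes F: "\<And>t. 0 \<le> t \<Longrightarrow> (F has_real_derivative F' t) (at t within {0..})"
    and F': "continuous_on {0..} F'" and K: "\<And>t. 0 \<le> t \<Longrightarrow> \<bar>F t\<bar> \<le> K * eh t"
  shows "small F'"
  unfolding small_def
proof (intro conjI F' allI impI)
  fix \<epsilon> :: real assume \<epsilon>: "\<epsilon> > 0"
  have Fc: "continuous_on {0..} F"
    using F by (meson DERIV_continuous_on atLeast_iff)
  define c where "c = max 0 K"
  have c: "0 \<le> c" "\<And>t. 0 \<le> t \<Longrightarrow> \<bar>F t\<bar> \<le> c * eh t"
  proof -
    show "0 \<le> c" by (simp add: c_def)
    fix t :: real assume t: "0 \<le> t"
    have "K * eh t \<le> c * eh t"
      unfolding c_def by (intro mult_right_mono eh0 t) simp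
    with K[OF t] show "\<bar>F t\<bar> \<le> c * eh t" by linarith
  qed
  define d where "d = \<epsilon> / (2 * (c + 1))"
  have d: "0 < d" "c * d \<le> \<epsilon> / 2"
    using \<epsilon> c(1) by (auto simp: d_def field_simps add_pos_nonneg)
  obtain C1 where C1: "\<And>T. 0 \<le> T \<Longrightarrow> (T + 1) powr m * eh T \<le> C1 + d * wint m e T"
    using eh_bdry[OF d(1)] by blast
  obtain K2 C2 where K2: "0 \<le> K2" "\<And>T. 0 \<le> T \<Longrightarrow> wint m eh T \<le> C2 + K2 * wint m e T"
    using eh_int by blast
  define d' where "d' = d / (K2 + 1)"
  have d': "0 < d'" "d' * K2 \<le> d"
    using d K2(1) by (auto simp: d'_def field_simps add_pos_nonneg)
  obtain C3 where C3: "\<And>T. 0 \<le> T \<Longrightarrow> m * wint (m - 1) eh T \<le> C3 + d' * wint m eh T"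
    using weight_derivative_absorb[OF eh eh0 d'(1) m] by blast
  have "wint m F' T \<le> (c * C1 + \<bar>F 0\<bar> + c * (C3 + d' * C2)) + \<epsilon> * wint m e T" if T: "0 \<le> T" for T
  proof -
    have I0: "0 \<le> wint m e T" by (rule e_wint_nonneg)
    have "m * wint (m - 1) eh T \<le> C3 + d' * (C2 + K2 * wint m e T)"
      using C3[OF T] mult_left_mono[OF K2(2)[OF T], of d'] d'(1) by linarith
    also have "\<dots> = (C3 + d' * C2) + (d' * K2) * wint m e T"
      by (simp add: algebra_simps)
    also have "\<dots> \<le> (C3 + d' * C2) + d * wint m e T"
      using d'(2) I0 by (intro add_left_mono mult_right_mono)
    finally have 1: "m * wint (m - 1) eh T \<le> (C3 + d' * C2) + d * wint m e T" .
    have "wint (m - 1) (\<lambda>t. - F t) T \<le> wint (m - 1) (\<lambda>t. c * eh t) T"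
      using c(2) by (intro wint_mono continuous_intros Fc eh) (metis abs_le_D2)
    then have "- wint (m - 1) F T \<le> c * wint (m - 1) eh T"
      using wint_cmult[of "m - 1" "-1" F T] by (simp add: wint_cmult)
    then have "- (m * wint (m - 1) F T) \<le> c * (m * wint (m - 1) eh T)"
      using mult_left_mono[OF _ m] by (metis mult.left_commute mult_minus_right)
    also have "\<dots> \<le> c * ((C3 + d' * C2) + d * wint m e T)"
      by (intro mult_left_mono 1 c)
    finally have 2: "- (m * wint (m - 1) F T) \<le> c * ((C3 + d' * C2) + d * wint m e T)" .
    have "(T + 1) powr m * F T \<le> (T + 1) powr m * (c * eh T)"
      using c(2)[OF T] by (intro mult_left_mono) auto
    also have "\<dots> = c * ((T + 1) powr m * eh T)"
      by simp
    also have "\<dots> \<le> c * (C1 + d * wint m e T)"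
      by (intro mult_left_mono C1 T c)
    finally have 3: "(T + 1) powr m * F T \<le> c * (C1 + d * wint m e T)" .
    have "wint m F' T = (T + 1) powr m * F T - F 0 - m * wint (m - 1) F T"
      using F F' T by (rule wint_by_parts)
    then have "wint m F' T \<le> c * (C1 + d * wint m e T) + \<bar>F 0\<bar> + c * ((C3 + d' * C2) + d * wint m e T)"
      using 2 3 by linarith
    also have "\<dots> = (c * C1 + \<bar>F 0\<bar> + c * (C3 + d' * C2)) + 2 * (c * d) * wint m e T"
      by (simp add: algebra_simps)
    also have "\<dots> \<le> (c * C1 + \<bar>F 0\<bar> + c * (C3 + d' * C2)) + \<epsilon> * wint m e T"
      using d(2) I0 by (intro add_left_mono mult_right_mono) auto
    finally show ?thesis .
  qed
  then show "\<exists>C. \<forall>T\<ge>0. wint m F' T \<le> C + \<epsilon> * wint m e T"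
    by blast
qed

text \<open>With factor 1/2 the integral up to \<open>T\<close>, which is finite, is absorbed into
  the left side.\<close>

lemma small_energy_bounded:
  assumes "small e"
  shows "\<exists>C. \<forall>T\<ge>0. wint m e T \<le> C"
proof -
  obtain C where "\<And>T. 0 \<le> T \<Longrightarrow> wint m e T \<le> C + 1/2 * wint m e T"
    using assms unfolding small_def by (meson half_gt_zero zero_less_one)
  then have "\<forall>T\<ge>0. wint m e T \<le> 2 * C"
    by fastforce
  then show ?thesis by blast
qed

end

section \<open>Energy estimates\<close>

lemma has_real_derivative_inner:
  fixes f h :: "real \<Rightarrow> 'a::real_inner"
  assumes "(f has_vector_derivative f') (at t within S)" "(h has_vector_derivative h') (at t within S)"
  shows "((\<lambda>t. f t \<bullet> h t) has_real_derivative f t \<bullet> h' + f' \<bullet> h t) (at t within S)"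
  unfolding has_field_derivative_def
  by (rule has_derivative_eq_rhs[OF has_derivative_inner[OF assms[unfolded has_vector_derivative_def]]])
    (auto simp: fun_eq_iff algebra_simps)

lemma integrable_halfline_closed:
  fixes f :: "real \<Rightarrow> real"
  assumes "f integrable_on {0<..}"
  shows "f integrable_on {0..}" "integral {0..} f = integral {0<..} f"
proof -
  have n: "negligible {x \<in> {0..} - {0<..}. f x \<noteq> 0}" "negligible {x \<in> {0<..} - {0..}. f x \<noteq> 0}"
    by (rule negligible_subset[of "{0}"], auto)+
  show "f integrable_on {0..}"
    using assms by (rule integrable_spike_set) (use n in auto)
  show "integral {0..} f = integral {0<..} f"
    by (rule integral_spike_set) (use n in auto)
qed

lemma abs_wint_le:
  fixes p f :: "real \<Rightarrow> real"
  assumes p: "continuous_on {0..} p" and f: "continuous_on {0..} f" and mn: "m \<le> n"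
    and pi: "(\<lambda>t. (t + 1) powr n * p t) absolutely_integrable_on {0<..}"
    and M: "\<And>t. t \<in> {0..T} \<Longrightarrow> \<bar>f t\<bar> \<le> M" and M0: "0 \<le> M"
  shows "\<bar>wint m (\<lambda>t. p t * f t) T\<bar> \<le> M * integral {0<..} (\<lambda>t. (t + 1) powr n * \<bar>p t\<bar>)"
proof -
  let ?q = "\<lambda>t. (t + 1) powr n * \<bar>p t\<bar>"
  have qi: "?q integrable_on {0<..}"
  by (rule weighted_abs_integrable[OF pi])
  have qT: "?q integrable_on {0..T}"
    by (intro wint_integrable continuous_intros p)
  have "norm (wint m (\<lambda>t. p t * f t) T) \<le> integral {0..T} (\<lambda>t. M * ?q t)"
    unfolding wint_def
  proof (rule integral_norm_bound_integral)
    show "(\<lambda>t. (t + 1) powr m * (p t * f t)) integrable_on {0..T}"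
      by (intro wint_integrable continuous_intros p f)
    show "(\<lambda>t. M * ?q t) integrable_on {0..T}"
      by (rule integrable_on_mult_right[OF qT])
    show "norm ((t + 1) powr m * (p t * f t)) \<le> M * ?q t" if t: "t \<in> {0..T}" for t
    proof -
      have "(t + 1) powr m * (\<bar>p t\<bar> * \<bar>f t\<bar>) \<le> (t + 1) powr n * (\<bar>p t\<bar> * M)"
        using t mn M[OF t] by (intro mult_mono powr_mono mult_left_mono) auto
      then show ?thesis
        by (simp add: abs_mult mult_ac)
    qed
  qed
  also have "\<dots> = M * integral {0..T} ?q"
    by simp
  also have "integral {0..T} ?q \<le> integral {0..} ?q"
    by (rule integral_subset_le[OF _ qT integrable_halfline_closed(1)[OF qi]]) auto
  finally show ?thesis
    using M0 by (simp add: integrable_halfline_closed(2)[OF qi] mult_left_mono)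
qed

text \<open>The unbounded operators are eliminated through \<open>Q\<^sub>i = A\<^sub>i\<^sup>-\<^sup>1\<^sup>/\<^sup>2\<close> and \<open>C\<^sub>i = B\<^sub>i Q\<^sub>i\<close>, which are
  bounded, together with \<open>U = A\<^sub>1\<^sup>1\<^sup>/\<^sup>2 u\<close>, \<open>V = A\<^sub>2\<^sup>1\<^sup>/\<^sup>2 v\<close> and \<open>W = U'\<close>; \<open>G\<close> is the tail integral of \<open>g\<close>.
  In \<open>commutator\<close> the two bracketed vectors are \<open>- A\<^sub>1 (u - g * u)\<close> and \<open>- A\<^sub>2 v\<close>.\<close>

locale damped_system =
  fixes lam0 \<alpha> k a1 a2 \<beta> \<beta>1 D1 D2 \<delta> N Kg :: real
    and g g' G :: "real \<Rightarrow> real"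
    and u u1 u2 v v1 v2 U W V V1 :: "real \<Rightarrow> 'a::{real_inner,complete_space}"
    and Q1 Q2 C1 C2 L1 L2 :: "'a \<Rightarrow> 'a"
  assumes lam0: "1 \<le> lam0"
    and g_cont: "continuous_on {0..} g"
    and g_ac: "\<And>t. 0 \<le> t \<Longrightarrow> g t = g 0 + integral {0..t} g'"
    and g_int: "(\<lambda>t. (t + 1) powr lam0 * g t) absolutely_integrable_on {0<..}"
    and g'_int: "(\<lambda>t. (t + 1) powr lam0 * g' t) absolutely_integrable_on {0<..}"
    and G_deriv: "\<And>t. 0 \<le> t \<Longrightarrow> (G has_real_derivative - g t) (at t within {0..})"
    and G_le: "\<And>t. 0 \<le> t \<Longrightarrow> (t + 1) powr lam0 * \<bar>G t\<bar> \<le> Kg"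
    and G_int: "(\<lambda>t. (t + 1) powr (lam0 - 1) * G t) absolutely_integrable_on {0<..}"
    and G_0: "G 0 = k"
    and pd: "\<And>T. 0 \<le> T \<Longrightarrow>
      0 \<le> integral {0..T} (\<lambda>t. (t + 1) powr lam0 * (convol (\<lambda>t. G t - \<delta> * exp (- N * t)) W t \<bullet> W t))"
    and params: "0 < \<delta>" "0 < N" "k < 1" "0 \<le> \<alpha>" "0 < a1" "0 < a2" "0 < \<beta>" "0 < \<beta>1" "0 < D1" "0 < D2"
    and gap: "k + a1 * (\<beta>1\<^sup>2 - \<alpha>) < 1"
    and bl: "bounded_linear Q1" "bounded_linear Q2" "bounded_linear C1" "bounded_linear C2"
      "bounded_linear L1" "bounded_linear L2"
    and Q1_le: "\<And>x. (norm (Q1 x))\<^sup>2 \<le> a1 * (norm x)\<^sup>2"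
    and Q2_le: "\<And>x. (norm (Q2 x))\<^sup>2 \<le> a2 * (norm x)\<^sup>2"
    and Q2_sym: "\<And>x y. Q2 x \<bullet> y = x \<bullet> Q2 y"
    and C1_le: "\<And>x. norm (C1 x) \<le> \<beta>1 * norm x"
    and C2_le: "\<And>x. norm (C2 x) \<le> \<beta>1 * norm x"
    and C2_ge: "\<And>x. \<beta> * norm x \<le> norm (C2 x)"
    and cross: "\<And>x y. C1 x \<bullet> Q2 y = Q1 x \<bullet> C2 y"
    and L1_le: "\<And>x. Q1 x \<bullet> L1 (C1 x) \<le> D2 * (norm (Q1 x))\<^sup>2"
    and L2_le: "\<And>x. Q2 x \<bullet> L2 (C2 x) \<le> D2 * (norm (Q2 x))\<^sup>2"
    and u_deriv: "\<And>t. 0 \<le> t \<Longrightarrow> (u has_vector_derivative u1 t) (at t within {0..})"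
    and u1_deriv: "\<And>t. 0 \<le> t \<Longrightarrow> (u1 has_vector_derivative u2 t) (at t within {0..})"
    and v_deriv: "\<And>t. 0 \<le> t \<Longrightarrow> (v has_vector_derivative v1 t) (at t within {0..})"
    and v1_deriv: "\<And>t. 0 \<le> t \<Longrightarrow> (v1 has_vector_derivative v2 t) (at t within {0..})"
    and U_deriv: "\<And>t. 0 \<le> t \<Longrightarrow> (U has_vector_derivative W t) (at t within {0..})"
    and V_deriv: "\<And>t. 0 \<le> t \<Longrightarrow> (V has_vector_derivative V1 t) (at t within {0..})"
    and cont2: "continuous_on {0..} u2" "continuous_on {0..} v2" "continuous_on {0..} W" "continuous_on {0..} V1"
    and u_eq: "\<And>t. 0 \<le> t \<Longrightarrow> u t = Q1 (U t)" and u1_eq: "\<And>t. 0 \<le> t \<Longrightarrow> u1 t = Q1 (W t)"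
    and v_eq: "\<And>t. 0 \<le> t \<Longrightarrow> v t = Q2 (V t)" and v1_eq: "\<And>t. 0 \<le> t \<Longrightarrow> v1 t = Q2 (V1 t)"
    and eq1: "\<And>t x. 0 \<le> t \<Longrightarrow>
      u2 t \<bullet> Q1 x + (U t - convol g U t) \<bullet> x + \<alpha> * (u t \<bullet> Q1 x) + C2 (V t) \<bullet> Q1 x = 0"
    and eq2: "\<And>t x. 0 \<le> t \<Longrightarrow> v2 t \<bullet> Q2 x + V t \<bullet> x + C1 (U t) \<bullet> Q2 x = 0"
    and commutator: "\<And>t. 0 \<le> t \<Longrightarrow> \<exists>p1\<ge>0. \<exists>p2\<ge>0.
      \<bar>(u2 t + \<alpha> *\<^sub>R u t + C2 (V t)) \<bullet> C2 (V t) - C1 (U t - convol g U t) \<bullet> (v2 t + C1 (U t))\<bar>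
        \<le> D1 * (norm (C1 (U t - convol g U t)) * norm (C2 (V t)) + p1 * p2) \<and>
      p1\<^sup>2 \<le> - ((u2 t + \<alpha> *\<^sub>R u t + C2 (V t)) \<bullet> L1 (C1 (U t - convol g U t)))
        + D2 * (norm (C1 (U t - convol g U t)))\<^sup>2 \<and>
      p2\<^sup>2 \<le> - ((v2 t + C1 (U t)) \<bullet> L2 (C2 (V t))) + D2 * (norm (C2 (V t)))\<^sup>2"
begin

definition z :: "real \<Rightarrow> 'a" where "z = convol (\<lambda>t. exp (- N * t)) W"
definition gU :: "real \<Rightarrow> 'a" where "gU = convol g U"
definition E :: "real \<Rightarrow> real" where
  "E t = 1/2 * (norm (u1 t))\<^sup>2 + (1 - k) / 2 * (norm (U t))\<^sup>2 + 1/2 * (norm (v1 t))\<^sup>2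
     + 1/2 * (norm (V t))\<^sup>2 + \<alpha> / 2 * (norm (u t))\<^sup>2 + C1 (U t) \<bullet> v t"
definition e :: "real \<Rightarrow> real" where
  "e t = (norm (u1 t))\<^sup>2 + (norm (U t))\<^sup>2 + (norm (v1 t))\<^sup>2 + (norm (V t))\<^sup>2"
text \<open>Boundary terms also contain \<open>z\<close> and g*U. These depend on the past, so their
  values are not dominated by \<open>e\<close> at the same time.\<close>

definition eh :: "real \<Rightarrow> real" where
  "eh t = e t + (norm (z t))\<^sup>2 + (norm (gU t))\<^sup>2"

lemma hvd_cont:
  fixes f :: "real \<Rightarrow> 'a"
  assumes "\<And>t. 0 \<le> t \<Longrightarrow> (f has_vector_derivative f' t) (at t within {0..})"
  shows "continuous_on {0..} f"
  using assms by (meson atLeast_iff continuous_on_vector_derivative)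

lemma G_cont: "continuous_on {0..} G"
  using G_deriv by (meson DERIV_continuous_on atLeast_iff)

lemmas cont = hvd_cont[OF u_deriv] hvd_cont[OF u1_deriv] hvd_cont[OF v_deriv] hvd_cont[OF v1_deriv]
  hvd_cont[OF U_deriv] hvd_cont[OF V_deriv] cont2 g_cont G_cont

lemmas cont_bl = bl[THEN bounded_linear.continuous_on]

lemma z_deriv: "0 \<le> t \<Longrightarrow> (z has_vector_derivative W t - N *\<^sub>R z t) (at t within {0..})"
  unfolding z_def by (rule convol_exp_has_vector_derivative) (auto intro: cont)

lemma z_cont: "continuous_on {0..} z"
  by (rule hvd_cont[OF z_deriv])

lemma gU_cont: "continuous_on {0..} gU"
  unfolding gU_def by (intro convol_continuous cont)

lemma z_0: "z 0 = 0"
  by (simp add: z_def convol_def)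

lemma e_cont: "continuous_on {0..} e"
  unfolding e_def by (intro continuous_intros cont)

lemma e_nonneg: "0 \<le> e t"
  by (simp add: e_def)

lemma eh_cont: "continuous_on {0..} eh"
  unfolding eh_def by (intro continuous_intros e_cont z_cont gU_cont)

lemma eh_nonneg: "0 \<le> eh t"
  using e_nonneg by (simp add: eh_def)

lemma E_cont: "continuous_on {0..} E"
  unfolding E_def by (intro continuous_intros cont cont_bl)

lemma GW_eq: "0 \<le> t \<Longrightarrow> convol G W t = k *\<^sub>R U t - G t *\<^sub>R U 0 - gU t"
  unfolding gU_def G_0[symmetric] by (rule convol_parts[OF g_cont G_deriv U_deriv]) (auto intro: cont)

text \<open>The coupling terms cancel by \<open>cross\<close>, and \<open>GW_eq\<close> replaces the
  memory term by \<open>k U\<close> and the convolution of \<open>G\<close> with \<open>W\<close>;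
  this is the origin of the coefficient \<open>1 - k\<close> in \<open>E\<close>.\<close>

lemma E_deriv:
  assumes t: "0 \<le> t"
  shows "(E has_real_derivative - (convol G W t \<bullet> W t) - G t * (W t \<bullet> U 0)) (at t within {0..})"
proof -
  note D = has_real_derivative_inner
  have C1U: "((\<lambda>t. C1 (U t)) has_vector_derivative C1 (W t)) (at t within {0..})"
    by (rule bounded_linear.has_vector_derivative[OF bl(3) U_deriv[OF t]])
  have "(E has_real_derivative 1/2 * (u1 t \<bullet> u2 t + u2 t \<bullet> u1 t) + (1 - k) / 2 * (U t \<bullet> W t + W t \<bullet> U t)
      + 1/2 * (v1 t \<bullet> v2 t + v2 t \<bullet> v1 t) + 1/2 * (V t \<bullet> V1 t + V1 t \<bullet> V t) + \<alpha> / 2 * (u t \<bullet> u1 t + u1 t \<bullet> u t)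
      + (C1 (U t) \<bullet> v1 t + C1 (W t) \<bullet> v t)) (at t within {0..})"
    unfolding E_def[abs_def] power2_norm_eq_inner
    by (intro DERIV_add DERIV_cmult D u1_deriv U_deriv v1_deriv V_deriv u_deriv C1U v_deriv t)
  moreover have "C1 (W t) \<bullet> v t = u1 t \<bullet> C2 (V t)"
    by (simp add: v_eq u1_eq t cross)
  moreover have "u2 t \<bullet> u1 t + (U t - gU t) \<bullet> W t + \<alpha> * (u t \<bullet> u1 t) + C2 (V t) \<bullet> u1 t = 0"
    using eq1[OF t, of "W t"] by (simp add: u1_eq t gU_def)
  moreover have "v2 t \<bullet> v1 t + V t \<bullet> V1 t + C1 (U t) \<bullet> v1 t = 0"
    using eq2[OF t, of "V1 t"] by (simp add: v1_eq t)
  moreover have "convol G W t \<bullet> W t = k * (U t \<bullet> W t) - G t * (W t \<bullet> U 0) - gU t \<bullet> W t"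
    by (simp add: GW_eq[OF t] inner_diff_left) (simp add: inner_commute)
  ultimately show ?thesis
    by (simp add: inner_commute inner_diff_left algebra_simps)
      (elim DERIV_cong, simp add: field_simps)
qed

section \<open>Equivalence of the energy with the sum of squares \<open>e\<close>\<close>

lemma u_le: "0 \<le> t \<Longrightarrow> (norm (u t))\<^sup>2 \<le> a1 * (norm (U t))\<^sup>2"
  by (simp add: u_eq Q1_le)

lemma v_le: "0 \<le> t \<Longrightarrow> (norm (v t))\<^sup>2 \<le> a2 * (norm (V t))\<^sup>2"
  by (simp add: v_eq Q2_le)

text \<open>For \<open>\<beta>1\<^sup>2 \<ge> \<alpha>\<close> the subtracted term is estimated by
  \<open>Q1_le\<close> and \<open>gap\<close> applies; otherwise it has the favourable sign and
  \<open>k < 1\<close> suffices. Hence the two gaps in the minimum.\<close>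

lemma gap_coercive: "\<exists>\<kappa>>0. \<forall>x. \<kappa> * (norm x)\<^sup>2 \<le> (1 - k) * (norm x)\<^sup>2 - (\<beta>1\<^sup>2 - \<alpha>) * (norm (Q1 x))\<^sup>2"
proof -
  define \<kappa> where "\<kappa> = min (1 - k) (1 - k - a1 * (\<beta>1\<^sup>2 - \<alpha>))"
  have "\<kappa> * (norm x)\<^sup>2 \<le> (1 - k) * (norm x)\<^sup>2 - (\<beta>1\<^sup>2 - \<alpha>) * (norm (Q1 x))\<^sup>2" for x
  proof (cases "\<beta>1\<^sup>2 \<ge> \<alpha>")
    case True
    have "\<kappa> * (norm x)\<^sup>2 \<le> (1 - k - a1 * (\<beta>1\<^sup>2 - \<alpha>)) * (norm x)\<^sup>2"
      by (intro mult_right_mono) (auto simp: \<kappa>_def)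
    moreover have "(\<beta>1\<^sup>2 - \<alpha>) * (norm (Q1 x))\<^sup>2 \<le> (\<beta>1\<^sup>2 - \<alpha>) * (a1 * (norm x)\<^sup>2)"
      using Q1_le True by (intro mult_left_mono) auto
    ultimately show ?thesis by (simp add: algebra_simps)
  next
    case False
    have "\<kappa> * (norm x)\<^sup>2 \<le> (1 - k) * (norm x)\<^sup>2"
      by (intro mult_right_mono) (auto simp: \<kappa>_def)
    moreover have "(\<beta>1\<^sup>2 - \<alpha>) * (norm (Q1 x))\<^sup>2 \<le> 0"
      using False by (intro mult_nonpos_nonneg) auto
    ultimately show ?thesis by simp
  qed
  moreover have "0 < \<kappa>" using params gap by (simp add: \<kappa>_def)
  ultimately show ?thesis by blast
qed

lemma potential_coercive:
  "\<exists>c>0. \<forall>(x::'a) (y::'a). c * ((norm x)\<^sup>2 + (norm y)\<^sup>2)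
     \<le> (1 - k) * (norm x)\<^sup>2 + \<alpha> * (norm (Q1 x))\<^sup>2 + (norm y)\<^sup>2 - 2 * \<beta>1 * norm (Q1 x) * norm y"
proof -
  obtain \<kappa> where \<kappa>: "0 < \<kappa>"
    and gc: "\<And>x. \<kappa> * (norm x)\<^sup>2 \<le> (1 - k) * (norm x)\<^sup>2 - (\<beta>1\<^sup>2 - \<alpha>) * (norm (Q1 x))\<^sup>2"
    using gap_coercive by blast
  \<comment> \<open>Half of \<kappa> pays for raising the coefficient in the completed square from 1
    to \<open>1 + r\<close>, which leaves the positive share \<open>1 - 1 / (1 + r)\<close> of the
    square of \<open>norm y\<close>.\<close>
  define r where "r = \<kappa> / (2 * (a1 * \<beta>1\<^sup>2))"
  have r: "0 < r" "r * (a1 * \<beta>1\<^sup>2) = \<kappa> / 2"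
    using \<kappa> params by (auto simp: r_def)
  define c where "c = min (\<kappa> / 2) (1 - 1 / (1 + r))"
  have c: "0 < c"
    using \<kappa> r by (simp add: c_def)
  have "c * ((norm x)\<^sup>2 + (norm y)\<^sup>2)
     \<le> (1 - k) * (norm x)\<^sup>2 + \<alpha> * (norm (Q1 x))\<^sup>2 + (norm y)\<^sup>2 - 2 * \<beta>1 * norm (Q1 x) * norm y" for x y :: 'a
  proof -
    define X q Y where "X = norm x" and "q = norm (Q1 x)" and "Y = norm y"
    have q: "q\<^sup>2 \<le> a1 * X\<^sup>2" using Q1_le[of x] by (simp add: X_def q_def)
    have "0 \<le> (Y - (1 + r) * (\<beta>1 * q))\<^sup>2 / (1 + r)"
      using r by simp
    also have "\<dots> = Y\<^sup>2 / (1 + r) - 2 * \<beta>1 * q * Y + (1 + r) * (\<beta>1\<^sup>2 * q\<^sup>2)"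
      using r by (simp add: power2_eq_square field_simps)
    finally have 1: "(1 - 1 / (1 + r)) * Y\<^sup>2 - (1 + r) * (\<beta>1\<^sup>2 * q\<^sup>2) \<le> Y\<^sup>2 - 2 * \<beta>1 * q * Y"
      by (simp add: algebra_simps)
    have 2: "\<kappa> * X\<^sup>2 \<le> (1 - k) * X\<^sup>2 - (\<beta>1\<^sup>2 - \<alpha>) * q\<^sup>2"
      using gc[of x] by (simp add: X_def q_def)
    have "r * \<beta>1\<^sup>2 * q\<^sup>2 \<le> r * \<beta>1\<^sup>2 * (a1 * X\<^sup>2)"
      using q r by (intro mult_left_mono) auto
    then have 3: "r * \<beta>1\<^sup>2 * q\<^sup>2 \<le> \<kappa> / 2 * X\<^sup>2"
      using r(2) by (metis mult.assoc mult.left_commute)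
    have "c \<le> \<kappa> / 2" "c \<le> 1 - 1 / (1 + r)"
      unfolding c_def by (rule min.cobounded1, rule min.cobounded2)
    then have "c * X\<^sup>2 \<le> \<kappa> / 2 * X\<^sup>2" "c * Y\<^sup>2 \<le> (1 - 1 / (1 + r)) * Y\<^sup>2"
      by (simp_all only: mult_right_mono[OF _ zero_le_power2])
    with 1 2 3 have "c * (X\<^sup>2 + Y\<^sup>2) \<le> (1 - k) * X\<^sup>2 + \<alpha> * q\<^sup>2 + Y\<^sup>2 - 2 * \<beta>1 * q * Y"
      by (simp add: algebra_simps)
    then show ?thesis by (simp add: X_def q_def Y_def)
  qed
  then show ?thesis using c by blast
qed

lemma E_coercive: "\<exists>c>0. \<forall>t\<ge>0. c * e t \<le> E t"
proof -
  obtain c where c: "0 < c" and le: "\<And>(x::'a) (y::'a). c * ((norm x)\<^sup>2 + (norm y)\<^sup>2)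
     \<le> (1 - k) * (norm x)\<^sup>2 + \<alpha> * (norm (Q1 x))\<^sup>2 + (norm y)\<^sup>2 - 2 * \<beta>1 * norm (Q1 x) * norm y"
    using potential_coercive by blast
  define d where "d = min (c / 2) (1 / 2)"
  have "d * e t \<le> E t" if t: "0 \<le> t" for t
  proof -
    \<comment> \<open>Shifting the coupling to the side of \<open>v\<close> brings in
      \<open>norm (u t)\<close> instead of \<open>norm (U t)\<close>, and it is the former that
      \<alpha> and the gap condition compensate.\<close>
    have "C1 (U t) \<bullet> v t = u t \<bullet> C2 (V t)"
      by (simp add: v_eq u_eq t cross)
    moreover have "- (u t \<bullet> C2 (V t)) \<le> norm (u t) * (\<beta>1 * norm (V t))"
      using Cauchy_Schwarz_ineq2[of "u t" "C2 (V t)"] mult_left_mono[OF C2_le[of "V t"] norm_ge_zero[of "u t"]]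
      by linarith
    ultimately have 1: "- (C1 (U t) \<bullet> v t) \<le> \<beta>1 * norm (u t) * norm (V t)"
      by (simp add: mult_ac)
    have 2: "c * ((norm (U t))\<^sup>2 + (norm (V t))\<^sup>2)
     \<le> (1 - k) * (norm (U t))\<^sup>2 + \<alpha> * (norm (u t))\<^sup>2 + (norm (V t))\<^sup>2 - 2 * \<beta>1 * norm (u t) * norm (V t)"
      using le[of "U t" "V t"] by (simp add: u_eq t)
    have "d * e t = d * ((norm (u1 t))\<^sup>2 + (norm (v1 t))\<^sup>2) + d * ((norm (U t))\<^sup>2 + (norm (V t))\<^sup>2)"
      by (simp add: e_def algebra_simps)
    also have "\<dots> \<le> 1/2 * ((norm (u1 t))\<^sup>2 + (norm (v1 t))\<^sup>2) + c/2 * ((norm (U t))\<^sup>2 + (norm (V t))\<^sup>2)"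
      by (intro add_mono mult_right_mono) (auto simp: d_def)
    also have "\<dots> \<le> E t"
      using 1 2 by (simp add: E_def field_simps)
    finally show ?thesis .
  qed
  moreover have "0 < d" using c by (simp add: d_def)
  ultimately show ?thesis by blast
qed

lemma E_le_e: "\<exists>K\<ge>0. \<forall>t\<ge>0. E t \<le> K * e t"
proof -
  define K where "K = 1 + (1 - k) + \<alpha> * a1 + \<beta>1 * (1 + a2)"
  have K0: "0 \<le> K" unfolding K_def using params by (intro add_nonneg_nonneg mult_nonneg_nonneg) auto
  have "E t \<le> K * e t" if t: "0 \<le> t" for t
  proof -
    have "C1 (U t) \<bullet> v t \<le> (\<beta>1 * norm (U t)) * norm (v t)"
      using norm_cauchy_schwarz[of "C1 (U t)" "v t"] mult_right_mono[OF C1_le[of "U t"] norm_ge_zero[of "v t"]]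
      by linarith
    also have "\<dots> \<le> \<beta>1 * ((norm (U t))\<^sup>2 + (norm (v t))\<^sup>2)"
    proof -
      have "norm (U t) * norm (v t) \<le> (norm (U t))\<^sup>2 + (norm (v t))\<^sup>2"
        using sum_squares_bound[of "norm (U t)" "norm (v t)"]
          mult_nonneg_nonneg[OF norm_ge_zero[of "U t"] norm_ge_zero[of "v t"]] by linarith
      then show ?thesis
        using params by (simp add: mult.assoc)
    qed
    also have "\<dots> \<le> \<beta>1 * ((norm (U t))\<^sup>2 + a2 * (norm (V t))\<^sup>2)"
      using params v_le[OF t] by (intro mult_left_mono) auto
    finally have 1: "C1 (U t) \<bullet> v t \<le> \<beta>1 * ((norm (U t))\<^sup>2 + a2 * (norm (V t))\<^sup>2)" .
    have 2: "\<alpha> * (norm (u t))\<^sup>2 \<le> \<alpha> * (a1 * (norm (U t))\<^sup>2)"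
      using params u_le[OF t] by (intro mult_left_mono) auto
    let ?a = "(norm (u1 t))\<^sup>2" and ?b = "(norm (U t))\<^sup>2" and ?c = "(norm (v1 t))\<^sup>2" and ?d = "(norm (V t))\<^sup>2"
    have "E t \<le> ?a + (1 - k) * ?b + ?c + ?d + \<alpha> * a1 * ?b + (\<beta>1 * ?b + \<beta>1 * a2 * ?d)"
    proof -
      have "0 \<le> ?a" "0 \<le> (1 - k) * ?b" "0 \<le> ?c" "0 \<le> ?d" "0 \<le> \<alpha> * (norm (u t))\<^sup>2"
        using params by auto
      moreover have "E t = 1/2 * ?a + 1/2 * ((1 - k) * ?b) + 1/2 * ?c + 1/2 * ?d + 1/2 * (\<alpha> * (norm (u t))\<^sup>2) + C1 (U t) \<bullet> v t"
        by (simp add: E_def)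
      moreover have "\<alpha> * (a1 * ?b) = \<alpha> * a1 * ?b" "\<beta>1 * (?b + a2 * ?d) = \<beta>1 * ?b + \<beta>1 * a2 * ?d"
        by (simp_all add: algebra_simps)
      ultimately show ?thesis
        using 1 2 by linarith
    qed
    also have "\<dots> \<le> K * ?a + K * ?b + K * ?c + K * ?d"
    proof -
      have "?a \<le> K * ?a" "?c \<le> K * ?c" "(1 - k + \<alpha> * a1 + \<beta>1) * ?b \<le> K * ?b" "(1 + \<beta>1 * a2) * ?d \<le> K * ?d"
      proof -
        have "0 \<le> \<alpha> * a1" "0 \<le> \<beta>1 * a2" "0 \<le> 1 - k" "0 \<le> \<beta>1"
          using params by auto
        then have "1 \<le> K" "1 - k + \<alpha> * a1 + \<beta>1 \<le> K" "1 + \<beta>1 * a2 \<le> K"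
          by (simp_all add: K_def distrib_left)
        then show "?a \<le> K * ?a" "?c \<le> K * ?c" "(1 - k + \<alpha> * a1 + \<beta>1) * ?b \<le> K * ?b" "(1 + \<beta>1 * a2) * ?d \<le> K * ?d"
          using mult_right_mono[of 1 K ?a] mult_right_mono[of 1 K ?c] mult_right_mono[of _ K ?b] mult_right_mono[of _ K ?d]
          by simp_all
      qed
      then show ?thesis
        by (simp add: algebra_simps)
    qed
    finally show ?thesis
      by (simp add: e_def algebra_simps)
  qed
  with K0 show ?thesis by blast
qed

section \<open>The weighted energy inequality\<close>

lemma exp_convol:
  assumes t: "0 \<le> t"
  shows "convol G W t = convol (\<lambda>t. G t - \<delta> * exp (- N * t)) W t + \<delta> *\<^sub>R z t"
proof -
  have i: "(\<lambda>s. (G (t - s) - \<delta> * exp (- N * (t - s))) *\<^sub>R W s) integrable_on {0..t}"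
    by (rule convol_integrable(1)) (intro continuous_intros cont)+
  have j: "(\<lambda>s. exp (- N * (t - s)) *\<^sub>R W s) integrable_on {0..t}"
    by (rule convol_integrable(1)) (intro continuous_intros cont)+
  have j': "(\<lambda>s. \<delta> *\<^sub>R exp (- N * (t - s)) *\<^sub>R W s) integrable_on {0..t}"
    and jz: "integral {0..t} (\<lambda>s. \<delta> *\<^sub>R exp (- N * (t - s)) *\<^sub>R W s) = \<delta> *\<^sub>R z t"
    using integrable_linear[OF j bounded_linear_scaleR_right[of \<delta>]]
      integral_linear[OF j bounded_linear_scaleR_right[of \<delta>]] by (simp_all only: o_def z_def convol_def)
  have "G (t - s) *\<^sub>R W s = (G (t - s) - \<delta> * exp (- N * (t - s))) *\<^sub>R W s + \<delta> *\<^sub>R exp (- N * (t - s)) *\<^sub>R W s" for s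
    by (simp only: scaleR_scaleR scaleR_left_diff_distrib diff_add_cancel)
  then have "convol G W t = integral {0..t} (\<lambda>s. (G (t - s) - \<delta> * exp (- N * (t - s))) *\<^sub>R W s + \<delta> *\<^sub>R exp (- N * (t - s)) *\<^sub>R W s)"
    unfolding convol_def by (rule integral_cong)
  also have "\<dots> = convol (\<lambda>t. G t - \<delta> * exp (- N * t)) W t + \<delta> *\<^sub>R z t"
    unfolding integral_add[OF i j'] jz by (simp add: convol_def)
  finally show ?thesis .
qed

definition pdf :: "real \<Rightarrow> real" where "pdf t = convol (\<lambda>t. G t - \<delta> * exp (- N * t)) W t \<bullet> W t"

lemma pdf_cont: "continuous_on {0..} pdf"
  unfolding pdf_def by (intro continuous_intros convol_continuous cont)

text \<open>This is the second mean value theorem, for the decreasing factor \<open>(t + 1) powr (m - lam0)\<close>.\<close>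

lemma pdf_wint_nonneg:
  assumes m: "m \<le> lam0" and T: "0 \<le> T"
  shows "0 \<le> wint m pdf T"
proof -
  let ?F = "\<lambda>T. integral {0..T} (\<lambda>t. (t + 1) powr lam0 * pdf t)"
  have F0: "0 \<le> ?F T" if "0 \<le> T" for T
    using pd[OF that] by (simp add: pdf_def)
  have pc: "continuous_on {0..} (\<lambda>t. (t + 1) powr lam0 * pdf t)"
    by (intro continuous_on_mult continuous_on_weight pdf_cont)
  have FD: "(?F has_real_derivative (t + 1) powr lam0 * pdf t) (at t within {0..})" if "0 \<le> t" for t
    by (rule integral_has_real_derivative_within[OF pc that])
  have Fc: "continuous_on {0..} ?F"
    by (rule DERIV_continuous_on) (rule FD, simp)
  have "wint m pdf T = wint (m - lam0) (\<lambda>t. (t + 1) powr lam0 * pdf t) T"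
    unfolding wint_def by (rule integral_cong) (simp only: mult.assoc[symmetric] powr_add[symmetric] diff_add_cancel)
  also have "\<dots> = (T + 1) powr (m - lam0) * ?F T - ?F 0 - (m - lam0) * wint (m - lam0 - 1) ?F T"
    using FD pc T by (rule wint_by_parts)
  also have "0 \<le> \<dots>"
  proof -
    have "0 \<le> wint (m - lam0 - 1) ?F T"
      by (rule wint_nonneg[OF Fc F0])
    then have "0 \<le> (lam0 - m) * wint (m - lam0 - 1) ?F T"
      using m by (intro mult_nonneg_nonneg) auto
    moreover have "0 \<le> (T + 1) powr (m - lam0) * ?F T"
      using F0[OF T] by (intro mult_nonneg_nonneg) auto
    moreover have "?F 0 = 0" by simp
    ultimately show ?thesis
      by (simp add: left_diff_distrib)
  qed
  finally show ?thesis .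
qed

text \<open>Per unit of the supremum of \<open>norm (U t)\<close>, the four contributions of the
  partial integration in \<open>history_term\<close>: end point, initial point, derivative of the
  weight and derivative of \<open>G\<close>.\<close>

definition Kh :: real where
  "Kh = norm (U 0) * (Kg + \<bar>k\<bar> + lam0 * integral {0<..} (\<lambda>t. (t + 1) powr (lam0 - 1) * \<bar>G t\<bar>)
     + integral {0<..} (\<lambda>t. (t + 1) powr lam0 * \<bar>g t\<bar>))"

text \<open>The initial datum is paired with the uncontrolled \<open>W\<close>, so the derivative is
  moved to the weighted kernel. That the result is linear in the bound \<open>M\<close> is decisive
  for \<open>U_bounded\<close>.\<close>

lemma history_term:
  assumes m: "0 \<le> m" "m \<le> lam0" and T: "0 \<le> T" and M: "\<And>t. t \<in> {0..T} \<Longrightarrow> norm (U t) \<le> M"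
  shows "- wint m (\<lambda>t. G t * (W t \<bullet> U 0)) T \<le> M * Kh"
proof -
  have M0: "0 \<le> M" using order_trans[OF norm_ge_zero M[of 0]] T by simp
  let ?f = "\<lambda>t. U t \<bullet> U 0"
  have fc: "continuous_on {0..} ?f" by (intro continuous_intros cont)
  have wc: "continuous_on {0..} (\<lambda>t. W t \<bullet> U 0)" by (intro continuous_intros cont)
  have fM: "\<bar>?f t\<bar> \<le> M * norm (U 0)" if "t \<in> {0..T}" for t
    using Cauchy_Schwarz_ineq2[of "U t" "U 0"] mult_right_mono[OF M[OF that] norm_ge_zero[of "U 0"]] by linarith
  have MU: "0 \<le> M * norm (U 0)" using M0 by simp
  have D: "((\<lambda>t. G t * ?f t) has_real_derivative G t * (W t \<bullet> U 0) - g t * ?f t) (at t within {0..})" if t: "0 \<le> t" for t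
  proof -
    have "((\<lambda>t. U t \<bullet> U 0) has_real_derivative U t \<bullet> 0 + W t \<bullet> U 0) (at t within {0..})"
      by (rule has_real_derivative_inner[OF U_deriv[OF t]]) (rule has_vector_derivative_const)
    from DERIV_mult[OF G_deriv[OF t] this] show ?thesis
      by (simp add: algebra_simps)
  qed
  have c: "continuous_on {0..} (\<lambda>t. G t * (W t \<bullet> U 0) - g t * ?f t)"
    by (intro continuous_intros cont)
  have p: "wint m (\<lambda>t. G t * (W t \<bullet> U 0) - g t * ?f t) T
      = (T + 1) powr m * (G T * ?f T) - G 0 * ?f 0 - m * wint (m - 1) (\<lambda>t. G t * ?f t) T"
    using D c T by (rule wint_by_parts)
  have "wint m (\<lambda>t. G t * (W t \<bullet> U 0)) T
      = wint m (\<lambda>t. (G t * (W t \<bullet> U 0) - g t * ?f t) + g t * ?f t) T"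
    by simp
  also have "\<dots> = wint m (\<lambda>t. G t * (W t \<bullet> U 0) - g t * ?f t) T + wint m (\<lambda>t. g t * ?f t) T"
    by (intro wint_add c continuous_intros cont)
  finally have eq: "wint m (\<lambda>t. G t * (W t \<bullet> U 0)) T
      = (T + 1) powr m * (G T * ?f T) - G 0 * ?f 0 - m * wint (m - 1) (\<lambda>t. G t * ?f t) T + wint m (\<lambda>t. g t * ?f t) T"
    unfolding p .
  have 1: "\<bar>(T + 1) powr m * (G T * ?f T)\<bar> \<le> Kg * (M * norm (U 0))"
  proof -
    have "(T + 1) powr m * \<bar>G T\<bar> \<le> (T + 1) powr lam0 * \<bar>G T\<bar>"
      using T m by (intro mult_right_mono powr_mono) auto
    also have "\<dots> \<le> Kg" by (rule G_le[OF T])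
    finally have GK: "(T + 1) powr m * \<bar>G T\<bar> \<le> Kg" .
    have "0 \<le> (T + 1) powr m * \<bar>G T\<bar>" by simp
    with GK have "0 \<le> Kg" by linarith
    then have "((T + 1) powr m * \<bar>G T\<bar>) * \<bar>?f T\<bar> \<le> Kg * (M * norm (U 0))"
      using fM[of T] T GK by (intro mult_mono) auto
    then show ?thesis by (simp add: abs_mult mult.assoc)
  qed
  have 2: "\<bar>G 0 * ?f 0\<bar> \<le> \<bar>k\<bar> * (M * norm (U 0))"
    unfolding abs_mult G_0 using fM[of 0] T by (intro mult_left_mono) auto
  have 3: "\<bar>m * wint (m - 1) (\<lambda>t. G t * ?f t) T\<bar> \<le> lam0 * ((M * norm (U 0)) * integral {0<..} (\<lambda>t. (t + 1) powr (lam0 - 1) * \<bar>G t\<bar>))"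
    unfolding abs_mult using m abs_wint_le[OF G_cont fc _ G_int fM MU, of "m - 1"]
    by (intro mult_mono) auto
  have 4: "\<bar>wint m (\<lambda>t. g t * ?f t) T\<bar> \<le> (M * norm (U 0)) * integral {0<..} (\<lambda>t. (t + 1) powr lam0 * \<bar>g t\<bar>)"
    using m by (intro abs_wint_le[OF g_cont fc _ g_int fM MU]) auto
  have "- wint m (\<lambda>t. G t * (W t \<bullet> U 0)) T \<le> Kg * (M * norm (U 0)) + \<bar>k\<bar> * (M * norm (U 0))
      + lam0 * ((M * norm (U 0)) * integral {0<..} (\<lambda>t. (t + 1) powr (lam0 - 1) * \<bar>G t\<bar>))
      + (M * norm (U 0)) * integral {0<..} (\<lambda>t. (t + 1) powr lam0 * \<bar>g t\<bar>)"
    unfolding eq using 1 2 3 4 by linarith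
  also have "\<dots> = M * Kh"
    by (simp add: Kh_def algebra_simps)
  finally show ?thesis .
qed

text \<open>Writing \<open>W = z' + N z\<close> turns \<open>z \<bullet> W\<close> into half the
  derivative of the square of \<open>norm z\<close> plus \<open>N\<close> times that square; the
  last term is the dissipation. The rest of the kernel contributes \<open>pdf\<close>, whose
  weighted integral is nonnegative.\<close>

lemma energy_estimate:
  assumes m: "0 \<le> m" "m \<le> lam0" and T: "0 \<le> T" and M: "\<And>t. t \<in> {0..T} \<Longrightarrow> norm (U t) \<le> M"
  shows "(T + 1) powr m * E T + \<delta> / 2 * ((T + 1) powr m * (norm (z T))\<^sup>2) + \<delta> * N * wint m (\<lambda>t. (norm (z t))\<^sup>2) T
    \<le> E 0 + M * Kh + m * wint (m - 1) E T + \<delta> / 2 * (m * wint (m - 1) (\<lambda>t. (norm (z t))\<^sup>2) T)"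
proof -
  let ?H = "\<lambda>t. G t * (W t \<bullet> U 0)"
  define Z where "Z = (\<lambda>t. z t \<bullet> W t - N * (norm (z t))\<^sup>2)"
  have z2: "continuous_on {0..} (\<lambda>t. (norm (z t))\<^sup>2)" "continuous_on {0..} (\<lambda>t. z t \<bullet> W t)"
    by (intro continuous_intros z_cont cont)+
  have Zc: "continuous_on {0..} Z" unfolding Z_def by (intro continuous_intros z_cont cont)
  have Hc: "continuous_on {0..} ?H" by (intro continuous_intros cont)
  have E': "(E has_real_derivative - 1 * pdf t + ((- \<delta>) * (z t \<bullet> W t) + (-1) * ?H t)) (at t within {0..})" if t: "0 \<le> t" for t
    by (rule DERIV_cong[OF E_deriv[OF t]]) (simp add: exp_convol[OF t] pdf_def inner_add_left)
  have cE': "continuous_on {0..} (\<lambda>t. - 1 * pdf t + ((- \<delta>) * (z t \<bullet> W t) + (-1) * ?H t))"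
    by (intro continuous_intros pdf_cont z2 Hc)
  have "wint m (\<lambda>t. - 1 * pdf t + ((- \<delta>) * (z t \<bullet> W t) + (-1) * ?H t)) T = (T + 1) powr m * E T - E 0 - m * wint (m - 1) E T"
    using E' cE' T by (rule wint_by_parts)
  moreover have "wint m (\<lambda>t. - 1 * pdf t + ((- \<delta>) * (z t \<bullet> W t) + (-1) * ?H t)) T
      = - wint m pdf T - \<delta> * wint m (\<lambda>t. z t \<bullet> W t) T - wint m ?H T"
  proof -
    have a: "continuous_on {0..} (\<lambda>t. - 1 * pdf t)" "continuous_on {0..} (\<lambda>t. (- \<delta>) * (z t \<bullet> W t))" "continuous_on {0..} (\<lambda>t. (-1) * ?H t)"
      by (intro continuous_intros pdf_cont z2 Hc)+
    show ?thesis
      unfolding wint_add[OF a(1) continuous_on_add[OF a(2,3)]] wint_add[OF a(2,3)] wint_cmult by simp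
  qed
  moreover have "wint m (\<lambda>t. z t \<bullet> W t) T = 1/2 * ((T + 1) powr m * (norm (z T))\<^sup>2)
      - m / 2 * wint (m - 1) (\<lambda>t. (norm (z t))\<^sup>2) T + N * wint m (\<lambda>t. (norm (z t))\<^sup>2) T"
  proof -
    have D: "((\<lambda>t. 1/2 * (norm (z t))\<^sup>2) has_real_derivative Z t) (at t within {0..})" if t: "0 \<le> t" for t
      unfolding power2_norm_eq_inner
      by (rule DERIV_cong[OF DERIV_cmult[OF has_real_derivative_inner[OF z_deriv[OF t] z_deriv[OF t]]]])
        (simp add: Z_def power2_norm_eq_inner inner_diff_left inner_diff_right inner_commute)
    have "wint m Z T = (T + 1) powr m * (1/2 * (norm (z T))\<^sup>2) - 1/2 * (norm (z 0))\<^sup>2 - m * wint (m - 1) (\<lambda>t. 1/2 * (norm (z t))\<^sup>2) T"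
      using D Zc T by (rule wint_by_parts)
    moreover have "wint m (\<lambda>t. z t \<bullet> W t) T = wint m (\<lambda>t. Z t + N * (norm (z t))\<^sup>2) T"
      by (simp add: Z_def)
    moreover have "\<dots> = wint m Z T + N * wint m (\<lambda>t. (norm (z t))\<^sup>2) T"
      unfolding wint_cmult[symmetric] by (intro wint_add Zc continuous_intros z_cont)
    ultimately show ?thesis
      by (simp only: wint_cmult z_0) simp
  qed
  moreover have "0 \<le> wint m pdf T"
    by (rule pdf_wint_nonneg[OF m(2) T])
  moreover have "- wint m ?H T \<le> M * Kh"
    by (rule history_term[OF m T M])
  ultimately show ?thesis
    by (simp add: algebra_simps)
qed

text \<open>The energy inequality with \<open>m = 0\<close> at a maximum point of
  \<open>norm (U t)\<close> on \<open>{0..T}\<close>, so that \<open>M\<close> is the value there.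
  The left side is at least quadratic in this value and the right side affine, which bounds it
  independently of \<open>T\<close>.\<close>

lemma U_bounded: "\<exists>B. \<forall>t\<ge>0. norm (U t) \<le> B"
proof -
  obtain c where c: "0 < c" "\<And>t. 0 \<le> t \<Longrightarrow> c * e t \<le> E t"
    using E_coercive by blast
  define B where "B = max 1 ((\<bar>E 0\<bar> + \<bar>Kh\<bar>) / c)"
  have "norm (U T) \<le> B" if T: "0 \<le> T" for T
  proof -
    have "continuous_on {0..T} (\<lambda>t. norm (U t))"
      by (intro continuous_intros continuous_on_subset[OF cont(5)]) auto
    then obtain t where t: "t \<in> {0..T}" "\<And>s. s \<in> {0..T} \<Longrightarrow> norm (U s) \<le> norm (U t)"
      using continuous_attains_sup[of "{0..T}" "\<lambda>t. norm (U t)"] T by auto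
    let ?x = "norm (U t)"
    have t0: "0 \<le> t" using t(1) by simp
    have "(t + 1) powr 0 * E t + \<delta> / 2 * ((t + 1) powr 0 * (norm (z t))\<^sup>2) + \<delta> * N * wint 0 (\<lambda>t. (norm (z t))\<^sup>2) t
      \<le> E 0 + ?x * Kh"
      using energy_estimate[of 0 t ?x] lam0 t by simp
    moreover have "0 \<le> \<delta> / 2 * ((t + 1) powr 0 * (norm (z t))\<^sup>2)" "0 \<le> \<delta> * N * wint 0 (\<lambda>t. (norm (z t))\<^sup>2) t"
      using params by (auto intro!: mult_nonneg_nonneg wint_nonneg continuous_intros z_cont)
    moreover have "(t + 1) powr 0 * E t = E t"
      using t0 by simp
    ultimately have "E t \<le> E 0 + ?x * Kh"
      by linarith
    moreover have "c * ?x\<^sup>2 \<le> c * e t"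
      using c(1) by (intro mult_left_mono) (auto simp: e_def)
    moreover have "?x * Kh \<le> ?x * \<bar>Kh\<bar>"
      by (intro mult_left_mono) auto
    ultimately have le: "c * ?x\<^sup>2 \<le> \<bar>E 0\<bar> + ?x * \<bar>Kh\<bar>"
      using c(2)[OF t0] by linarith
    have "?x \<le> B"
    proof (cases "?x \<le> 1")
      case False
      then have "\<bar>E 0\<bar> * 1 \<le> \<bar>E 0\<bar> * ?x"
        by (intro mult_left_mono) auto
      with le have "(c * ?x) * ?x \<le> (\<bar>E 0\<bar> + \<bar>Kh\<bar>) * ?x"
        by (simp add: power2_eq_square algebra_simps)
      then have "c * ?x \<le> \<bar>E 0\<bar> + \<bar>Kh\<bar>"
        using False by (auto simp: mult_le_cancel_right)
      then have "?x \<le> (\<bar>E 0\<bar> + \<bar>Kh\<bar>) / c"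
        using c(1) by (simp add: field_simps)
      then show ?thesis by (simp add: B_def)
    qed (simp add: B_def)
    with t(2)[of T] T show ?thesis by simp
  qed
  then show ?thesis by blast
qed

text \<open>Half of the dissipation absorbs the derivative of the weight against the square of
  \<open>norm z\<close>. The corresponding term with \<open>E\<close> is kept: it is absorbed in
  \<open>energy_boundary\<close> but bounded directly in the final decay argument.\<close>

lemma weighted_energy_estimate:
  assumes m: "0 \<le> m" "m \<le> lam0"
  shows "\<exists>C. \<forall>T\<ge>0. (T + 1) powr m * E T + \<delta> / 2 * ((T + 1) powr m * (norm (z T))\<^sup>2)
    + \<delta> * N / 2 * wint m (\<lambda>t. (norm (z t))\<^sup>2) T \<le> C + m * wint (m - 1) E T"
proof -
  obtain B where B: "\<And>t. 0 \<le> t \<Longrightarrow> norm (U t) \<le> B"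
    using U_bounded by blast
  have zc: "continuous_on {0..} (\<lambda>t. (norm (z t))\<^sup>2)"
    by (intro continuous_intros z_cont)
  obtain C where C: "\<And>T. 0 \<le> T \<Longrightarrow> m * wint (m - 1) (\<lambda>t. (norm (z t))\<^sup>2) T \<le> C + N * wint m (\<lambda>t. (norm (z t))\<^sup>2) T"
    using weight_derivative_absorb[OF zc _ params(2) m(1)] by auto
  have "(T + 1) powr m * E T + \<delta> / 2 * ((T + 1) powr m * (norm (z T))\<^sup>2)
    + \<delta> * N / 2 * wint m (\<lambda>t. (norm (z t))\<^sup>2) T \<le> (E 0 + B * Kh + \<delta> / 2 * C) + m * wint (m - 1) E T" if T: "0 \<le> T" for T
  proof -
    have "\<delta> / 2 * (m * wint (m - 1) (\<lambda>t. (norm (z t))\<^sup>2) T) \<le> \<delta> / 2 * (C + N * wint m (\<lambda>t. (norm (z t))\<^sup>2) T)"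
      using params C[OF T] by (intro mult_left_mono) auto
    moreover have "(T + 1) powr m * E T + \<delta> / 2 * ((T + 1) powr m * (norm (z T))\<^sup>2) + \<delta> * N * wint m (\<lambda>t. (norm (z t))\<^sup>2) T
      \<le> E 0 + B * Kh + m * wint (m - 1) E T + \<delta> / 2 * (m * wint (m - 1) (\<lambda>t. (norm (z t))\<^sup>2) T)"
      by (rule energy_estimate[OF m T]) (use B in auto)
    ultimately show ?thesis
      by (simp add: algebra_simps)
  qed
  then show ?thesis by blast
qed

end

section \<open>Vector-valued functions that are small or dominated by \<open>eh\<close>\<close>

lemma norm_add_square_le:
  fixes a b :: "'b::real_normed_vector"
  shows "(norm (a + b))\<^sup>2 \<le> 2 * (norm a)\<^sup>2 + 2 * (norm b)\<^sup>2"
proof -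
  have "(norm (a + b))\<^sup>2 \<le> (norm a + norm b)\<^sup>2"
    by (intro power_mono norm_triangle_ineq) auto
  also have "\<dots> \<le> 2 * (norm a)\<^sup>2 + 2 * (norm b)\<^sup>2"
    using sum_squares_bound[of "norm a" "norm b"] by (simp add: power2_sum)
  finally show ?thesis .
qed

lemma bounded_linear_square_le:
  assumes "bounded_linear L"
  shows "\<exists>K\<ge>0. \<forall>x. (norm (L x))\<^sup>2 \<le> K * (norm x)\<^sup>2"
proof -
  obtain K where K: "0 \<le> K" "\<And>x. norm (L x) \<le> norm x * K"
    using bounded_linear.nonneg_bounded[OF assms] by blast
  have "(norm (L x))\<^sup>2 \<le> K\<^sup>2 * (norm x)\<^sup>2" for x
    using power_mono[OF K(2)[of x], of 2] by (simp add: power_mult_distrib mult.commute)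
  then show ?thesis by (intro exI[of _ "K\<^sup>2"]) auto
qed

context weighted_energy
begin

text \<open>Boundary terms of partial integrations must be dominated by \<open>eh\<close>, which is what \<open>bg\<close> records;
  \<open>sm\<close> means negligible in weighted \<open>L\<^sup>2\<close> compared with the energy.\<close>

definition sm :: "(real \<Rightarrow> 'b::real_inner) \<Rightarrow> bool" where
  "sm f \<longleftrightarrow> continuous_on {0..} f \<and> small (\<lambda>t. (norm (f t))\<^sup>2)"

definition bg :: "(real \<Rightarrow> 'b::real_inner) \<Rightarrow> bool" where
  "bg f \<longleftrightarrow> continuous_on {0..} f \<and> (\<exists>K\<ge>0. \<forall>t\<ge>0. (norm (f t))\<^sup>2 \<le> K * eh t)"

lemma bg_big: "bg f \<Longrightarrow> big (\<lambda>t. (norm (f t))\<^sup>2)"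
  unfolding bg_def by (elim conjE exE) (rule big_mono[OF big_cmult[OF big_eh]], auto intro!: continuous_intros)

lemma bg_bounded_linear:
  assumes L: "bounded_linear L" and f: "bg f"
  shows "bg (\<lambda>t. L (f t))"
proof -
  obtain K where K: "0 \<le> K" "\<And>x. (norm (L x))\<^sup>2 \<le> K * (norm x)\<^sup>2"
    using bounded_linear_square_le[OF L] by blast
  obtain K' where K': "0 \<le> K'" "\<And>t. 0 \<le> t \<Longrightarrow> (norm (f t))\<^sup>2 \<le> K' * eh t"
    using f unfolding bg_def by blast
  have "(norm (L (f t)))\<^sup>2 \<le> (K * K') * eh t" if "0 \<le> t" for t
    using K(2)[of "f t"] mult_left_mono[OF K'(2)[OF that] K(1)] by (simp add: mult.assoc)
  moreover have "continuous_on {0..} (\<lambda>t. L (f t))"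
    using f by (intro bounded_linear.continuous_on[OF L]) (simp add: bg_def)
  ultimately show ?thesis
    unfolding bg_def using K(1) K'(1) by (intro conjI exI[of _ "K * K'"]) auto
qed

lemma bg_add:
  assumes "bg f" "bg h"
  shows "bg (\<lambda>t. f t + h t)"
proof -
  obtain K where K: "0 \<le> K" "\<And>t. 0 \<le> t \<Longrightarrow> (norm (f t))\<^sup>2 \<le> K * eh t"
    using assms unfolding bg_def by blast
  obtain K' where K': "0 \<le> K'" "\<And>t. 0 \<le> t \<Longrightarrow> (norm (h t))\<^sup>2 \<le> K' * eh t"
    using assms unfolding bg_def by blast
  have "(norm (f t + h t))\<^sup>2 \<le> (2 * K + 2 * K') * eh t" if "0 \<le> t" for t
    using norm_add_square_le[of "f t" "h t"] K(2)[OF that] K'(2)[OF that] by (simp add: algebra_simps)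
  moreover have "continuous_on {0..} (\<lambda>t. f t + h t)"
    using assms by (intro continuous_intros) (auto simp: bg_def)
  ultimately show ?thesis
    unfolding bg_def using K(1) K'(1) by (intro conjI exI[of _ "2 * K + 2 * K'"]) auto
qed

lemma bg_scaleR: "bg f \<Longrightarrow> bg (\<lambda>t. c *\<^sub>R f t)"
  by (rule bg_bounded_linear[OF bounded_linear_scaleR_right])

lemma bg_diff: "bg f \<Longrightarrow> bg h \<Longrightarrow> bg (\<lambda>t. f t - h t)"
  using bg_add[of f "\<lambda>t. (-1) *\<^sub>R h t"] bg_scaleR[of h "-1"] by simp

lemma sm_bounded_linear:
  assumes L: "bounded_linear L" and f: "sm f"
  shows "sm (\<lambda>t. L (f t))"
proof -
  obtain K where K: "0 \<le> K" "\<And>x. (norm (L x))\<^sup>2 \<le> K * (norm x)\<^sup>2"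
    using bounded_linear_square_le[OF L] by blast
  have c: "continuous_on {0..} (\<lambda>t. L (f t))"
    using f by (intro bounded_linear.continuous_on[OF L]) (simp add: sm_def)
  have "small (\<lambda>t. K * (norm (f t))\<^sup>2)"
    using f K(1) by (intro small_cmult) (simp_all add: sm_def)
  then have "small (\<lambda>t. (norm (L (f t)))\<^sup>2)"
    by (rule small_mono) (intro continuous_on_power continuous_on_norm c K(2))+
  then show ?thesis
    using c by (simp add: sm_def)
qed

lemma sm_add:
  assumes "sm f" "sm h"
  shows "sm (\<lambda>t. f t + h t)"
proof -
  have c: "continuous_on {0..} (\<lambda>t. f t + h t)"
    using assms by (intro continuous_intros) (auto simp: sm_def)
  have "small (\<lambda>t. 2 * (norm (f t))\<^sup>2 + 2 * (norm (h t))\<^sup>2)"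
    using assms by (intro small_add small_cmult) (auto simp: sm_def)
  then have "small (\<lambda>t. (norm (f t + h t))\<^sup>2)"
    by (rule small_mono) (intro continuous_intros c norm_add_square_le)+
  then show ?thesis
    using c by (simp add: sm_def)
qed

lemma sm_scaleR: "sm f \<Longrightarrow> sm (\<lambda>t. c *\<^sub>R f t)"
  by (rule sm_bounded_linear[OF bounded_linear_scaleR_right])

lemma sm_diff: "sm f \<Longrightarrow> sm h \<Longrightarrow> sm (\<lambda>t. f t - h t)"
  using sm_add[of f "\<lambda>t. (-1) *\<^sub>R h t"] sm_scaleR[of h "-1"] by simp

lemma sm_mono:
  assumes "sm h" "continuous_on {0..} f" "0 \<le> c" "\<And>t. 0 \<le> t \<Longrightarrow> norm (f t) \<le> c * norm (h t)"
  shows "sm f"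
proof -
  have "(norm (f t))\<^sup>2 \<le> c\<^sup>2 * (norm (h t))\<^sup>2" if "0 \<le> t" for t
    using power_mono[OF assms(4)[OF that], of 2] by (simp add: power_mult_distrib)
  note le = this
  have "small (\<lambda>t. c\<^sup>2 * (norm (h t))\<^sup>2)"
    using assms(1) by (intro small_cmult) (simp_all add: sm_def)
  then have "small (\<lambda>t. (norm (f t))\<^sup>2)"
    by (rule small_mono) (intro continuous_on_power continuous_on_norm assms(2), rule le)
  then show ?thesis
    using assms(2) by (simp add: sm_def)
qed

lemma small_inner:
  assumes "sm f" "bg h"
  shows "small (\<lambda>t. f t \<bullet> h t)" "small (\<lambda>t. h t \<bullet> f t)" "small (\<lambda>t. - (f t \<bullet> h t))" "small (\<lambda>t. - (h t \<bullet> f t))"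
    "small (\<lambda>t. norm (f t) * norm (h t))"
proof -
  have c: "continuous_on {0..} f" "continuous_on {0..} h"
    using assms by (auto simp: sm_def bg_def)
  have *: "small k" if "continuous_on {0..} k" "\<And>t. 0 \<le> t \<Longrightarrow> k t \<le> norm (f t) * norm (h t)" for k
    by (rule small_product[of "\<lambda>t. norm (f t)" "\<lambda>t. norm (h t)" k 1])
      (use assms bg_big[OF assms(2)] that in \<open>auto simp: sm_def\<close>)
  have le: "\<bar>f t \<bullet> h t\<bar> \<le> norm (f t) * norm (h t)" for t
    by (rule Cauchy_Schwarz_ineq2)
  show "small (\<lambda>t. f t \<bullet> h t)" "small (\<lambda>t. h t \<bullet> f t)" "small (\<lambda>t. - (f t \<bullet> h t))" "small (\<lambda>t. - (h t \<bullet> f t))"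
    "small (\<lambda>t. norm (f t) * norm (h t))"
    using le by (intro *; auto intro!: continuous_intros c simp: inner_commute abs_le_iff)+
qed

text \<open>Only \<open>a\<close> and \<open>b\<close> have to be dominated by \<open>eh\<close>;
  their derivatives are arbitrary continuous functions. The multiplier identities discard
  \<open>u2\<close>, \<open>v2\<close>, \<open>W\<close> and \<open>V1\<close> in this way.\<close>

lemma small_inner_derivative:
  fixes a b :: "real \<Rightarrow> 'b::real_inner"
  assumes "bg a" "bg b"
    and a: "\<And>t. 0 \<le> t \<Longrightarrow> (a has_vector_derivative a' t) (at t within {0..})"
    and b: "\<And>t. 0 \<le> t \<Longrightarrow> (b has_vector_derivative b' t) (at t within {0..})"
    and c: "continuous_on {0..} a'" "continuous_on {0..} b'"
  shows "small (\<lambda>t. a t \<bullet> b' t + a' t \<bullet> b t)" "small (\<lambda>t. - (a t \<bullet> b' t + a' t \<bullet> b t))"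
proof -
  have c': "continuous_on {0..} a" "continuous_on {0..} b"
    using assms by (auto simp: bg_def)
  obtain K where K: "0 \<le> K" "\<And>t. 0 \<le> t \<Longrightarrow> (norm (a t))\<^sup>2 \<le> K * eh t"
    using assms unfolding bg_def by blast
  obtain K' where K': "0 \<le> K'" "\<And>t. 0 \<le> t \<Longrightarrow> (norm (b t))\<^sup>2 \<le> K' * eh t"
    using assms unfolding bg_def by blast
  have le: "\<bar>a t \<bullet> b t\<bar> \<le> (K + K') * eh t" if t: "0 \<le> t" for t
  proof -
    have "norm (a t) * norm (b t) \<le> (norm (a t))\<^sup>2 + (norm (b t))\<^sup>2"
      using sum_squares_bound[of "norm (a t)" "norm (b t)"]
        mult_nonneg_nonneg[OF norm_ge_zero[of "a t"] norm_ge_zero[of "b t"]] by linarith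
    with Cauchy_Schwarz_ineq2[of "a t" "b t"] K(2)[OF t] K'(2)[OF t] show ?thesis
      by (simp add: distrib_right)
  qed
  have D: "((\<lambda>t. a t \<bullet> b t) has_real_derivative a t \<bullet> b' t + a' t \<bullet> b t) (at t within {0..})" if "0 \<le> t" for t
    by (rule has_real_derivative_inner[OF a[OF that] b[OF that]])
  show "small (\<lambda>t. a t \<bullet> b' t + a' t \<bullet> b t)"
    by (rule small_derivative[where F="\<lambda>t. a t \<bullet> b t" and K="K + K'"])
      (use D le in \<open>auto intro!: continuous_intros c c'\<close>)
  show "small (\<lambda>t. - (a t \<bullet> b' t + a' t \<bullet> b t))"
  proof (rule small_derivative[where F="\<lambda>t. - (a t \<bullet> b t)" and K="K + K'"])
    show "((\<lambda>t. - (a t \<bullet> b t)) has_real_derivative - (a t \<bullet> b' t + a' t \<bullet> b t)) (at t within {0..})" if "0 \<le> t" for t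
      by (rule DERIV_minus[OF D[OF that]])
  qed (use le in \<open>auto intro!: continuous_intros c c'\<close>)
qed

lemma sm_convol:
  fixes f :: "real \<Rightarrow> 'b::{real_inner,complete_space}"
  assumes p: "(\<lambda>s. (s + 1) powr (m / 2) * p s) absolutely_integrable_on {0<..}" and pc: "continuous_on {0..} p"
    and f: "sm f"
  shows "sm (convol p f)"
proof -
  have fc: "continuous_on {0..} f" using f by (simp add: sm_def)
  have c: "continuous_on {0..} (convol p f)" by (rule convol_continuous[OF pc fc])
  define P where "P = integral {0<..} (\<lambda>s. (s + 1) powr (m / 2) * \<bar>p s\<bar>)"
  have le: "wint m (\<lambda>t. (norm (convol p f t))\<^sup>2) T \<le> wint m (\<lambda>t. P\<^sup>2 * (norm (f t))\<^sup>2) T" for T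
    unfolding wint_cmult unfolding wint_def P_def
    by (rule weighted_young[OF m p, of "\<lambda>t. norm (f t)" "\<lambda>t. norm (convol p f t)"])
      (auto intro!: continuous_intros c fc norm_convol_le[OF pc fc])
  have "small (\<lambda>t. P\<^sup>2 * (norm (f t))\<^sup>2)"
    using f by (intro small_cmult) (auto simp: sm_def)
  then have "small (\<lambda>t. (norm (convol p f t))\<^sup>2)"
    unfolding small_def using le by (intro conjI continuous_on_power continuous_on_norm c) (meson order_trans)
  then show ?thesis using c by (simp add: sm_def)
qed

end

context damped_system
begin

text \<open>Coercivity turns \<open>weighted_energy_estimate\<close> into a bound for
  \<open>e\<close> and \<open>z\<close> at time \<open>T\<close>; the remaining integral, with
  exponent \<open>m - 1\<close>, is absorbed. The dissipation integral is kept on the left because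
  it is the source of smallness for \<open>z\<close>.\<close>

lemma energy_boundary:
  assumes m: "0 \<le> m" "m \<le> lam0" and \<epsilon>: "0 < \<epsilon>"
  shows "\<exists>C. \<forall>T\<ge>0. (T + 1) powr m * (e T + (norm (z T))\<^sup>2) + wint m (\<lambda>t. (norm (z t))\<^sup>2) T
    \<le> C + \<epsilon> * wint m e T"
proof -
  obtain c where c: "0 < c" "\<And>t. 0 \<le> t \<Longrightarrow> c * e t \<le> E t"
    using E_coercive by blast
  obtain K where K: "0 \<le> K" "\<And>t. 0 \<le> t \<Longrightarrow> E t \<le> K * e t"
    using E_le_e by blast
  obtain C where C: "\<And>T. 0 \<le> T \<Longrightarrow> (T + 1) powr m * E T + \<delta> / 2 * ((T + 1) powr m * (norm (z T))\<^sup>2)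
    + \<delta> * N / 2 * wint m (\<lambda>t. (norm (z t))\<^sup>2) T \<le> C + m * wint (m - 1) E T"
    using weighted_energy_estimate[OF m] by blast
  \<comment> \<open>The smallest of the three coefficients on the left of the energy inequality,
    after \<open>E\<close> is bounded below by \<open>c * e\<close>.\<close>
  define d where "d = min c (min (\<delta> / 2) (\<delta> * N / 2))"
  have d: "0 < d" "d \<le> c" "d \<le> \<delta> / 2" "d \<le> \<delta> * N / 2"
    using c params by (auto simp: d_def)
  define \<epsilon>' where "\<epsilon>' = d * \<epsilon> / (K + 1)"
  have \<epsilon>': "0 < \<epsilon>'" "K * \<epsilon>' \<le> d * \<epsilon>"
    using d(1) K(1) \<epsilon> by (auto simp: \<epsilon>'_def field_simps add_pos_nonneg)
  obtain C' where C': "\<And>T. 0 \<le> T \<Longrightarrow> m * wint (m - 1) e T \<le> C' + \<epsilon>' * wint m e T"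
    using weight_derivative_absorb[OF e_cont e_nonneg \<epsilon>'(1) m(1)] by blast
  have zc: "continuous_on {0..} (\<lambda>t. (norm (z t))\<^sup>2)"
    by (intro continuous_intros z_cont)
  have "(T + 1) powr m * (e T + (norm (z T))\<^sup>2) + wint m (\<lambda>t. (norm (z t))\<^sup>2) T
    \<le> (C + K * C') / d + \<epsilon> * wint m e T" if T: "0 \<le> T" for T
  proof -
    let ?w = "(T + 1) powr m" and ?I = "wint m (\<lambda>t. (norm (z t))\<^sup>2) T"
    have I0: "0 \<le> ?I" "0 \<le> wint m e T"
      by (auto intro!: wint_nonneg zc e_cont e_nonneg)
    have "wint (m - 1) E T \<le> wint (m - 1) (\<lambda>t. K * e t) T"
      using K by (intro wint_mono continuous_intros E_cont e_cont) auto
    then have "m * wint (m - 1) E T \<le> K * (m * wint (m - 1) e T)"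
      using mult_left_mono[of "wint (m - 1) E T" "K * wint (m - 1) e T" m] m(1) by (simp add: wint_cmult mult.left_commute)
    also have "\<dots> \<le> K * (C' + \<epsilon>' * wint m e T)"
      by (intro mult_left_mono C' T K)
    also have "\<dots> = K * C' + (K * \<epsilon>') * wint m e T"
      by (simp add: algebra_simps)
    also have "\<dots> \<le> K * C' + (d * \<epsilon>) * wint m e T"
      using \<epsilon>'(2) I0 by (intro add_left_mono mult_right_mono)
    finally have 1: "m * wint (m - 1) E T \<le> K * C' + d * \<epsilon> * wint m e T" .
    have "d * e T \<le> E T"
      using c(2)[OF T] mult_right_mono[OF d(2) e_nonneg[of T]] by linarith
    then have "?w * (d * e T) \<le> ?w * E T"
      by (intro mult_left_mono) auto
    moreover have "d * (?w * (norm (z T))\<^sup>2) \<le> \<delta> / 2 * (?w * (norm (z T))\<^sup>2)"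
      using d(3) by (intro mult_right_mono) auto
    moreover have "d * ?I \<le> \<delta> * N / 2 * ?I"
      using d(4) I0 by (intro mult_right_mono)
    ultimately have "d * (?w * (e T + (norm (z T))\<^sup>2) + ?I) \<le> (C + K * C') + d * \<epsilon> * wint m e T"
      using C[OF T] 1 by (simp add: algebra_simps)
    then show ?thesis
      using d(1) by (simp add: field_simps)
  qed
  then show ?thesis by blast
qed

text \<open>The delicate part is the boundary value of g*U: being nonlocal, it needs a bound for the
  weighted \<open>U\<close> on all of \<open>{0..T}\<close>, which submultiplicativity of the weight
  then carries through the convolution.\<close>

lemma weighted_energy_system:
  assumes m: "0 \<le> m" "m \<le> lam0"
  shows "weighted_energy m e eh"
proof
  define P where "P = integral {0<..} (\<lambda>s. (s + 1) powr (m / 2) * \<bar>g s\<bar>)"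
  have gw: "(\<lambda>s. (s + 1) powr (m / 2) * g s) absolutely_integrable_on {0<..}"
    by (rule absolutely_integrable_lower_weight[OF g_int]) (use m in auto)
  have gi: "(\<lambda>s. (s + 1) powr (m / 2) * \<bar>g s\<bar>) integrable_on {0<..}"
  by (rule weighted_abs_integrable[OF gw])
  have P0: "0 \<le> P" unfolding P_def using gi by (rule integral_nonneg) auto
  show "0 \<le> m" by fact
  show "continuous_on {0..} e" "continuous_on {0..} eh" by (rule e_cont eh_cont)+
  show "0 \<le> e t" "0 \<le> eh t" for t by (rule e_nonneg eh_nonneg)+
  have c: "continuous_on {0..} (\<lambda>t. (norm (z t))\<^sup>2)" "continuous_on {0..} (\<lambda>t. (norm (gU t))\<^sup>2)" "continuous_on {0..} (\<lambda>t. (norm (U t))\<^sup>2)"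
    by (intro continuous_intros z_cont gU_cont cont)+
  have I0: "0 \<le> wint m e T" "0 \<le> wint m (\<lambda>t. (norm (z t))\<^sup>2) T" for T
    by (auto intro!: wint_nonneg c e_cont e_nonneg)
  have Ue: "(norm (U t))\<^sup>2 \<le> e t" for t by (simp add: e_def)
  have young: "wint m (\<lambda>t. (norm (gU t))\<^sup>2) T \<le> P\<^sup>2 * wint m e T" for T
  proof -
    have "wint m (\<lambda>t. (norm (gU t))\<^sup>2) T \<le> P\<^sup>2 * wint m (\<lambda>t. (norm (U t))\<^sup>2) T"
      unfolding wint_def P_def
      by (rule weighted_young[OF m(1) gw, of "\<lambda>t. norm (U t)" "\<lambda>t. norm (gU t)"])
        (auto intro!: continuous_on_norm gU_cont cont norm_convol_le[of g U, folded gU_def])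
    also have "\<dots> \<le> P\<^sup>2 * wint m e T"
      by (intro mult_left_mono wint_mono c e_cont Ue) auto
    finally show ?thesis .
  qed
  have split: "wint m eh T = wint m e T + wint m (\<lambda>t. (norm (z t))\<^sup>2) T + wint m (\<lambda>t. (norm (gU t))\<^sup>2) T" for T
    unfolding eh_def by (subst wint_add wint_add, (intro continuous_intros e_cont z_cont gU_cont)+)+ simp
  obtain C where C: "\<And>T. 0 \<le> T \<Longrightarrow> (T + 1) powr m * (e T + (norm (z T))\<^sup>2) + wint m (\<lambda>t. (norm (z t))\<^sup>2) T
    \<le> C + 1 * wint m e T"
    using energy_boundary[OF m zero_less_one] by blast
  have "wint m eh T \<le> C + (2 + P\<^sup>2) * wint m e T" if T: "0 \<le> T" for T
  proof -
    have "0 \<le> (T + 1) powr m * (e T + (norm (z T))\<^sup>2)"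
      using e_nonneg[of T] by (intro mult_nonneg_nonneg add_nonneg_nonneg) auto
    with C[OF T] young[of T] show ?thesis
      by (simp add: split distrib_right)
  qed
  then show "\<exists>K\<ge>0. \<exists>C. \<forall>T\<ge>0. wint m eh T \<le> C + K * wint m e T"
    by (intro exI[of _ "2 + P\<^sup>2"] conjI exI[of _ C]) auto
  fix \<epsilon> :: real assume \<epsilon>: "0 < \<epsilon>"
  define \<epsilon>' where "\<epsilon>' = \<epsilon> / (1 + P\<^sup>2)"
  have P1: "0 < 1 + P\<^sup>2" by (simp add: add_pos_nonneg)
  have \<epsilon>': "0 < \<epsilon>'" "(1 + P\<^sup>2) * \<epsilon>' = \<epsilon>"
    using \<epsilon> P1 by (auto simp: \<epsilon>'_def)
  obtain B where B: "\<And>T. 0 \<le> T \<Longrightarrow> (T + 1) powr m * (e T + (norm (z T))\<^sup>2) + wint m (\<lambda>t. (norm (z t))\<^sup>2) T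
    \<le> B + \<epsilon>' * wint m e T"
    using energy_boundary[OF m \<epsilon>'(1)] by blast
  have "(T + 1) powr m * eh T \<le> (1 + P\<^sup>2) * B + \<epsilon> * wint m e T" if T: "0 \<le> T" for T
  proof -
    \<comment> \<open>The integral of \<open>e\<close> grows with time, so the bound formed at the
      final time serves all earlier times as well.\<close>
    define R where "R = B + \<epsilon>' * wint m e T"
    have bd: "(t + 1) powr m * (e t + (norm (z t))\<^sup>2) \<le> R" if t: "t \<in> {0..T}" for t
    proof -
      have "wint m e t \<le> wint m e T"
        using t by (intro wint_mono_time e_cont e_nonneg) auto
      then have "\<epsilon>' * wint m e t \<le> \<epsilon>' * wint m e T"
        using \<epsilon>'(1) by (intro mult_left_mono) auto
      with B[of t] I0(2)[of t] t show ?thesis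
        unfolding R_def by simp
    qed
    have R0: "0 \<le> R"
    proof -
      have "0 \<le> (T + 1) powr m * (e T + (norm (z T))\<^sup>2)"
        using e_nonneg[of T] by (intro mult_nonneg_nonneg add_nonneg_nonneg) auto
      with bd[of T] T show ?thesis by auto
    qed
    let ?w = "\<lambda>t. (t + 1) powr (m / 2)"
    have UR: "?w t * norm (U t) \<le> sqrt R" if t: "t \<in> {0..T}" for t
    proof (rule real_le_rsqrt)
      have "(?w t * norm (U t))\<^sup>2 = (t + 1) powr m * (norm (U t))\<^sup>2"
        using t by (simp add: power_mult_distrib powr_power)
      also have "\<dots> \<le> (t + 1) powr m * (e t + (norm (z t))\<^sup>2)"
        using Ue[of t] by (intro mult_left_mono) (auto intro: add_increasing2)
      also have "\<dots> \<le> R" by (rule bd[OF t])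
      finally show "(?w t * norm (U t))\<^sup>2 \<le> R" .
    qed
    have "?w T * norm (gU T) \<le> ?w T * integral {0..T} (\<lambda>s. \<bar>g s\<bar> * norm (U (T - s)))"
      unfolding gU_def by (intro mult_left_mono norm_convol_le cont) auto
    also have "\<dots> = integral {0..T} (\<lambda>s. ?w T * (\<bar>g s\<bar> * norm (U (T - s))))"
      by simp
    also have "\<dots> \<le> integral {0..T} (\<lambda>s. ?w s * \<bar>g s\<bar> * sqrt R)"
    proof (rule integral_le)
      have "continuous_on {0..T} (\<lambda>s. U (T - s))"
        by (rule continuous_on_compose2[OF cont(5)]) (auto intro!: continuous_intros)
      then show "(\<lambda>s. ?w T * (\<bar>g s\<bar> * norm (U (T - s)))) integrable_on {0..T}"
        by (intro integrable_continuous_interval continuous_intros continuous_on_subset[OF g_cont]) auto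
      show "(\<lambda>s. ?w s * \<bar>g s\<bar> * sqrt R) integrable_on {0..T}"
        by (intro integrable_on_mult_left wint_integrable continuous_intros g_cont)
      show "?w T * (\<bar>g s\<bar> * norm (U (T - s))) \<le> ?w s * \<bar>g s\<bar> * sqrt R" if s: "s \<in> {0..T}" for s
      proof -
        have "?w T * (\<bar>g s\<bar> * norm (U (T - s))) \<le> (?w s * ?w (T - s)) * (\<bar>g s\<bar> * norm (U (T - s)))"
          using s m by (intro mult_right_mono weight_submultiplicative) auto
        also have "\<dots> = (?w s * \<bar>g s\<bar>) * (?w (T - s) * norm (U (T - s)))"
          by (simp add: mult_ac)
        also have "\<dots> \<le> (?w s * \<bar>g s\<bar>) * sqrt R"
          using s by (intro mult_left_mono UR) auto
        finally show ?thesis .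
      qed
    qed
    also have "\<dots> = integral {0..T} (\<lambda>s. ?w s * \<bar>g s\<bar>) * sqrt R"
      by simp
    also have "\<dots> \<le> P * sqrt R"
    proof (intro mult_right_mono)
      have "integral {0..T} (\<lambda>s. ?w s * \<bar>g s\<bar>) \<le> integral {0..} (\<lambda>s. ?w s * \<bar>g s\<bar>)"
        by (intro integral_subset_le wint_integrable continuous_intros g_cont integrable_halfline_closed(1)[OF gi]) auto
      then show "integral {0..T} (\<lambda>s. ?w s * \<bar>g s\<bar>) \<le> P"
        by (simp add: P_def integrable_halfline_closed(2)[OF gi])
    qed (use R0 in simp)
    finally have "(?w T * norm (gU T))\<^sup>2 \<le> (P * sqrt R)\<^sup>2"
      by (intro power_mono) auto
    moreover have "(?w T * norm (gU T))\<^sup>2 = (T + 1) powr m * (norm (gU T))\<^sup>2"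
      using T by (simp add: power_mult_distrib powr_power)
    moreover have "(P * sqrt R)\<^sup>2 = P\<^sup>2 * R"
      using R0 by (simp add: power_mult_distrib)
    ultimately have "(T + 1) powr m * (norm (gU T))\<^sup>2 \<le> P\<^sup>2 * R"
      by (simp only:)
    moreover have "(T + 1) powr m * (e T + (norm (z T))\<^sup>2) \<le> R"
      using bd[of T] T by simp
    ultimately have "(T + 1) powr m * eh T \<le> (1 + P\<^sup>2) * R"
      by (simp add: eh_def algebra_simps)
    also have "\<dots> = (1 + P\<^sup>2) * B + ((1 + P\<^sup>2) * \<epsilon>') * wint m e T"
      by (simp add: R_def algebra_simps)
    finally show ?thesis
      unfolding \<epsilon>'(2) .
  qed
  then show "\<exists>C. \<forall>T\<ge>0. (T + 1) powr m * eh T \<le> C + \<epsilon> * wint m e T"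
    by blast
qed

end

section \<open>Multiplier estimates\<close>

locale damped_weighted = damped_system +
  fixes m :: real
  assumes m_nonneg: "0 \<le> m" and m_le: "m \<le> lam0" and m_le': "m \<le> 2 * (lam0 - 1)"
begin

sublocale wt: weighted_energy m e eh
  by (rule weighted_energy_system[OF m_nonneg m_le])

lemma g_weight: "(\<lambda>s. (s + 1) powr (m / 2) * g s) absolutely_integrable_on {0<..}"
  and g'_weight: "(\<lambda>s. (s + 1) powr (m / 2) * g' s) absolutely_integrable_on {0<..}"
  and G_weight: "(\<lambda>s. (s + 1) powr (m / 2) * G s) absolutely_integrable_on {0<..}"
  using m_nonneg m_le m_le' by (intro absolutely_integrable_lower_weight[OF g_int]
      absolutely_integrable_lower_weight[OF g'_int] absolutely_integrable_lower_weight[OF G_int]; simp)+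

lemma bg_intro:
  fixes f :: "real \<Rightarrow> 'a"
  assumes "continuous_on {0..} f" "0 \<le> K" "\<And>t. 0 \<le> t \<Longrightarrow> (norm (f t))\<^sup>2 \<le> K * eh t"
  shows "wt.bg f"
  using assms unfolding wt.bg_def by blast

lemma bg_U: "wt.bg U" and bg_V: "wt.bg V" and bg_u1: "wt.bg u1" and bg_v1: "wt.bg v1" and bg_gU: "wt.bg gU"
  by (auto intro!: bg_intro[where K=1] cont gU_cont simp: eh_def e_def)

lemma bg_z: "wt.bg z"
  by (rule bg_intro[where K=1]) (use z_cont e_nonneg in \<open>auto simp: eh_def intro: add_increasing add_nonneg_nonneg\<close>)

lemma bg_u: "wt.bg u"
proof (rule bg_intro)
  show "(norm (u t))\<^sup>2 \<le> a1 * eh t" if "0 \<le> t" for t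
  proof -
    have "a1 * (norm (U t))\<^sup>2 \<le> a1 * eh t"
      using params by (intro mult_left_mono) (auto simp: eh_def e_def)
    with u_le[OF that] show ?thesis by linarith
  qed
qed (use params cont in auto)

lemma bg_v: "wt.bg v"
proof (rule bg_intro)
  show "(norm (v t))\<^sup>2 \<le> a2 * eh t" if "0 \<le> t" for t
  proof -
    have "a2 * (norm (V t))\<^sup>2 \<le> a2 * eh t"
      using params by (intro mult_left_mono) (auto simp: eh_def e_def)
    with v_le[OF that] show ?thesis by linarith
  qed
qed (use params cont in auto)

lemmas bgL = bl[THEN wt.bg_bounded_linear]
lemmas smL = bl[THEN wt.sm_bounded_linear]
lemmas hvdL = bl[THEN bounded_linear.has_vector_derivative]

lemma sm_z: "wt.sm z"
  unfolding wt.sm_def wt.small_def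
proof (intro conjI allI impI)
  show "continuous_on {0..} z" "continuous_on {0..} (\<lambda>t. (norm (z t))\<^sup>2)"
    by (intro continuous_intros z_cont)+
  fix \<epsilon> :: real assume "0 < \<epsilon>"
  then obtain C where C: "\<And>T. 0 \<le> T \<Longrightarrow> (T + 1) powr m * (e T + (norm (z T))\<^sup>2) + wint m (\<lambda>t. (norm (z t))\<^sup>2) T
    \<le> C + \<epsilon> * wint m e T"
    using energy_boundary[OF m_nonneg m_le] by blast
  have "0 \<le> (T + 1) powr m * (e T + (norm (z T))\<^sup>2)" for T
    using e_nonneg by (intro mult_nonneg_nonneg add_nonneg_nonneg) auto
  then have "wint m (\<lambda>t. (norm (z t))\<^sup>2) T \<le> C + \<epsilon> * wint m e T" if "0 \<le> T" for T
    using C[OF that] by (smt (verit))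
  then show "\<exists>C. \<forall>T\<ge>0. wint m (\<lambda>t. (norm (z t))\<^sup>2) T \<le> C + \<epsilon> * wint m e T"
    by blast
qed

text \<open>The multiplier \<open>Q1 z\<close>, the exponential average of \<open>u'\<close>.\<close>

lemma sm_u1: "wt.sm u1"
proof -
  have D: "wt.small (\<lambda>t. u1 t \<bullet> Q1 (W t - N *\<^sub>R z t) + u2 t \<bullet> Q1 (z t))"
    by (rule wt.small_inner_derivative(1)[OF bg_u1 bgL(1)[OF bg_z] u1_deriv hvdL(1)[OF z_deriv]])
      (auto intro!: cont cont_bl continuous_intros z_cont)
  have "wt.small (\<lambda>t. (u1 t \<bullet> Q1 (W t - N *\<^sub>R z t) + u2 t \<bullet> Q1 (z t)) + (N * (u1 t \<bullet> Q1 (z t))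
      + ((U t - gU t) \<bullet> z t + (\<alpha> * (u t \<bullet> Q1 (z t)) + C2 (V t) \<bullet> Q1 (z t)))))"
    using params by (intro wt.small_add wt.small_cmult D wt.small_inner(2) smL sm_z bg_u1 bg_u bgL bg_V
        wt.bg_diff bg_U bg_gU) auto
  then have "wt.small (\<lambda>t. (norm (u1 t))\<^sup>2)"
  proof (rule wt.small_mono)
    show "continuous_on {0..} (\<lambda>t. (norm (u1 t))\<^sup>2)" by (intro continuous_intros cont)
    fix t :: real assume t: "0 \<le> t"
    \<comment> \<open>Since \<open>z' = W - N z\<close> and \<open>Q1 W = u'\<close>, the derivative
      of the multiplier is \<open>u'\<close> up to a small term; this produces the square of
      \<open>u'\<close>.\<close>
    have "Q1 (W t - N *\<^sub>R z t) = u1 t - N *\<^sub>R Q1 (z t)"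
      using bl(1)[THEN bounded_linear.linear] by (simp add: linear_diff linear_scale u1_eq t)
    then have "(norm (u1 t))\<^sup>2 = u1 t \<bullet> Q1 (W t - N *\<^sub>R z t) + N * (u1 t \<bullet> Q1 (z t))"
      by (simp add: power2_norm_eq_inner inner_diff_right)
    moreover have "u2 t \<bullet> Q1 (z t) + (U t - gU t) \<bullet> z t + \<alpha> * (u t \<bullet> Q1 (z t)) + C2 (V t) \<bullet> Q1 (z t) = 0"
      using eq1[OF t, of "z t"] by (simp add: gU_def)
    ultimately show "(norm (u1 t))\<^sup>2 \<le> (u1 t \<bullet> Q1 (W t - N *\<^sub>R z t) + u2 t \<bullet> Q1 (z t)) + (N * (u1 t \<bullet> Q1 (z t))
      + ((U t - gU t) \<bullet> z t + (\<alpha> * (u t \<bullet> Q1 (z t)) + C2 (V t) \<bullet> Q1 (z t))))"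
      by linarith
  qed
  then show ?thesis
    by (simp add: wt.sm_def cont)
qed

text \<open>\<open>W - N z\<close> is the derivative of \<open>z\<close>, so
  \<open>convol_parts\<close> applies with \<open>z\<close> in the role of \<open>U\<close>, and
  only convolutions of the small function \<open>z\<close> with the weighted kernels
  \<open>g\<close> and \<open>G\<close> remain.\<close>

lemma sm_GW: "wt.sm (convol G W)"
proof -
  have Wz: "continuous_on {0..} (\<lambda>t. W t - N *\<^sub>R z t)"
    by (intro continuous_intros cont z_cont)
  have eq: "convol G W t = (k *\<^sub>R z t - convol g z t) + N *\<^sub>R convol G z t" if t: "0 \<le> t" for t
  proof -
    have "convol G (\<lambda>t. W t - N *\<^sub>R z t) t = G 0 *\<^sub>R z t - G t *\<^sub>R z 0 - convol g z t"
      by (rule convol_parts[OF g_cont G_deriv z_deriv Wz t])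
    moreover have "convol G (\<lambda>t. W t - N *\<^sub>R z t) t = convol G W t - N *\<^sub>R convol G z t"
    proof -
      have i: "(\<lambda>s. G (t - s) *\<^sub>R W s) integrable_on {0..t}" "(\<lambda>s. G (t - s) *\<^sub>R z s) integrable_on {0..t}"
        by (rule convol_integrable(1)[OF G_cont]; intro cont z_cont)+
      note j = integrable_linear[OF i(2) bounded_linear_scaleR_right[of N], unfolded o_def]
        integral_linear[OF i(2) bounded_linear_scaleR_right[of N], unfolded o_def]
      have "convol G (\<lambda>t. W t - N *\<^sub>R z t) t = integral {0..t} (\<lambda>s. G (t - s) *\<^sub>R W s - N *\<^sub>R G (t - s) *\<^sub>R z s)"
        unfolding convol_def by (rule integral_cong) (simp add: scaleR_diff_right mult.commute)
      also have "\<dots> = convol G W t - N *\<^sub>R convol G z t"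
        unfolding integral_diff[OF i(1) j(1)] j(2) by (simp add: convol_def)
      finally show ?thesis .
    qed
    ultimately show ?thesis
      by (simp add: z_0 G_0 algebra_simps)
  qed
  have "wt.sm (\<lambda>t. (k *\<^sub>R z t - convol g z t) + N *\<^sub>R convol G z t)"
    by (intro wt.sm_add wt.sm_diff wt.sm_scaleR sm_z wt.sm_convol g_weight G_weight cont)
  then show ?thesis
    by (rule wt.sm_mono[where c=1]) (auto simp: eq intro!: convol_continuous cont)
qed

text \<open>Of the two factors \<open>G\<close> in the weighted square, one takes the exponent
  \<open>lam0 - 1\<close>, for which it is integrable. The other takes
  \<open>m - (lam0 - 1)\<close>, which is at most \<open>lam0\<close>, so that \<open>Kg\<close>
  bounds it. The weighted integral is therefore bounded outright, without recourse to the
  energy.\<close>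

lemma sm_GU0: "wt.sm (\<lambda>t. G t *\<^sub>R U 0)"
proof -
  let ?f = "\<lambda>t. (t + 1) powr (m - (lam0 - 1)) * G t"
  define P where "P = Kg * integral {0<..} (\<lambda>t. (t + 1) powr (lam0 - 1) * \<bar>G t\<bar>)"
  have fc: "continuous_on {0..} ?f"
    by (intro continuous_on_mult continuous_on_weight G_cont)
  have fK: "\<bar>?f t\<bar> \<le> Kg" if "0 \<le> t" for t
  proof -
    have "(t + 1) powr (m - (lam0 - 1)) * \<bar>G t\<bar> \<le> (t + 1) powr lam0 * \<bar>G t\<bar>"
      using that m_le' lam0 by (intro mult_right_mono powr_mono) auto
    with G_le[OF that] show ?thesis by (simp add: abs_mult)
  qed
  have "wint m (\<lambda>t. (norm (G t *\<^sub>R U 0))\<^sup>2) T \<le> (norm (U 0))\<^sup>2 * P" for T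
  proof -
    have "wint (lam0 - 1) (\<lambda>t. G t * ?f t) T = wint m (\<lambda>t. (G t)\<^sup>2) T"
      unfolding wint_def
    proof (rule integral_cong)
      fix t
      have "(t + 1) powr (lam0 - 1) * (t + 1) powr (m - (lam0 - 1)) = (t + 1) powr m"
        by (simp flip: powr_add)
      then show "(t + 1) powr (lam0 - 1) * (G t * ?f t) = (t + 1) powr m * (G t)\<^sup>2"
        by (metis (no_types, opaque_lifting) mult.assoc mult.commute power2_eq_square)
    qed
    moreover have "0 \<le> Kg" using fK[of 0] by simp
    then have "\<bar>wint (lam0 - 1) (\<lambda>t. G t * ?f t) T\<bar> \<le> P"
      unfolding P_def by (intro abs_wint_le[OF G_cont fc order_refl G_int fK]) auto
    ultimately have "wint m (\<lambda>t. (G t)\<^sup>2) T \<le> P" by simp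
    then have "(norm (U 0))\<^sup>2 * wint m (\<lambda>t. (G t)\<^sup>2) T \<le> (norm (U 0))\<^sup>2 * P"
      by (intro mult_left_mono) auto
    then show ?thesis
      by (simp add: power_mult_distrib mult.commute flip: wint_cmult)
  qed
  note le = this
  have c: "continuous_on {0..} (\<lambda>t. G t *\<^sub>R U 0)"
    by (intro continuous_intros G_cont)
  show ?thesis
    unfolding wt.sm_def wt.small_def
  proof (intro conjI c continuous_on_power continuous_on_norm allI impI)
    fix \<epsilon> :: real assume "0 < \<epsilon>"
    then have "0 \<le> \<epsilon> * wint m e T" for T
      using wt.e_wint_nonneg by simp
    then show "\<exists>C. \<forall>T\<ge>0. wint m (\<lambda>t. (norm (G t *\<^sub>R U 0))\<^sup>2) T \<le> C + \<epsilon> * wint m e T"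
      using le by (intro exI[of _ "(norm (U 0))\<^sup>2 * P"]) (metis add_increasing2)
  qed
qed

text \<open>The multiplier pair \<open>u\<close>, \<open>- A\<^sub>2\<^sup>-\<^sup>1 B\<^sub>1 u\<close>: the second component turns the coupling term
  \<open>B\<^sub>2 v \<bullet> u\<close> into a quantity controlled by \<open>u\<close> and \<open>u'\<close> alone.\<close>

lemma sm_U: "wt.sm U"
proof -
  let ?R = "\<lambda>x. Q2 (Q2 (C1 x))"
  have RL: "bounded_linear ?R"
    by (rule bounded_linear_compose[OF bl(2) bounded_linear_compose[OF bl(2,3)]])
  \<comment> \<open>Duality: by \<open>cross\<close>, \<open>Q2 (C1 x)\<close> is the adjoint of
    \<open>C2\<close> applied to \<open>Q1 x\<close>. Hence \<open>norm u\<close> appears with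
    exactly the constant \<beta>1 that the gap condition admits, and \<open>W\<close> enters only
    through \<open>u'\<close>.\<close>
  have QC: "norm (Q2 (C1 x)) \<le> \<beta>1 * norm (Q1 x)" for x
  proof -
    have "(norm (Q2 (C1 x)))\<^sup>2 = Q1 x \<bullet> C2 (Q2 (C1 x))"
      using cross[of x "Q2 (C1 x)"] Q2_sym[of "C1 x" "Q2 (C1 x)"] by (simp add: power2_norm_eq_inner)
    also have "\<dots> \<le> norm (Q1 x) * (\<beta>1 * norm (Q2 (C1 x)))"
      using norm_cauchy_schwarz[of "Q1 x" "C2 (Q2 (C1 x))"] mult_left_mono[OF C2_le[of "Q2 (C1 x)"] norm_ge_zero[of "Q1 x"]]
      by linarith
    finally have "norm (Q2 (C1 x)) * norm (Q2 (C1 x)) \<le> (\<beta>1 * norm (Q1 x)) * norm (Q2 (C1 x))"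
      by (simp add: power2_eq_square mult_ac)
    then show ?thesis
      using params by (cases "norm (Q2 (C1 x)) = 0") auto
  qed
  obtain KQ where KQ: "0 \<le> KQ" "\<And>x. norm (Q2 x) \<le> norm x * KQ"
    using bounded_linear.nonneg_bounded[OF bl(2)] by blast
  have smRW: "wt.sm (\<lambda>t. ?R (W t))"
  proof (rule wt.sm_mono[OF sm_u1])
    show "continuous_on {0..} (\<lambda>t. ?R (W t))" by (intro cont_bl cont)
    show "0 \<le> \<beta>1 * KQ" using params KQ by simp
    show "norm (?R (W t)) \<le> \<beta>1 * KQ * norm (u1 t)" if "0 \<le> t" for t
    proof -
      have "norm (?R (W t)) \<le> norm (Q2 (C1 (W t))) * KQ" by (rule KQ)
      also have "\<dots> \<le> (\<beta>1 * norm (Q1 (W t))) * KQ"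
        by (intro mult_right_mono QC KQ)
      finally show ?thesis by (simp add: u1_eq that mult_ac)
    qed
  qed
  have D1: "wt.small (\<lambda>t. - (u1 t \<bullet> u1 t + u2 t \<bullet> u t))"
    by (rule wt.small_inner_derivative(2)[OF bg_u1 bg_u u1_deriv u_deriv]) (auto intro: cont)
  have D2: "wt.small (\<lambda>t. v1 t \<bullet> ?R (W t) + v2 t \<bullet> ?R (U t))"
    by (rule wt.small_inner_derivative(1)[OF bg_v1 wt.bg_bounded_linear[OF RL bg_U] v1_deriv
          bounded_linear.has_vector_derivative[OF RL U_deriv]]) (auto intro!: cont cont_bl)
  obtain \<kappa> where \<kappa>: "0 < \<kappa>" and gc: "\<And>x. \<kappa> * (norm x)\<^sup>2 \<le> (1 - k) * (norm x)\<^sup>2 - (\<beta>1\<^sup>2 - \<alpha>) * (norm (Q1 x))\<^sup>2"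
    using gap_coercive by blast
  have "wt.small (\<lambda>t. 1/\<kappa> * (- (u1 t \<bullet> u1 t + u2 t \<bullet> u t) + ((v1 t \<bullet> ?R (W t) + v2 t \<bullet> ?R (U t)) + ((norm (u1 t))\<^sup>2
      + (- ((G t *\<^sub>R U 0) \<bullet> U t) + (- (convol G W t \<bullet> U t) + - (v1 t \<bullet> ?R (W t))))))))"
    using \<kappa> sm_u1 by (intro wt.small_cmult wt.small_add D1 D2 wt.small_inner(3)[OF sm_GU0 bg_U] wt.small_inner(3)[OF sm_GW bg_U]
        wt.small_inner(4)[OF smRW bg_v1]) (auto simp: wt.sm_def)
  then have "wt.small (\<lambda>t. (norm (U t))\<^sup>2)"
  proof (rule wt.small_mono)
    show "continuous_on {0..} (\<lambda>t. (norm (U t))\<^sup>2)" by (intro continuous_intros cont)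
    fix t :: real assume t: "0 \<le> t"
    have 1: "u2 t \<bullet> u t + ((norm (U t))\<^sup>2 - gU t \<bullet> U t) + \<alpha> * (norm (u t))\<^sup>2 + C2 (V t) \<bullet> u t = 0"
      using eq1[OF t, of "U t"] by (simp add: gU_def u_eq t power2_norm_eq_inner inner_diff_left)
    have 2: "convol G W t \<bullet> U t = k * (norm (U t))\<^sup>2 - (G t *\<^sub>R U 0) \<bullet> U t - gU t \<bullet> U t"
      by (simp add: GW_eq[OF t] inner_diff_left power2_norm_eq_inner)
    have 3: "v2 t \<bullet> ?R (U t) + V t \<bullet> Q2 (C1 (U t)) + C1 (U t) \<bullet> ?R (U t) = 0"
      by (rule eq2[OF t])
    \<comment> \<open>The coupling in the first equation equals the middle term of the second one
      and is eliminated; the price is the term in 5, which 6 and 7 cover.\<close>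
    have 4: "V t \<bullet> Q2 (C1 (U t)) = C2 (V t) \<bullet> u t"
      using cross[of "U t" "V t"] Q2_sym[of "V t" "C1 (U t)"] by (simp add: u_eq t inner_commute)
    have 5: "C1 (U t) \<bullet> ?R (U t) = (norm (Q2 (C1 (U t))))\<^sup>2"
      using Q2_sym[of "C1 (U t)" "Q2 (C1 (U t))"] by (simp add: power2_norm_eq_inner)
    have 6: "(norm (Q2 (C1 (U t))))\<^sup>2 \<le> \<beta>1\<^sup>2 * (norm (u t))\<^sup>2"
      using power_mono[OF QC[of "U t"], of 2] by (simp add: power_mult_distrib u_eq t)
    have 7: "\<kappa> * (norm (U t))\<^sup>2 \<le> (1 - k) * (norm (U t))\<^sup>2 - (\<beta>1\<^sup>2 - \<alpha>) * (norm (u t))\<^sup>2"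
      using gc[of "U t"] by (simp add: u_eq t)
    have "\<kappa> * (norm (U t))\<^sup>2 \<le> - (u1 t \<bullet> u1 t + u2 t \<bullet> u t) + ((v1 t \<bullet> ?R (W t) + v2 t \<bullet> ?R (U t)) + ((norm (u1 t))\<^sup>2
      + (- ((G t *\<^sub>R U 0) \<bullet> U t) + (- (convol G W t \<bullet> U t) + - (v1 t \<bullet> ?R (W t))))))"
    proof -
      have "u1 t \<bullet> u1 t = (norm (u1 t))\<^sup>2" by (simp add: power2_norm_eq_inner)
      moreover have "(1 - k) * (norm (U t))\<^sup>2 - (\<beta>1\<^sup>2 - \<alpha>) * (norm (u t))\<^sup>2
          = (norm (U t))\<^sup>2 - k * (norm (U t))\<^sup>2 - \<beta>1\<^sup>2 * (norm (u t))\<^sup>2 + \<alpha> * (norm (u t))\<^sup>2"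
        by (simp add: algebra_simps)
      ultimately show ?thesis
        using 1 2 3 4 5 6 7 by linarith
    qed
    then show "(norm (U t))\<^sup>2 \<le> 1/\<kappa> * (- (u1 t \<bullet> u1 t + u2 t \<bullet> u t) + ((v1 t \<bullet> ?R (W t) + v2 t \<bullet> ?R (U t)) + ((norm (u1 t))\<^sup>2
      + (- ((G t *\<^sub>R U 0) \<bullet> U t) + (- (convol G W t \<bullet> U t) + - (v1 t \<bullet> ?R (W t)))))))"
      using \<kappa> by (simp add: pos_le_divide_eq mult.commute)
  qed
  then show ?thesis
    by (simp add: wt.sm_def cont)
qed

lemma sm_u: "wt.sm u"
  by (rule wt.sm_mono[OF smL(1)[OF sm_U], of _ 1]) (auto simp: u_eq intro: cont)

section \<open>The derivative of the memory term, and the estimates for the second component\<close>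

definition X :: "real \<Rightarrow> 'a" where "X t = convol g W t + g t *\<^sub>R U 0"

lemma X_cont: "continuous_on {0..} X"
  unfolding X_def by (intro continuous_intros convol_continuous cont)

lemma gU_deriv: "0 \<le> t \<Longrightarrow> (gU has_vector_derivative X t) (at t within {0..})"
  unfolding gU_def X_def by (rule convol_has_vector_derivative[OF g_cont U_deriv]) (auto intro: cont)

lemma sm_X: "wt.sm X"
proof -
  \<comment> \<open>The excess over the local term \<open>\<bar>g 0\<bar> * norm (U t)\<close> is
    dominated by a pure convolution, as \<open>weighted_young\<close> requires.\<close>
  define Y where "Y t = max 0 (norm (X t) - \<bar>g 0\<bar> * norm (U t))" for t
  have Yc: "continuous_on {0..} Y"
    unfolding Y_def by (intro continuous_intros X_cont cont)
  define P where "P = integral {0<..} (\<lambda>s. (s + 1) powr (m / 2) * \<bar>g' s\<bar>)"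
  have g'1: "g' absolutely_integrable_on {0<..}"
    by (rule absolutely_integrable_drop_weight[OF g'_int]) (use lam0 in simp)
  have Yle: "\<bar>Y t\<bar> \<le> integral {0..t} (\<lambda>s. \<bar>g' s\<bar> * norm (U (t - s)))" if t: "0 \<le> t" for t
  proof -
    have "0 \<le> integral {0..t} (\<lambda>s. \<bar>g' s\<bar> * norm (U (t - s)))"
      by (intro integral_nonneg weight_integrable_product(1)[OF g'1 _ t]) (auto intro!: continuous_on_norm cont)
    moreover have "norm (X t) \<le> \<bar>g 0\<bar> * norm (U t) + integral {0..t} (\<lambda>s. \<bar>g' s\<bar> * norm (U (t - s)))"
      unfolding X_def by (rule norm_convol_derivative_le[OF g_ac g_cont g'1 U_deriv cont2(3) t])
    ultimately show ?thesis
      by (simp add: Y_def)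
  qed
  have "wint m (\<lambda>t. (Y t)\<^sup>2) T \<le> wint m (\<lambda>t. P\<^sup>2 * (norm (U t))\<^sup>2) T" for T
    unfolding wint_cmult unfolding wint_def P_def
    by (rule weighted_young[OF m_nonneg g'_weight, of "\<lambda>t. norm (U t)" Y]) (auto intro!: continuous_on_norm cont Yc Yle)
  moreover have sU: "wt.small (\<lambda>t. c * (norm (U t))\<^sup>2)" if "0 \<le> c" for c
    using sm_U that by (intro wt.small_cmult) (auto simp: wt.sm_def)
  from sU[of "P\<^sup>2"] have "wt.small (\<lambda>t. P\<^sup>2 * (norm (U t))\<^sup>2)" by simp
  ultimately have "wt.small (\<lambda>t. (Y t)\<^sup>2)"
    unfolding wt.small_def by (intro conjI continuous_on_power Yc) (meson order_trans)
  then have "wt.small (\<lambda>t. 2 * \<bar>g 0\<bar>\<^sup>2 * (norm (U t))\<^sup>2 + 2 * (Y t)\<^sup>2)"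
    by (intro wt.small_add sU wt.small_cmult) auto
  then have "wt.small (\<lambda>t. (norm (X t))\<^sup>2)"
  proof (rule wt.small_mono)
    show "continuous_on {0..} (\<lambda>t. (norm (X t))\<^sup>2)" by (intro continuous_intros X_cont)
    fix t
    have "(norm (X t))\<^sup>2 \<le> (\<bar>g 0\<bar> * norm (U t) + Y t)\<^sup>2"
      by (intro power_mono) (auto simp: Y_def)
    also have "\<dots> \<le> 2 * (\<bar>g 0\<bar> * norm (U t))\<^sup>2 + 2 * (Y t)\<^sup>2"
      using sum_squares_bound[of "\<bar>g 0\<bar> * norm (U t)" "Y t"] by (simp add: power2_sum)
    finally show "(norm (X t))\<^sup>2 \<le> 2 * \<bar>g 0\<bar>\<^sup>2 * (norm (U t))\<^sup>2 + 2 * (Y t)\<^sup>2"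
      by (simp add: power_mult_distrib)
  qed
  then show ?thesis
    by (simp add: wt.sm_def X_cont)
qed

text \<open>The root of \<open>A1\<close> applied to u - g*u; it is small together with
  \<open>U\<close>, and its derivative is \<open>W - X\<close>.\<close>

definition Ut :: "real \<Rightarrow> 'a" where "Ut t = U t - gU t"

lemma bg_Ut: "wt.bg Ut"
  unfolding Ut_def by (intro wt.bg_diff bg_U bg_gU)

lemma sm_Ut: "wt.sm Ut"
  unfolding Ut_def gU_def by (intro wt.sm_diff sm_U wt.sm_convol g_weight g_cont)

lemma Ut_deriv: "0 \<le> t \<Longrightarrow> (Ut has_vector_derivative W t - X t) (at t within {0..})"
  unfolding Ut_def by (intro has_vector_derivative_diff U_deriv gU_deriv)

text \<open>The product \<open>p1 * p2\<close> in the commutator bound decides the argument. The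
  square of \<open>p1\<close> is bounded by the small quantity \<open>?P1\<close>, because it
  belongs to \<open>Ut\<close>. That of \<open>p2\<close> is bounded only up to the big quantity
  \<open>?B\<close>, as it belongs to \<open>v\<close>. Young's inequality with parameter \<eta>
  puts the small factor on \<open>?B\<close>, and \<open>small_limit\<close> concludes. Lower
  boundedness of \<open>C2\<close> finally recovers \<open>V\<close>.\<close>

lemma sm_V: "wt.sm V"
proof -
  let ?B = "\<lambda>t. D2 * (norm (v1 t))\<^sup>2 + ((norm (C1 (U t)))\<^sup>2 + ((norm (L2 (C2 (V t))))\<^sup>2 + D2 * (norm (C2 (V t)))\<^sup>2))"
  have bigB: "wt.big (\<lambda>t. D1 / 2 * ?B t)"
    using params by (intro wt.big_cmult wt.big_add wt.bg_big bgL bg_U bg_V bg_v1) auto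
  note cW = continuous_on_diff[OF cont2(3) X_cont]
  let ?T1 = "\<lambda>t. C1 (Ut t) \<bullet> v2 t + C1 (W t - X t) \<bullet> v1 t"
  let ?T2 = "\<lambda>t. - (u1 t \<bullet> C2 (V1 t) + u2 t \<bullet> C2 (V t))"
  let ?T3 = "\<lambda>t. C1 (X t) \<bullet> v1 t"
  let ?T4 = "\<lambda>t. C1 (Ut t) \<bullet> C1 (U t)"
  let ?T5 = "\<lambda>t. norm (C1 (Ut t)) * norm (C2 (V t))"
  let ?T6 = "\<lambda>t. - (u t \<bullet> C2 (V t))"
  let ?P1 = "\<lambda>t. - (u1 t \<bullet> L1 (C1 (W t - X t)) + u2 t \<bullet> L1 (C1 (Ut t))) + (D2 * (norm (u1 t))\<^sup>2
      + (- (u1 t \<bullet> L1 (C1 (X t))) + (- ((\<alpha> *\<^sub>R u t + C2 (V t)) \<bullet> L1 (C1 (Ut t))) + D2 * (norm (C1 (Ut t)))\<^sup>2)))"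
  let ?P2 = "\<lambda>t. - (v1 t \<bullet> L2 (C2 (V1 t)) + v2 t \<bullet> L2 (C2 (V t)))"
  have s1: "wt.small ?T1"
    by (rule wt.small_inner_derivative(1)[OF bgL(3)[OF bg_Ut] bg_v1 hvdL(3)[OF Ut_deriv] v1_deriv])
      (auto intro!: cont cont_bl cW)
  have s2: "wt.small ?T2"
    by (rule wt.small_inner_derivative(2)[OF bg_u1 bgL(4)[OF bg_V] u1_deriv hvdL(4)[OF V_deriv]])
      (auto intro!: cont cont_bl)
  have s3: "wt.small ?T3" by (intro wt.small_inner(1) smL sm_X bg_v1)
  have s4: "wt.small ?T4" by (intro wt.small_inner(1) smL sm_Ut bgL bg_U)
  have s5: "wt.small ?T5" by (intro wt.small_inner(5) smL sm_Ut bgL bg_V)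
  have s6: "wt.small ?T6" by (intro wt.small_inner(3) sm_u bgL bg_V)
  have p1: "wt.small ?P1"
  proof (intro wt.small_add)
    show "wt.small (\<lambda>t. - (u1 t \<bullet> L1 (C1 (W t - X t)) + u2 t \<bullet> L1 (C1 (Ut t))))"
      by (rule wt.small_inner_derivative(2)[OF bg_u1 bgL(5)[OF bgL(3)[OF bg_Ut]] u1_deriv hvdL(5)[OF hvdL(3)[OF Ut_deriv]]])
        (auto intro!: cont cont_bl cW)
    show "wt.small (\<lambda>t. D2 * (norm (u1 t))\<^sup>2)"
      using params sm_u1 by (intro wt.small_cmult) (auto simp: wt.sm_def)
    show "wt.small (\<lambda>t. - (u1 t \<bullet> L1 (C1 (X t))))"
      by (intro wt.small_inner(4) smL sm_X bg_u1)
    show "wt.small (\<lambda>t. - ((\<alpha> *\<^sub>R u t + C2 (V t)) \<bullet> L1 (C1 (Ut t))))"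
      by (intro wt.small_inner(4) smL sm_Ut wt.bg_add wt.bg_scaleR bg_u bgL bg_V)
    show "wt.small (\<lambda>t. D2 * (norm (C1 (Ut t)))\<^sup>2)"
      using params smL(3)[OF sm_Ut] by (intro wt.small_cmult) (auto simp: wt.sm_def)
  qed
  have p2: "wt.small ?P2"
    by (rule wt.small_inner_derivative(2)[OF bg_v1 bgL(6)[OF bgL(4)[OF bg_V]] v1_deriv hvdL(6)[OF hvdL(4)[OF V_deriv]]])
      (auto intro!: cont cont_bl)
  have "wt.small (\<lambda>t. (norm (C2 (V t)))\<^sup>2)"
  proof (rule wt.small_limit[OF bigB])
    show "continuous_on {0..} (\<lambda>t. (norm (C2 (V t)))\<^sup>2)"
      by (intro continuous_intros cont_bl cont)
    fix \<eta> :: real assume \<eta>: "0 < \<eta>"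
    let ?S = "\<lambda>t. ?T1 t + (?T2 t + (?T3 t + (?T4 t + (D1 * ?T5 t + (\<alpha> * ?T6 t + (D1 / (2 * \<eta>) * ?P1 t + D1 * \<eta> / 2 * ?P2 t))))))"
    have "wt.small ?S"
      using params \<eta> by (intro wt.small_add s1 s2 s3 s4 s5 s6 p1 p2 wt.small_cmult) auto
    moreover have "(norm (C2 (V t)))\<^sup>2 \<le> ?S t + \<eta> * (D1 / 2 * ?B t)" if t: "0 \<le> t" for t
    proof -
      obtain r1 r2 where r: "0 \<le> r1" "0 \<le> r2"
        and c1: "\<bar>(u2 t + \<alpha> *\<^sub>R u t + C2 (V t)) \<bullet> C2 (V t) - C1 (Ut t) \<bullet> (v2 t + C1 (U t))\<bar>
          \<le> D1 * (norm (C1 (Ut t)) * norm (C2 (V t)) + r1 * r2)"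
        and c2: "r1\<^sup>2 \<le> - ((u2 t + \<alpha> *\<^sub>R u t + C2 (V t)) \<bullet> L1 (C1 (Ut t))) + D2 * (norm (C1 (Ut t)))\<^sup>2"
        and c3: "r2\<^sup>2 \<le> - ((v2 t + C1 (U t)) \<bullet> L2 (C2 (V t))) + D2 * (norm (C2 (V t)))\<^sup>2"
        using commutator[OF t] unfolding Ut_def gU_def by blast
      \<comment> \<open>By \<open>cross\<close>, the contributions of \<open>W\<close> to
        \<open>?T1\<close> and of \<open>V1\<close> to \<open>?T2\<close> cancel; the correction
        \<open>X\<close> is returned by \<open>?T3\<close>.\<close>
      have x1: "C1 (W t - X t) \<bullet> v1 t = u1 t \<bullet> C2 (V1 t) - C1 (X t) \<bullet> v1 t"
        using cross[of "W t" "V1 t"] by (simp add: linear_diff[OF bl(3)[THEN bounded_linear.linear]] inner_diff_left u1_eq v1_eq t)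
      have x2: "u1 t \<bullet> L1 (C1 (W t - X t)) = u1 t \<bullet> L1 (C1 (W t)) - u1 t \<bullet> L1 (C1 (X t))"
        by (simp add: linear_diff[OF bl(3)[THEN bounded_linear.linear]] linear_diff[OF bl(5)[THEN bounded_linear.linear]] inner_diff_right)
      \<comment> \<open>No norm bound for \<open>W\<close> is at hand; the one-sided form bound on
        \<open>L1\<close> trades it for the square of \<open>u'\<close>, which is already known to
        be small.\<close>
      have x3: "u1 t \<bullet> L1 (C1 (W t)) \<le> D2 * (norm (u1 t))\<^sup>2"
        using L1_le[of "W t"] by (simp add: u1_eq t)
      have x4: "v1 t \<bullet> L2 (C2 (V1 t)) \<le> D2 * (norm (v1 t))\<^sup>2"
        using L2_le[of "V1 t"] by (simp add: v1_eq t)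
      have r1: "r1\<^sup>2 \<le> ?P1 t"
        using c2 x2 x3 by (simp add: inner_add_left)
      have x5: "- (C1 (U t) \<bullet> L2 (C2 (V t))) \<le> (norm (C1 (U t)))\<^sup>2 + (norm (L2 (C2 (V t))))\<^sup>2"
        using Cauchy_Schwarz_ineq2[of "C1 (U t)" "L2 (C2 (V t))"] sum_squares_bound[of "norm (C1 (U t))" "norm (L2 (C2 (V t)))"]
          mult_nonneg_nonneg[OF norm_ge_zero[of "C1 (U t)"] norm_ge_zero[of "L2 (C2 (V t))"]] by linarith
      have r2: "r2\<^sup>2 \<le> ?P2 t + ?B t"
        using c3 x4 x5 by (simp add: inner_add_left)
      have "r1 * r2 \<le> 1 / (2 * \<eta>) * r1\<^sup>2 + \<eta> / 2 * r2\<^sup>2"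
      proof -
        have "0 \<le> (r1 - \<eta> * r2)\<^sup>2 / (2 * \<eta>)" using \<eta> by simp
        also have "\<dots> = 1 / (2 * \<eta>) * r1\<^sup>2 + \<eta> / 2 * r2\<^sup>2 - r1 * r2"
          using \<eta> by (simp add: power2_eq_square field_simps)
        finally show ?thesis by simp
      qed
      also have "\<dots> \<le> 1 / (2 * \<eta>) * ?P1 t + \<eta> / 2 * (?P2 t + ?B t)"
        using \<eta> by (intro add_mono mult_left_mono r1 r2) auto
      finally have "D1 * (r1 * r2) \<le> D1 * (1 / (2 * \<eta>) * ?P1 t + \<eta> / 2 * (?P2 t + ?B t))"
        using params by (intro mult_left_mono) auto
      also have "\<dots> = D1 / (2 * \<eta>) * ?P1 t + D1 * \<eta> / 2 * ?P2 t + \<eta> * (D1 / 2 * ?B t)"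
        by (simp add: algebra_simps)
      finally have y: "D1 * (r1 * r2) \<le> D1 / (2 * \<eta>) * ?P1 t + D1 * \<eta> / 2 * ?P2 t + \<eta> * (D1 / 2 * ?B t)" .
      have "(u2 t + \<alpha> *\<^sub>R u t + C2 (V t)) \<bullet> C2 (V t) \<le> C1 (Ut t) \<bullet> (v2 t + C1 (U t)) + D1 * ?T5 t + D1 * (r1 * r2)"
        using c1 by (simp add: distrib_left)
      then have "(norm (C2 (V t)))\<^sup>2 \<le> C1 (Ut t) \<bullet> v2 t + C1 (Ut t) \<bullet> C1 (U t) + D1 * ?T5 t + D1 * (r1 * r2)
          - u2 t \<bullet> C2 (V t) + \<alpha> * ?T6 t"
        by (simp add: inner_add_left inner_add_right power2_norm_eq_inner)
      with y x1 show ?thesis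
        by linarith
    qed
    ultimately show "\<exists>k. wt.small k \<and> (\<forall>t\<ge>0. (norm (C2 (V t)))\<^sup>2 \<le> k t + \<eta> * (D1 / 2 * ?B t))"
      by blast
  qed
  then have "wt.sm (\<lambda>t. C2 (V t))"
    by (auto simp: wt.sm_def intro!: cont_bl cont)
  then show ?thesis
  proof (rule wt.sm_mono)
    show "norm (V t) \<le> 1 / \<beta> * norm (C2 (V t))" for t
      using C2_ge[of "V t"] params by (simp add: field_simps)
  qed (use params cont in auto)
qed

lemma sm_v1: "wt.sm v1"
proof -
  have "wt.small (\<lambda>t. (v1 t \<bullet> v1 t + v2 t \<bullet> v t) + ((norm (V t))\<^sup>2 + C1 (U t) \<bullet> v t))"
  proof (rule wt.small_add[OF _ wt.small_add])
    show "wt.small (\<lambda>t. C1 (U t) \<bullet> v t)"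
      by (intro wt.small_inner(1) smL sm_U bg_v)
    show "wt.small (\<lambda>t. v1 t \<bullet> v1 t + v2 t \<bullet> v t)"
      by (rule wt.small_inner_derivative(1)[OF bg_v1 bg_v v1_deriv v_deriv]) (auto intro: cont)
    show "wt.small (\<lambda>t. (norm (V t))\<^sup>2)"
      using sm_V by (simp add: wt.sm_def)
  qed
  then have "wt.small (\<lambda>t. (norm (v1 t))\<^sup>2)"
  proof (rule wt.small_mono)
    show "continuous_on {0..} (\<lambda>t. (norm (v1 t))\<^sup>2)" by (intro continuous_intros cont)
    fix t :: real assume t: "0 \<le> t"
    show "(norm (v1 t))\<^sup>2 \<le> (v1 t \<bullet> v1 t + v2 t \<bullet> v t) + ((norm (V t))\<^sup>2 + C1 (U t) \<bullet> v t)"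
      using eq2[OF t, of "V t"] by (simp add: v_eq t power2_norm_eq_inner)
  qed
  then show ?thesis
    by (simp add: wt.sm_def cont)
qed

lemma wint_energy_bounded: "\<exists>C. \<forall>T\<ge>0. wint m e T \<le> C"
proof (rule wt.small_energy_bounded)
  have "wt.small (\<lambda>t. (norm (u1 t))\<^sup>2 + (norm (U t))\<^sup>2 + (norm (v1 t))\<^sup>2 + (norm (V t))\<^sup>2)"
    using sm_u1 sm_U sm_v1 sm_V by (intro wt.small_add) (auto simp: wt.sm_def)
  then show "wt.small e"
    by (rule wt.small_mono) (rule e_cont, simp add: e_def)
qed

end

context damped_system
begin

lemma decay:
  shows "\<exists>C. \<forall>t\<ge>0. E t \<le> C * (t + 1) powr (- lam0)"
    and "\<exists>C. \<forall>T\<ge>0. wint (min lam0 (2 * (lam0 - 1))) E T \<le> C"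
    and "\<And>t. 0 \<le> t \<Longrightarrow> 0 \<le> E t"
proof -
  define \<mu> where "\<mu> = min lam0 (2 * (lam0 - 1))"
  interpret damped_weighted where m = \<mu>
    by unfold_locales (use lam0 in \<open>auto simp: \<mu>_def\<close>)
  obtain C where C: "\<And>T. 0 \<le> T \<Longrightarrow> wint \<mu> e T \<le> C"
    using wint_energy_bounded by blast
  obtain K where K: "0 \<le> K" "\<And>t. 0 \<le> t \<Longrightarrow> E t \<le> K * e t"
    using E_le_e by blast
  obtain c where c: "0 < c" "\<And>t. 0 \<le> t \<Longrightarrow> c * e t \<le> E t"
    using E_coercive by blast
  show E0: "0 \<le> E t" if "0 \<le> t" for t
  proof -
    have "0 \<le> c * e t" using c(1) e_nonneg[of t] by simp
    with c(2)[OF that] show ?thesis by linarith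
  qed
  have KC: "wint \<mu> E T \<le> K * C" if T: "0 \<le> T" for T
  proof -
    have "wint \<mu> E T \<le> wint \<mu> (\<lambda>t. K * e t) T"
      using K by (intro wint_mono continuous_intros E_cont e_cont) auto
    also have "\<dots> \<le> K * C"
      unfolding wint_cmult using C[OF T] K(1) by (rule mult_left_mono)
    finally show ?thesis .
  qed
  then show "\<exists>C. \<forall>T\<ge>0. wint (min lam0 (2 * (lam0 - 1))) E T \<le> C"
    unfolding \<mu>_def by blast
  obtain B where B: "\<And>T. 0 \<le> T \<Longrightarrow> (T + 1) powr lam0 * E T + \<delta> / 2 * ((T + 1) powr lam0 * (norm (z T))\<^sup>2)
    + \<delta> * N / 2 * wint lam0 (\<lambda>t. (norm (z t))\<^sup>2) T \<le> B + lam0 * wint (lam0 - 1) E T"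
    using weighted_energy_estimate[of lam0] lam0 by auto
  have "E T \<le> (B + lam0 * (K * C)) * (T + 1) powr (- lam0)" if T: "0 \<le> T" for T
  proof -
    \<comment> \<open>Here \<open>lam0 \<ge> 1\<close> enters: it makes \<open>lam0 - 1\<close> at
      most \<open>2 * (lam0 - 1)\<close>.\<close>
    have "wint (lam0 - 1) E T \<le> wint \<mu> E T"
      using lam0 by (intro wint_mono_weight E_cont E0) (auto simp: \<mu>_def)
    with KC[OF T] have "lam0 * wint (lam0 - 1) E T \<le> lam0 * (K * C)"
      using lam0 by (intro mult_left_mono) auto
    moreover have "0 \<le> \<delta> / 2 * ((T + 1) powr lam0 * (norm (z T))\<^sup>2)"
      using params by simp
    moreover have "0 \<le> \<delta> * N / 2 * wint lam0 (\<lambda>t. (norm (z t))\<^sup>2) T"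
      using params by (intro mult_nonneg_nonneg wint_nonneg continuous_intros z_cont) auto
    ultimately have "(T + 1) powr lam0 * E T \<le> B + lam0 * (K * C)"
      using B[OF T] by linarith
    then have "(T + 1) powr (- lam0) * ((T + 1) powr lam0 * E T) \<le> (T + 1) powr (- lam0) * (B + lam0 * (K * C))"
      by (intro mult_left_mono) auto
    moreover have "(T + 1) powr (- lam0) * (T + 1) powr lam0 = 1"
      using T by (simp flip: powr_add)
    ultimately show ?thesis
      by (simp only: mult.assoc[symmetric] mult_1_left) (simp only: mult.commute)
  qed
  then show "\<exists>C. \<forall>t\<ge>0. E t \<le> C * (t + 1) powr (- lam0)"
    by blast
qed

end

section \<open>Reduction to bounded operators\<close>

lemma integrable_halfline_of_bounded:
  fixes f :: "real \<Rightarrow> real"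
  assumes f: "continuous_on {0..} f" and f0: "\<And>t. 0 \<le> t \<Longrightarrow> 0 \<le> f t"
    and C: "\<And>T. 0 \<le> T \<Longrightarrow> integral {0..T} f \<le> C"
  shows "f absolutely_integrable_on {0..}" "integral {0..} f \<le> C"
proof -
  let ?F = "\<lambda>n t. if t \<in> {0..real n} then f t else 0"
  have fT: "f integrable_on {0..T}" for T
    by (intro integrable_continuous_interval continuous_on_subset[OF f]) auto
  have I: "integral {0..} (?F n) = integral {0..real n} f" for n
    by (subst integral_restrict_Int) (simp add: Int_absorb1)
  have *: "f integrable_on {0..} \<and> (\<lambda>n. integral {0..} (?F n)) \<longlonglongrightarrow> integral {0..} f"
  proof (rule monotone_convergence_increasing)
    show "?F n integrable_on {0..}" for n
      unfolding integrable_restrict_Int by (simp add: Int_absorb1 fT)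
    show "?F n t \<le> ?F (Suc n) t" if "t \<in> {0..}" for n t
      using f0[of t] that by auto
    show "(\<lambda>n. ?F n t) \<longlonglongrightarrow> f t" if t: "t \<in> {0..}" for t
    proof (rule tendsto_eventually)
      obtain n0 :: nat where "t \<le> real n0" using real_arch_simple by blast
      then show "\<forall>\<^sub>F n in sequentially. ?F n t = f t"
        using t by (auto simp: eventually_sequentially intro!: exI[of _ n0])
    qed
    have "\<bar>integral {0..real n} f\<bar> \<le> C" for n
    proof -
      have "0 \<le> integral {0..real n} f"
        by (rule integral_nonneg[OF fT]) (simp add: f0)
      with C[of "real n"] show ?thesis by simp
    qed
    then show "bounded (range (\<lambda>n. integral {0..} (?F n)))"
      unfolding I bounded_iff by (intro exI[of _ C]) auto
  qed
  then show "f absolutely_integrable_on {0..}"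
    by (intro nonnegative_absolutely_integrable_1) (auto intro: f0)
  show "integral {0..} f \<le> C"
  proof (rule LIMSEQ_le_const2)
    show "(\<lambda>n. integral {0..real n} f) \<longlonglongrightarrow> integral {0..} f"
      using * unfolding I by blast
  qed (use C in auto)
qed

lemma tail_integral:
  fixes p :: "real \<Rightarrow> real"
  assumes pc: "continuous_on {0..} p" and n: "0 \<le> n"
    and pi: "(\<lambda>t. (t + 1) powr n * p t) absolutely_integrable_on {0<..}" and t: "0 \<le> t"
  shows "((\<lambda>t. integral {t<..} p) has_real_derivative - p t) (at t within {0..})"
    "(t + 1) powr n * \<bar>integral {t<..} p\<bar> \<le> integral {0<..} (\<lambda>t. (t + 1) powr n * \<bar>p t\<bar>)"
proof -
  have p1: "p absolutely_integrable_on {0<..}"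
    by (rule absolutely_integrable_drop_weight[OF pi n])
  have pt: "p absolutely_integrable_on {t<..}" if "0 \<le> t" for t
    by (rule set_integrable_subset[OF p1]) (use that in auto)
  then have pti: "p integrable_on {t<..}" if "0 \<le> t" for t
    using that by (auto simp: absolutely_integrable_on_def)
  have pT: "p integrable_on {0..T}" for T
    by (intro integrable_continuous_interval continuous_on_subset[OF pc]) auto
  have eq: "integral {t<..} p = integral {0<..} p - integral {0..t} p" if t: "0 \<le> t" for t
  proof -
    have "(p has_integral (integral {0..t} p + integral {t<..} p)) ({0..t} \<union> {t<..})"
      by (intro has_integral_Un integrable_integral pT pti t) (auto simp: Int_def not_le intro: negligible_subset[of "{}"])
    moreover have "{0..t} \<union> {t<..} = {0..}" using t by auto
    ultimately have "integral {0..} p = integral {0..t} p + integral {t<..} p"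
      by (simp add: integral_unique)
    then show ?thesis
      using integrable_halfline_closed(2)[OF pti[of 0]] by simp
  qed
  have "((\<lambda>t. integral {0<..} p - integral {0..t} p) has_real_derivative 0 - p t) (at t within {0..})"
    by (intro DERIV_diff DERIV_const integral_has_real_derivative_within pc t)
  then have "((\<lambda>t. integral {t<..} p) has_real_derivative 0 - p t) (at t within {0..})"
  proof (rule has_field_derivative_transform_within[where d=1])
    show "integral {0<..} p - integral {0..s} p = integral {s<..} p" if "s \<in> {0..}" for s
      using that by (intro eq[symmetric]) simp
  qed (use t in auto)
  then show "((\<lambda>t. integral {t<..} p) has_real_derivative - p t) (at t within {0..})"
    by simp
  have q: "(\<lambda>t. (t + 1) powr n * \<bar>p t\<bar>) integrable_on {0<..}"
  by (rule weighted_abs_integrable[OF pi])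
  have pia: "(\<lambda>s. (s + 1) powr n * p s) absolutely_integrable_on {t<..}"
    by (rule set_integrable_subset[OF pi]) (use t in auto)
  have qt: "(\<lambda>s. (s + 1) powr n * \<bar>p s\<bar>) integrable_on {t<..}"
  by (rule weighted_abs_integrable[OF pia])
  have "norm (integral {t<..} (\<lambda>s. (t + 1) powr n * p s)) \<le> integral {t<..} (\<lambda>s. (s + 1) powr n * \<bar>p s\<bar>)"
  proof (rule integral_norm_bound_integral)
    show "(\<lambda>s. (t + 1) powr n * p s) integrable_on {t<..}"
      by (intro integrable_on_mult_right pti t)
    show "norm ((t + 1) powr n * p s) \<le> (s + 1) powr n * \<bar>p s\<bar>" if "s \<in> {t<..}" for s
      using that t n by (auto simp: abs_mult intro!: mult_right_mono powr_mono2)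
  qed (rule qt)
  also have "\<dots> \<le> integral {0<..} (\<lambda>s. (s + 1) powr n * \<bar>p s\<bar>)"
    by (rule integral_subset_le[OF _ qt q]) (use t in auto)
  finally show "(t + 1) powr n * \<bar>integral {t<..} p\<bar> \<le> integral {0<..} (\<lambda>t. (t + 1) powr n * \<bar>p t\<bar>)"
    by (simp add: abs_mult)
qed

text \<open>Passing to the tail costs one power of the weight. The tail \<Gamma> of
  \<open>\<bar>p\<bar>\<close> has derivative \<open>- \<bar>p t\<bar>\<close>, and partial
  integration bounds its integral with exponent \<open>n - 1\<close> by the moment of
  \<open>p\<close> plus an end point value, each at most \<open>K\<close>. The signed tail is
  majorized by \<Gamma>.\<close>

lemma tail_integral_weight:
  fixes p :: "real \<Rightarrow> real"
  assumes pc: "continuous_on {0..} p" and n: "1 \<le> n"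
    and pi: "(\<lambda>t. (t + 1) powr n * p t) absolutely_integrable_on {0<..}"
  shows "(\<lambda>t. (t + 1) powr (n - 1) * integral {t<..} p) absolutely_integrable_on {0<..}"
proof -
  define \<Gamma> where "\<Gamma> t = integral {t<..} (\<lambda>s. \<bar>p s\<bar>)" for t
  define K where "K = integral {0<..} (\<lambda>t. (t + 1) powr n * \<bar>p t\<bar>)"
  have n0: "0 \<le> n" using n by simp
  have ac: "continuous_on {0..} (\<lambda>t. \<bar>p t\<bar>)" by (intro continuous_intros pc)
  have ai: "(\<lambda>t. (t + 1) powr n * \<bar>p t\<bar>) absolutely_integrable_on {0<..}"
    using set_integrable_abs[OF pi] by (simp add: abs_mult)
  have \<Gamma>D: "(\<Gamma> has_real_derivative - \<bar>p t\<bar>) (at t within {0..})" if "0 \<le> t" for t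
    unfolding \<Gamma>_def by (rule tail_integral(1)[OF ac n0 ai that])
  have \<Gamma>K: "(t + 1) powr n * \<bar>\<Gamma> t\<bar> \<le> K" if "0 \<le> t" for t
    using tail_integral(2)[OF ac n0 ai that] by (simp add: \<Gamma>_def K_def)
  have a1: "(\<lambda>s. \<bar>p s\<bar>) integrable_on {t<..}" "p integrable_on {t<..}" if "0 \<le> t" for t
  proof -
    have "p absolutely_integrable_on {0<..}"
      by (rule absolutely_integrable_drop_weight[OF pi n0])
    then have "p absolutely_integrable_on {t<..}"
      by (rule set_integrable_subset) (use that in auto)
    then show "(\<lambda>s. \<bar>p s\<bar>) integrable_on {t<..}" "p integrable_on {t<..}"
      by (auto simp: absolutely_integrable_on_def)
  qed
  have \<Gamma>0: "0 \<le> \<Gamma> t" if "0 \<le> t" for t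
    unfolding \<Gamma>_def by (rule integral_nonneg[OF a1(1)[OF that]]) simp
  have \<Gamma>c: "continuous_on {0..} \<Gamma>"
    by (rule DERIV_continuous_on) (rule \<Gamma>D, simp)
  have bd: "wint (n - 1) \<Gamma> T \<le> 2 * K" if T: "0 \<le> T" for T
  proof -
    have "wint n (\<lambda>t. - \<bar>p t\<bar>) T = (T + 1) powr n * \<Gamma> T - \<Gamma> 0 - n * wint (n - 1) \<Gamma> T"
      using \<Gamma>D _ T by (rule wint_by_parts) (auto intro!: continuous_intros pc)
    moreover have "wint n (\<lambda>t. - \<bar>p t\<bar>) T = - wint n (\<lambda>t. \<bar>p t\<bar>) T"
      using wint_cmult[of n "-1" "\<lambda>t. \<bar>p t\<bar>" T] by simp
    moreover have "\<bar>wint n (\<lambda>t. \<bar>p t\<bar> * 1) T\<bar> \<le> 1 * integral {0<..} (\<lambda>t. (t + 1) powr n * \<bar>\<bar>p t\<bar>\<bar>)"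
      by (rule abs_wint_le[OF ac _ order_refl ai]) (auto intro: continuous_intros)
    then have "wint n (\<lambda>t. \<bar>p t\<bar>) T \<le> K"
      by (simp add: K_def)
    moreover have "(T + 1) powr n * \<Gamma> T \<le> K"
      using \<Gamma>K[OF T] \<Gamma>0[OF T] by simp
    ultimately have "n * wint (n - 1) \<Gamma> T \<le> 2 * K"
      using \<Gamma>0[of 0] by simp
    moreover have "0 \<le> wint (n - 1) \<Gamma> T"
      by (rule wint_nonneg[OF \<Gamma>c \<Gamma>0])
    then have "1 * wint (n - 1) \<Gamma> T \<le> n * wint (n - 1) \<Gamma> T"
      using n by (intro mult_right_mono)
    ultimately show ?thesis by simp
  qed
  have tc: "continuous_on {0..} (\<lambda>t. integral {t<..} p)"
    by (rule DERIV_continuous_on) (rule tail_integral(1)[OF pc n0 pi], simp)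
  have le: "\<bar>integral {t<..} p\<bar> \<le> \<Gamma> t" if "0 \<le> t" for t
    unfolding \<Gamma>_def using integral_norm_bound_integral[OF a1(2)[OF that] a1(1)[OF that]] by simp
  have "(\<lambda>t. \<bar>(t + 1) powr (n - 1) * integral {t<..} p\<bar>) absolutely_integrable_on {0..}"
  proof (rule integrable_halfline_of_bounded(1)[where C="2 * K"])
    show "continuous_on {0..} (\<lambda>t. \<bar>(t + 1) powr (n - 1) * integral {t<..} p\<bar>)"
      by (intro continuous_on_rabs continuous_on_mult continuous_on_weight tc)
    show "integral {0..T} (\<lambda>t. \<bar>(t + 1) powr (n - 1) * integral {t<..} p\<bar>) \<le> 2 * K" if T: "0 \<le> T" for T
    proof -
      have "wint (n - 1) (\<lambda>t. \<bar>integral {t<..} p\<bar>) T \<le> wint (n - 1) \<Gamma> T"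
        by (intro wint_mono \<Gamma>c le continuous_intros tc)
      with bd[OF T] show ?thesis
        by (simp add: wint_def abs_mult)
    qed
  qed simp
  then have "(\<lambda>t. \<bar>(t + 1) powr (n - 1) * integral {t<..} p\<bar>) absolutely_integrable_on {0<..}"
    by (rule set_integrable_subset) auto
  moreover have "(\<lambda>t. (t + 1) powr (n - 1) * integral {t<..} p) \<in> borel_measurable (lebesgue_on {0<..})"
    by (rule continuous_imp_measurable_on_sets_lebesgue)
      (auto intro!: continuous_on_mult continuous_on_subset[OF continuous_on_weight] continuous_on_subset[OF tc])
  ultimately show ?thesis
    by (intro measurable_bounded_by_integrable_imp_absolutely_integrable[where g="\<lambda>t. \<bar>(t + 1) powr (n - 1) * integral {t<..} p\<bar>"])
      (auto simp: absolutely_integrable_on_def)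
qed

lemma L2_loc_continuous:
  fixes w :: "real \<Rightarrow> 'a::real_normed_vector"
  assumes w: "continuous_on {0..} w"
  shows "L2_loc w"
  unfolding L2_loc_def
proof (intro conjI allI impI)
  \<comment> \<open>Continuous approximants on the whole line: the cutoff rises linearly from 0 at 0
    to 1 at \<open>1 / n\<close>, so at every point the sequence is eventually constant.\<close>
  have "(\<lambda>n. min 1 (max 0 (real n * x)) *\<^sub>R w (max 0 x)) \<longlonglongrightarrow> (if x \<in> {0<..} then w x else 0)" for x
  proof (rule tendsto_eventually)
    show "\<forall>\<^sub>F n in sequentially. min 1 (max 0 (real n * x)) *\<^sub>R w (max 0 x) = (if x \<in> {0<..} then w x else 0)"
    proof (cases "x > 0")
      case True
      obtain n0 :: nat where n0: "1 / x \<le> real n0" using real_arch_simple by blast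
      have "1 \<le> real n * x" if "n0 \<le> n" for n
      proof -
        have "1 / x \<le> real n" using n0 that by (simp add: order_trans)
        then show ?thesis using True by (simp add: field_simps)
      qed
      then show ?thesis
        using True by (auto simp: eventually_sequentially max_def intro!: exI[of _ n0])
    next
      case False
      then have "real n * x \<le> 0" for n by (simp add: mult_nonneg_nonpos)
      then show ?thesis using False by (simp add: max_absorb1)
    qed
  qed
  moreover have "continuous_on UNIV (\<lambda>x. min 1 (max 0 (real n * x)) *\<^sub>R w (max 0 x))" for n
    by (intro continuous_intros continuous_on_compose2[OF w]) auto
  ultimately show "w measurable_on {0<..}"
    unfolding measurable_on_def
    by (intro exI[of _ "{}"] exI[of _ "\<lambda>n x. min 1 (max 0 (real n * x)) *\<^sub>R w (max 0 x)"]) auto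
  fix T :: real
  have "(\<lambda>t. (norm (w t))\<^sup>2) absolutely_integrable_on {0..T}"
    by (intro absolutely_integrable_continuous_real continuous_intros continuous_on_subset[OF w]) auto
  then show "(\<lambda>t. (norm (w t))\<^sup>2) absolutely_integrable_on {0<..<T}"
    by (rule set_integrable_subset) auto
qed

section \<open>Graph-norm regularity and passage to bounded operators\<close>

lemma C0_graph_continuous:
  assumes A: "linear_oper A" and u: "C0_graph A u"
  shows "continuous_on {0..} (\<lambda>t. app A (u t))"
  unfolding continuous_on_def
proof
  fix t :: real assume t: "t \<in> {0..}"
  have D: "u s \<in> Dom A" if "0 \<le> s" for s
    using u that by (simp add: C0_graph_def)
  have lim: "((\<lambda>s. graph_norm A (u s - u t)) \<longlongrightarrow> 0) (at t within {0..})"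
    using u t by (simp add: C0_graph_def)
  have "((\<lambda>s. app A (u s) - app A (u t)) \<longlongrightarrow> 0) (at t within {0..})"
  proof (rule Lim_null_comparison[OF _ lim])
    show "\<forall>\<^sub>F s in at t within {0..}. norm (app A (u s) - app A (u t)) \<le> graph_norm A (u s - u t)"
      unfolding eventually_at
    proof (intro exI[of _ 1] conjI ballI impI)
      fix s :: real assume "s \<in> {0..}"
      then have "app A (u s - u t) = app A (u s) - app A (u t)"
        using t D by (intro linear_operD(7)[OF A]) auto
      then show "norm (app A (u s) - app A (u t)) \<le> graph_norm A (u s - u t)"
        by (simp add: graph_norm_def real_le_rsqrt)
    qed simp
  qed
  then show "((\<lambda>s. app A (u s)) \<longlongrightarrow> app A (u t)) (at t within {0..})"
    by (rule LIM_zero_cancel)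
qed

lemma C1_graph_derivative:
  assumes A: "linear_oper A" and u: "C1_graph A u u'" and t: "0 \<le> t"
  shows "((\<lambda>t. app A (u t)) has_vector_derivative app A (u' t)) (at t within {0..})"
  unfolding has_vector_derivative_def has_derivative_at_within
proof
  show "bounded_linear (\<lambda>x. x *\<^sub>R app A (u' t))" by (rule bounded_linear_scaleR_left)
  have D: "u s \<in> Dom A" "u' s \<in> Dom A" if "0 \<le> s" for s
    using u that by (auto simp: C1_graph_def C0_graph_def)
  have lim: "((\<lambda>s. graph_norm A ((u s - u t) /\<^sub>R (s - t) - u' t)) \<longlongrightarrow> 0) (at t within {0..})"
    using u t by (simp add: C1_graph_def)
  have "((\<lambda>s. ((app A (u s) - app A (u t)) - (s - t) *\<^sub>R app A (u' t)) /\<^sub>R norm (s - t)) \<longlongrightarrow> 0) (at t within {0..})"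
  proof (rule Lim_null_comparison[OF _ lim])
    show "\<forall>\<^sub>F s in at t within {0..}. norm (((app A (u s) - app A (u t)) - (s - t) *\<^sub>R app A (u' t)) /\<^sub>R norm (s - t))
        \<le> graph_norm A ((u s - u t) /\<^sub>R (s - t) - u' t)"
      unfolding eventually_at
    proof (intro exI[of _ 1] conjI ballI impI)
      fix s :: real assume s: "s \<in> {0..}" and st: "s \<noteq> t \<and> dist s t < 1"
      let ?q = "(u s - u t) /\<^sub>R (s - t) - u' t"
      have "app A ?q = (app A (u s) - app A (u t)) /\<^sub>R (s - t) - app A (u' t)"
        using s t D by (simp add: linear_operD(3,5,6,7)[OF A])
      then have "app A ?q = ((app A (u s) - app A (u t)) - (s - t) *\<^sub>R app A (u' t)) /\<^sub>R (s - t)"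
        using st by (simp add: scaleR_diff_right)
      then have "norm (((app A (u s) - app A (u t)) - (s - t) *\<^sub>R app A (u' t)) /\<^sub>R norm (s - t)) = norm (app A ?q)"
        by simp
      also have "\<dots> \<le> graph_norm A ?q"
        by (simp add: graph_norm_def real_le_rsqrt)
      finally show "norm (((app A (u s) - app A (u t)) - (s - t) *\<^sub>R app A (u' t)) /\<^sub>R norm (s - t)) \<le> graph_norm A ?q" .
    qed simp
  qed
  then show "((\<lambda>s. (app A (u s) - app A (u t) - (s - t) *\<^sub>R app A (u' t)) /\<^sub>R norm (s - t)) \<longlongrightarrow> 0) (at t within {0..})" .
qed

lemma dense_equal:
  fixes f h :: "'a::real_normed_vector \<Rightarrow> real"
  assumes D: "closure D = UNIV" and "continuous_on UNIV f" "continuous_on UNIV h"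
    and "\<And>x. x \<in> D \<Longrightarrow> f x = h x"
  shows "f x = h x"
proof -
  have "closed {x. f x = h x}"
    by (rule closed_Collect_eq[OF assms(2,3)])
  then have "closure D \<subseteq> {x. f x = h x}"
    using assms(4) by (intro closure_minimal) auto
  then show ?thesis using D by auto
qed

lemma dense_le:
  fixes f h :: "'a::real_normed_vector \<Rightarrow> real"
  assumes D: "closure D = UNIV" and "continuous_on UNIV f" "continuous_on UNIV h"
    and "\<And>x. x \<in> D \<Longrightarrow> f x \<le> h x"
  shows "f x \<le> h x"
proof -
  have "closed {x. f x \<le> h x}"
    by (rule closed_Collect_le[OF assms(2,3)])
  then have "closure D \<subseteq> {x. f x \<le> h x}"
    using assms(4) by (intro closure_minimal) auto
  then show ?thesis using D by auto
qed

lemma bounded_linear_relative: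
  assumes B: "linear_oper B" and Q: "bounded_linear Q" and QD: "\<And>x. Q x \<in> Dom B"
    and le: "\<And>x. norm (app B (Q x)) \<le> K * norm x"
  shows "bounded_linear (\<lambda>x. app B (Q x))"
proof (rule bounded_linear_intro)
  note lin = bounded_linear.linear[OF Q]
  show "app B (Q (x + y)) = app B (Q x) + app B (Q y)" for x y
    by (simp add: linear_add[OF lin] linear_operD(4)[OF B] QD)
  show "app B (Q (r *\<^sub>R x)) = r *\<^sub>R app B (Q x)" for r x
    by (simp add: linear_scale[OF lin] linear_operD(5)[OF B] QD)
  show "norm (app B (Q x)) \<le> norm x * K" for x
    using le[of x] by (simp add: mult.commute)
qed

text \<open>\<open>ac_derivative\<close> speaks only of positive times and leaves \<open>g 0\<close>
  arbitrary. Integrability of \<open>g'\<close> up to 0 yields the limit there, so that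
  \<open>h\<close> is the continuous representative of \<open>g\<close> on the closed half
  line.\<close>

lemma ac_continuous_extension:
  assumes ac: "ac_derivative g g'" and g': "g' absolutely_integrable_on {0<..}"
  obtains h where "\<And>t. 0 < t \<Longrightarrow> h t = g t" "\<And>t. 0 \<le> t \<Longrightarrow> h t = h 0 + integral {0..t} g'" "continuous_on {0..} h"
proof -
  have g'i: "g' integrable_on {0..T}" for T
  proof -
    have "g' absolutely_integrable_on {0<..<T}"
      by (rule set_integrable_subset[OF g']) auto
    then have "g' absolutely_integrable_on {0..T}"
      by (simp add: absolutely_integrable_on_Icc_iff_Ioo)
    then show ?thesis by (simp add: absolutely_integrable_on_def)
  qed
  define h where "h t = (g 1 - integral {0..1} g') + integral {0..t} g'" for t
  have comb: "integral {0..s} g' + integral {s..t} g' = integral {0..t} g'" if "0 \<le> s" "s \<le> t" for s t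
    by (rule Henstock_Kurzweil_Integration.integral_combine) (use that g'i in auto)
  have "h t = g t" if t: "0 < t" for t
  proof (cases "t \<le> 1")
    case True
    have "integral {t..1} g' = g 1 - g t"
      using ac t True unfolding ac_derivative_def by blast
    then show ?thesis
      using comb[of t 1] t True by (simp add: h_def)
  next
    case False
    have "integral {1..t} g' = g t - g 1"
      using ac False unfolding ac_derivative_def by (metis not_le zero_less_one less_imp_le)
    then show ?thesis
      using comb[of 1 t] False by (simp add: h_def)
  qed
  moreover have "h t = h 0 + integral {0..t} g'" for t
    by (simp add: h_def)
  moreover have "continuous_on {0..} h"
  proof (rule continuous_on_halfline)
    show "continuous_on {0..T} h" for T
      unfolding h_def by (intro continuous_intros indefinite_integral_continuous_1 g'i)
  qed
  ultimately show thesis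
    using that by blast
qed

theorem theorem3p1:
  fixes A1 A2 B1 B2 :: "'a::{real_inner,complete_space} oper"
    and a1 a2 \<beta> \<beta>1 \<alpha> lam0 :: real
    and g :: "real \<Rightarrow> real"
    and u0 u1 v0 v1 :: 'a
    and u u' u'' v v' v'' :: "real \<Rightarrow> 'a"
  assumes I1: "assumption_I1 A1 A2 a1 a2"
    and I2: "assumption_I2 A1 A2 B1 B2 \<beta> \<beta>1"
    and I3': "assumption_I3' TYPE('a) a1 \<beta>1 \<alpha> lam0 g"
    and I4: "assumption_I4 A1 A2 B1 B2"
    and u0: "u0 \<in> Dom A1" and v0: "v0 \<in> Dom A2"
    and u1: "u1 \<in> Dom (sqrt_oper A1)" and v1: "v1 \<in> Dom (sqrt_oper A2)"
    and sol: "classical_solution A1 A2 B1 B2 \<alpha> g u0 u1 v0 v1 u u' u'' v v' v''"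
  shows "\<exists>C>0.
     (\<forall>t\<ge>0. energy A1 A2 B1 \<alpha> g u u' v v' t \<le> C * (t + 1) powr (- lam0)) \<and>
     (\<lambda>t. (t + 1) powr (min lam0 (2 * (lam0 - 1))) * energy A1 A2 B1 \<alpha> g u u' v v' t)
       absolutely_integrable_on {0..} \<and>
     integral {0..} (\<lambda>t. (t + 1) powr (min lam0 (2 * (lam0 - 1))) *
                         energy A1 A2 B1 \<alpha> g u u' v v' t) \<le> C"
proof -
  define S1 S2 where "S1 = sqrt_oper A1" and "S2 = sqrt_oper A2"
  from I1 have A1: "self_adjoint A1" and A2: "self_adjoint A2" and a: "0 < a1" "0 < a2"
    and co1: "\<And>u. u \<in> Dom A1 \<Longrightarrow> (norm u)\<^sup>2 \<le> a1 * (app A1 u \<bullet> u)"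
    and co2: "\<And>u. u \<in> Dom A2 \<Longrightarrow> (norm u)\<^sup>2 \<le> a2 * (app A2 u \<bullet> u)"
    by (auto simp: assumption_I1_def)
  obtain Q1 where Q1: "bounded_linear Q1" "\<And>x y. Q1 x \<bullet> y = x \<bullet> Q1 y"
    "\<And>x. Q1 x \<in> Dom S1" "\<And>x. app S1 (Q1 x) = x" "\<And>x. x \<in> Dom S1 \<Longrightarrow> Q1 (app S1 x) = x"
    "\<And>x. (norm (Q1 x))\<^sup>2 \<le> a1 * (norm x)\<^sup>2" "\<And>x. Q1 (Q1 x) \<in> Dom A1" "\<And>x. app A1 (Q1 (Q1 x)) = x"
    "\<And>x. x \<in> Dom A1 \<Longrightarrow> Q1 (app A1 x) = app S1 x" "\<And>x. x \<in> Dom A1 \<Longrightarrow> x \<in> Dom S1" "closure (Dom S1) = UNIV"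
    by (rule coercive_sqrt_oper_inverse[OF A1 a(1), folded S1_def], erule co1, rule that)
  obtain Q2 where Q2: "bounded_linear Q2" "\<And>x y. Q2 x \<bullet> y = x \<bullet> Q2 y"
    "\<And>x. Q2 x \<in> Dom S2" "\<And>x. app S2 (Q2 x) = x" "\<And>x. x \<in> Dom S2 \<Longrightarrow> Q2 (app S2 x) = x"
    "\<And>x. (norm (Q2 x))\<^sup>2 \<le> a2 * (norm x)\<^sup>2" "\<And>x. Q2 (Q2 x) \<in> Dom A2" "\<And>x. app A2 (Q2 (Q2 x)) = x"
    "\<And>x. x \<in> Dom A2 \<Longrightarrow> Q2 (app A2 x) = app S2 x" "\<And>x. x \<in> Dom A2 \<Longrightarrow> x \<in> Dom S2" "closure (Dom S2) = UNIV"
    by (rule coercive_sqrt_oper_inverse[OF A2 a(2), folded S2_def], erule co2, rule that)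
  have lS: "linear_oper S1" "linear_oper S2"
    using coercive_sqrt_oper[OF A1 a(1) co1] coercive_sqrt_oper[OF A2 a(2) co2]
    by (auto simp: S1_def S2_def is_sqrt_oper_def self_adjoint_def)
  from I2 have B: "linear_oper B1" "linear_oper B2" and BD: "Dom S1 \<subseteq> Dom B1" "Dom S2 \<subseteq> Dom B2"
    and adj: "\<And>u v. u \<in> Dom A1 \<Longrightarrow> v \<in> Dom A2 \<Longrightarrow> app B1 u \<bullet> v = u \<bullet> app B2 v"
    and \<beta>: "0 < \<beta>" "0 < \<beta>1"
    and B1_le: "\<And>w. w \<in> Dom S1 \<Longrightarrow> norm (app B1 w) \<le> \<beta>1 * norm (app S1 w)"
    and B2_le: "\<And>w. w \<in> Dom S2 \<Longrightarrow> norm (app B2 w) \<le> \<beta>1 * norm (app S2 w)"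
    and B2_ge: "\<And>w. w \<in> Dom S2 \<Longrightarrow> \<beta> * norm (app S2 w) \<le> norm (app B2 w)"
    by (auto simp: assumption_I2_def S1_def S2_def)
  define C1 C2 where "C1 = (\<lambda>x. app B1 (Q1 x))" and "C2 = (\<lambda>x. app B2 (Q2 x))"
  have C1_le: "norm (C1 x) \<le> \<beta>1 * norm x" and C2_le: "norm (C2 x) \<le> \<beta>1 * norm x"
    and C2_ge: "\<beta> * norm x \<le> norm (C2 x)" for x
    using B1_le[OF Q1(3)[of x]] B2_le[OF Q2(3)[of x]] B2_ge[OF Q2(3)[of x]] by (simp_all add: C1_def C2_def Q1(4) Q2(4))
  have C1: "bounded_linear C1" unfolding C1_def
    by (rule bounded_linear_relative[OF B(1) Q1(1), of \<beta>1]) (use Q1(3) BD C1_le in \<open>auto simp: C1_def\<close>)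
  have C2: "bounded_linear C2" unfolding C2_def
    by (rule bounded_linear_relative[OF B(2) Q2(1), of \<beta>1]) (use Q2(3) BD C2_le in \<open>auto simp: C2_def\<close>)
  note bl_cont = Q1(1)[THEN bounded_linear.continuous_on] Q2(1)[THEN bounded_linear.continuous_on]
    C1[THEN bounded_linear.continuous_on] C2[THEN bounded_linear.continuous_on]
  have C1_S: "C1 (app S1 x) = app B1 x" if "x \<in> Dom S1" for x
    by (simp add: C1_def Q1(5)[OF that])
  have C2_S: "C2 (app S2 x) = app B2 x" if "x \<in> Dom S2" for x
    by (simp add: C2_def Q2(5)[OF that])
  \<comment> \<open>\<open>adj\<close> is available on \<open>Dom A1\<close> and
    \<open>Dom A2\<close> only. As \<open>Q1\<close> and \<open>Q2\<close> map the domains of the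
    roots there, the identity holds on dense sets and extends by continuity, one argument at a
    time.\<close>
  have cross: "C1 x \<bullet> Q2 y = Q1 x \<bullet> C2 y" for x y
  proof (rule dense_equal[OF Q2(11), where f="\<lambda>y. C1 x \<bullet> Q2 y" and h="\<lambda>y. Q1 x \<bullet> C2 y"])
    fix y assume y: "y \<in> Dom S2"
    show "C1 x \<bullet> Q2 y = Q1 x \<bullet> C2 y"
    proof (rule dense_equal[OF Q1(11), where f="\<lambda>x. C1 x \<bullet> Q2 y" and h="\<lambda>x. Q1 x \<bullet> C2 y"])
      fix x assume x: "x \<in> Dom S1"
      have "Q1 x \<in> Dom A1" "Q2 y \<in> Dom A2"
        using Q1(7)[of "app S1 x"] Q2(7)[of "app S2 y"] by (simp_all add: Q1(5)[OF x] Q2(5)[OF y])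
      then show "C1 x \<bullet> Q2 y = Q1 x \<bullet> C2 y"
        unfolding C1_def C2_def by (rule adj)
    qed (intro continuous_intros bl_cont)+
  qed (intro continuous_intros bl_cont)+
  obtain P :: "'a \<Rightarrow> real" and L1 L2 :: "'a \<Rightarrow> 'a" and D1 D2
    where P0': "\<forall>x \<in> app B1 ` Dom A1 \<union> app B2 ` Dom A2. 0 \<le> P x"
    and L: "bounded_linear L1" "bounded_linear L2" and D: "0 < D1" "0 < D2"
    and comm': "\<forall>u\<in>Dom A1. \<forall>v\<in>Dom A2. \<bar>app A1 u \<bullet> app B2 v - app B1 u \<bullet> app A2 v\<bar>
             \<le> D1 * (norm (app B1 u) * norm (app B2 v) + P (app B1 u) * P (app B2 v))"
    and P1': "\<forall>w\<in>Dom A1. (P (app B1 w))\<^sup>2 \<le> app A1 w \<bullet> L1 (app B1 w) + D2 * (norm (app B1 w))\<^sup>2 \<and>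
           w \<bullet> L1 (app B1 w) \<le> D2 * (norm w)\<^sup>2"
    and P2': "\<forall>w\<in>Dom A2. (P (app B2 w))\<^sup>2 \<le> app A2 w \<bullet> L2 (app B2 w) + D2 * (norm (app B2 w))\<^sup>2 \<and>
           w \<bullet> L2 (app B2 w) \<le> D2 * (norm w)\<^sup>2"
    using I4 unfolding assumption_I4_def by (elim exE conjE) (rule that)
  note P0 = bspec[OF P0'] and comm = bspec[OF bspec[OF comm']] and P1 = bspec[OF P1', THEN conjunct1]
    and LL1 = bspec[OF P1', THEN conjunct2] and P2 = bspec[OF P2', THEN conjunct1] and LL2 = bspec[OF P2', THEN conjunct2]
  note L_cont = L[THEN bounded_linear.continuous_on]
  have L1_le: "Q1 x \<bullet> L1 (C1 x) \<le> D2 * (norm (Q1 x))\<^sup>2" for x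
  proof (rule dense_le[OF Q1(11), where f="\<lambda>x. Q1 x \<bullet> L1 (C1 x)" and h="\<lambda>x. D2 * (norm (Q1 x))\<^sup>2"])
    fix x assume x: "x \<in> Dom S1"
    have "Q1 x \<in> Dom A1" using Q1(7)[of "app S1 x"] by (simp add: Q1(5)[OF x])
    then show "Q1 x \<bullet> L1 (C1 x) \<le> D2 * (norm (Q1 x))\<^sup>2"
      unfolding C1_def by (rule LL1)
  qed (intro continuous_intros bl_cont L_cont)+
  have L2_le: "Q2 x \<bullet> L2 (C2 x) \<le> D2 * (norm (Q2 x))\<^sup>2" for x
  proof (rule dense_le[OF Q2(11), where f="\<lambda>x. Q2 x \<bullet> L2 (C2 x)" and h="\<lambda>x. D2 * (norm (Q2 x))\<^sup>2"])
    fix x assume x: "x \<in> Dom S2"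
    have "Q2 x \<in> Dom A2" using Q2(7)[of "app S2 x"] by (simp add: Q2(5)[OF x])
    then show "Q2 x \<bullet> L2 (C2 x) \<le> D2 * (norm (Q2 x))\<^sup>2"
      unfolding C2_def by (rule LL2)
  qed (intro continuous_intros bl_cont L_cont)+
  from I3' obtain g' where \<alpha>: "0 \<le> \<alpha>" and lam0: "1 \<le> lam0" and k1: "integral {0<..} g < 1"
    and gap: "integral {0<..} g + a1 * (\<beta>1\<^sup>2 - \<alpha>) < 1"
    and gw: "(\<lambda>t. (t + 1) powr lam0 * g t) absolutely_integrable_on {0<..}"
    and ac: "ac_derivative g g'" and g'w: "(\<lambda>t. (t + 1) powr lam0 * g' t) absolutely_integrable_on {0<..}"
    and spd: "strongly_pd_kernel TYPE('a) (\<lambda>t. (t + 1) powr lam0) (\<lambda>t. integral {t<..} g)"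
    by (auto simp: assumption_I3'_def)
  have lam00: "0 \<le> lam0" using lam0 by simp
  have g'1: "g' absolutely_integrable_on {0<..}"
    by (rule absolutely_integrable_drop_weight[OF g'w lam00])
  \<comment> \<open>\<open>h\<close> serves as kernel from here on; the value of \<open>g\<close> at
    0 affects neither tail integrals nor convolutions.\<close>
  obtain h where hg: "\<And>t. 0 < t \<Longrightarrow> h t = g t" and h_ac: "\<And>t. 0 \<le> t \<Longrightarrow> h t = h 0 + integral {0..t} g'"
    and hc: "continuous_on {0..} h"
    by (rule ac_continuous_extension[OF ac g'1]) (rule that)
  have hw: "(\<lambda>t. (t + 1) powr lam0 * h t) absolutely_integrable_on {0<..}"
    using gw by (rule set_integrable_cong[OF refl refl, THEN iffD1, rotated]) (auto simp: hg)
  define G where "G t = integral {t<..} g" for t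
  have Gh: "G t = integral {t<..} h" if "0 \<le> t" for t
    unfolding G_def by (rule integral_cong) (use that hg in auto)
  note tail = tail_integral[OF hc lam00 hw]
  have G_deriv: "(G has_real_derivative - h t) (at t within {0..})" if t: "0 \<le> t" for t
    by (rule has_field_derivative_transform_within[OF tail(1)[OF t], where d=1]) (use t Gh in auto)
  have G_le: "(t + 1) powr lam0 * \<bar>G t\<bar> \<le> integral {0<..} (\<lambda>t. (t + 1) powr lam0 * \<bar>h t\<bar>)" if "0 \<le> t" for t
    using tail(2)[OF that] by (simp add: Gh that)
  have G_int: "(\<lambda>t. (t + 1) powr (lam0 - 1) * G t) absolutely_integrable_on {0<..}"
    using tail_integral_weight[OF hc lam0 hw]
    by (rule set_integrable_cong[OF refl refl, THEN iffD1, rotated]) (auto simp: Gh)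
  from sol have C2u: "C2_half_line u u' u''" and C1u: "C1_graph S1 u u'" and C0u: "C0_graph A1 u"
    and C2v: "C2_half_line v v' v''" and C1v: "C1_graph S2 v v'" and C0v: "C0_graph A2 v"
    and e1: "\<And>t. 0 \<le> t \<Longrightarrow> u'' t + app A1 (u t) - convol g (\<lambda>s. app A1 (u s)) t + \<alpha> *\<^sub>R u t + app B2 (v t) = 0"
    and e2: "\<And>t. 0 \<le> t \<Longrightarrow> v'' t + app A2 (v t) + app B1 (u t) = 0"
    by (auto simp: classical_solution_def S1_def S2_def)
  define U W V V1 where "U t = app S1 (u t)" and "W t = app S1 (u' t)" and "V t = app S2 (v t)"
    and "V1 t = app S2 (v' t)" for t
  have uD: "u t \<in> Dom A1" "v t \<in> Dom A2" "u t \<in> Dom S1" "v t \<in> Dom S2" "u' t \<in> Dom S1" "v' t \<in> Dom S2" if "0 \<le> t" for t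
    using C0u C0v C1u C1v that by (auto simp: C0_graph_def C1_graph_def)
  have Wc: "continuous_on {0..} W" and V1c: "continuous_on {0..} V1"
    unfolding W_def V1_def using C1u C1v
    by (auto intro!: C0_graph_continuous lS simp: C1_graph_def)
  have UD: "(U has_vector_derivative W t) (at t within {0..})" and VD: "(V has_vector_derivative V1 t) (at t within {0..})"
    if "0 \<le> t" for t
    unfolding U_def W_def V_def V1_def
    using C1_graph_derivative[OF lS(1) C1u that] C1_graph_derivative[OF lS(2) C1v that] by auto
  have Uc: "continuous_on {0..} U"
    using UD by (meson atLeast_iff continuous_on_vector_derivative)
  have A1c: "continuous_on {0..} (\<lambda>s. app A1 (u s))"
    by (rule C0_graph_continuous[OF self_adjointD(1)[OF A1] C0u])
  have QU: "Q1 (U t) = u t" "Q1 (W t) = u' t" "Q2 (V t) = v t" "Q2 (V1 t) = v' t" if "0 \<le> t" for t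
    using uD[OF that] by (simp_all add: U_def W_def V_def V1_def Q1(5) Q2(5))
  have CU: "C1 (U t) = app B1 (u t)" "C2 (V t) = app B2 (v t)" if "0 \<le> t" for t
    using uD[OF that] by (simp_all add: U_def V_def C1_S C2_S)
  have conv: "convol g (\<lambda>s. app A1 (u s)) t = convol h (\<lambda>s. app A1 (u s)) t" for t
    unfolding convol_def
    by (rule integral_spike[of "{t}"]) (auto simp: hg)
  have Qconv: "Q1 (convol h (\<lambda>s. app A1 (u s)) t) = convol h U t" if "0 \<le> t" for t
  proof -
    have "Q1 (convol h (\<lambda>s. app A1 (u s)) t) = convol h (\<lambda>s. Q1 (app A1 (u s))) t"
      by (rule convol_bounded_linear[OF Q1(1) hc A1c])
    also have "\<dots> = convol h U t"
      unfolding convol_def by (rule integral_cong) (simp add: Q1(9) uD U_def)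
    finally show ?thesis .
  qed
  \<comment> \<open>This is \<open>A1\<close> applied to u - g*u, written with \<open>A1\<close>
    inside the convolution so that membership of g*u in \<open>Dom A1\<close> is not
    presupposed.\<close>
  define y where "y t = app A1 (u t) - convol h (\<lambda>s. app A1 (u s)) t" for t
  have y: "u'' t + \<alpha> *\<^sub>R u t + C2 (V t) = - y t" if "0 \<le> t" for t
    using e1[OF that] unfolding y_def conv by (simp add: CU that algebra_simps add_eq_0_iff)
  have Qy: "Q1 (y t) = U t - convol h U t" if "0 \<le> t" for t
    unfolding y_def
    by (simp add: linear_diff[OF bounded_linear.linear[OF Q1(1)]] Q1(9) uD that Qconv U_def)
  have yv: "v'' t + C1 (U t) = - app A2 (v t)" if "0 \<le> t" for t
    using e2[OF that] by (simp add: CU that eq_neg_iff_add_eq_0 add_ac)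
  obtain \<delta> N where \<delta>: "0 < \<delta>" "0 < N" and pdk: "pd_kernel TYPE('a) (\<lambda>t. (t + 1) powr lam0) (\<lambda>t. G t - \<delta> * exp (- N * t))"
    using spd unfolding strongly_pd_kernel_def G_def by blast
  have "damped_system lam0 \<alpha> (integral {0<..} g) a1 a2 \<beta> \<beta>1 D1 D2 \<delta> N
    (integral {0<..} (\<lambda>t. (t + 1) powr lam0 * \<bar>h t\<bar>)) h g' G u u' u'' v v' v'' U W V V1 Q1 Q2 C1 C2 L1 L2"
  proof (rule damped_system.intro)
    show "0 \<le> integral {0..T} (\<lambda>t. (t + 1) powr lam0 * (convol (\<lambda>t. G t - \<delta> * exp (- N * t)) W t \<bullet> W t))" if "0 \<le> T" for T
      using pdk L2_loc_continuous[OF Wc] that unfolding pd_kernel_def by blast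
    show "G 0 = integral {0<..} g" by (simp add: G_def)
    show "(u has_vector_derivative u' t) (at t within {0..})" "(u' has_vector_derivative u'' t) (at t within {0..})"
      "(v has_vector_derivative v' t) (at t within {0..})" "(v' has_vector_derivative v'' t) (at t within {0..})" if "0 \<le> t" for t
      using C2u C2v that by (auto simp: C2_half_line_def)
    show "continuous_on {0..} u''" "continuous_on {0..} v''"
      using C2u C2v by (auto simp: C2_half_line_def)
    fix t :: real and x :: 'a assume t: "0 \<le> t"
    have "(u'' t + \<alpha> *\<^sub>R u t + C2 (V t)) \<bullet> Q1 x = - (Q1 (y t) \<bullet> x)"
      by (simp add: y t Q1(2))
    then show "u'' t \<bullet> Q1 x + (U t - convol h U t) \<bullet> x + \<alpha> * (u t \<bullet> Q1 x) + C2 (V t) \<bullet> Q1 x = 0"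
      by (simp add: Qy t inner_add_left)
    have "Q2 (app A2 (v t)) = V t"
      by (simp add: Q2(9) uD t V_def)
    moreover have "(v'' t + C1 (U t)) \<bullet> Q2 x = - (Q2 (app A2 (v t)) \<bullet> x)"
      by (simp add: yv t Q2(2))
    ultimately show "v'' t \<bullet> Q2 x + V t \<bullet> x + C1 (U t) \<bullet> Q2 x = 0"
      by (simp add: inner_add_left)
  next
    fix t :: real assume t: "0 \<le> t"
    \<comment> \<open>The function u - g*u at time \<open>t\<close>, recovered by applying the
      inverse of \<open>A1\<close> to \<open>y t\<close> and hence in \<open>Dom A1\<close>.\<close>
    define w where "w = Q1 (Q1 (y t))"
    have w: "w \<in> Dom A1" "app A1 w = y t" "app B1 w = C1 (U t - convol h U t)"
      unfolding w_def C1_def Qy[OF t, symmetric] by (rule Q1(7) Q1(8) refl)+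
    note vD = uD(2)[OF t]
    show "\<exists>p1\<ge>0. \<exists>p2\<ge>0.
      \<bar>(u'' t + \<alpha> *\<^sub>R u t + C2 (V t)) \<bullet> C2 (V t) - C1 (U t - convol h U t) \<bullet> (v'' t + C1 (U t))\<bar>
        \<le> D1 * (norm (C1 (U t - convol h U t)) * norm (C2 (V t)) + p1 * p2) \<and>
      p1\<^sup>2 \<le> - ((u'' t + \<alpha> *\<^sub>R u t + C2 (V t)) \<bullet> L1 (C1 (U t - convol h U t)))
        + D2 * (norm (C1 (U t - convol h U t)))\<^sup>2 \<and>
      p2\<^sup>2 \<le> - ((v'' t + C1 (U t)) \<bullet> L2 (C2 (V t))) + D2 * (norm (C2 (V t)))\<^sup>2"
    proof (rule exI[of _ "P (app B1 w)"], intro conjI exI[of _ "P (app B2 (v t))"])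
      show "0 \<le> P (app B1 w)" "0 \<le> P (app B2 (v t))"
        using w(1) vD by (auto intro!: P0)
      have "\<bar>y t \<bullet> app B2 (v t) - app B1 w \<bullet> app A2 (v t)\<bar>
          \<le> D1 * (norm (app B1 w) * norm (app B2 (v t)) + P (app B1 w) * P (app B2 (v t)))"
        using comm[OF w(1) vD] by (simp add: w(2))
      then show "\<bar>(u'' t + \<alpha> *\<^sub>R u t + C2 (V t)) \<bullet> C2 (V t) - C1 (U t - convol h U t) \<bullet> (v'' t + C1 (U t))\<bar>
        \<le> D1 * (norm (C1 (U t - convol h U t)) * norm (C2 (V t)) + P (app B1 w) * P (app B2 (v t)))"
        unfolding y[OF t] yv[OF t] unfolding w(3)[symmetric] CU(2)[OF t] by (simp add: abs_minus_commute)
      show "(P (app B1 w))\<^sup>2 \<le> - ((u'' t + \<alpha> *\<^sub>R u t + C2 (V t)) \<bullet> L1 (C1 (U t - convol h U t)))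
        + D2 * (norm (C1 (U t - convol h U t)))\<^sup>2"
        unfolding y[OF t] w(3)[symmetric] using P1[OF w(1)] by (simp add: w(2))
      show "(P (app B2 (v t)))\<^sup>2 \<le> - ((v'' t + C1 (U t)) \<bullet> L2 (C2 (V t))) + D2 * (norm (C2 (V t)))\<^sup>2"
        unfolding yv[OF t] CU(2)[OF t] using P2[OF vD] by simp
    qed
  qed (rule lam0 hc h_ac hw g'w G_deriv G_le G_int \<delta> k1 \<alpha> a \<beta> D gap Q1(1,6) Q2(1,2,6) C1 C2 L C1_le C2_le C2_ge
      cross L1_le L2_le UD VD Wc V1c QU[symmetric] | assumption)+
  then interpret damped_system lam0 \<alpha> "integral {0<..} g" a1 a2 \<beta> \<beta>1 D1 D2 \<delta> N
    "integral {0<..} (\<lambda>t. (t + 1) powr lam0 * \<bar>h t\<bar>)" h g' G u u' u'' v v' v'' U W V V1 Q1 Q2 C1 C2 L1 L2 .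
  define \<E> where "\<E> = energy A1 A2 B1 \<alpha> g u u' v v'"
  have EE: "\<E> t = E t" if "0 \<le> t" for t
    unfolding \<E>_def energy_def E_def by (simp add: CU that flip: S1_def S2_def U_def V_def)
  define \<mu> where "\<mu> = min lam0 (2 * (lam0 - 1))"
  obtain K where K: "\<And>t. 0 \<le> t \<Longrightarrow> E t \<le> K * (t + 1) powr (- lam0)"
    using decay(1) by blast
  obtain M where M: "\<And>T. 0 \<le> T \<Longrightarrow> wint \<mu> E T \<le> M"
    using decay(2) unfolding \<mu>_def by blast
  \<comment> \<open>The 1 makes the common constant positive whatever the signs of \<open>K\<close>
    and \<open>M\<close>.\<close>
  define C where "C = max 1 (max K M)"
  have bound: "integral {0..T} (\<lambda>t. (t + 1) powr \<mu> * \<E> t) \<le> C" if "0 \<le> T" for T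
  proof -
    have "integral {0..T} (\<lambda>t. (t + 1) powr \<mu> * \<E> t) = wint \<mu> E T"
      unfolding wint_def by (rule integral_cong) (simp add: EE)
    with M[OF that] show ?thesis by (simp add: C_def)
  qed
  have cont\<E>: "continuous_on {0..} (\<lambda>t. (t + 1) powr \<mu> * \<E> t)"
    by (rule continuous_on_eq[OF continuous_on_mult[OF continuous_on_weight[of \<mu>] E_cont]]) (simp add: EE)
  note I = integrable_halfline_of_bounded[OF cont\<E> _ bound]
  have nonneg: "0 \<le> (t + 1) powr \<mu> * \<E> t" if "0 \<le> t" for t
    using decay(3)[OF that] by (simp add: EE that)
  have "\<E> t \<le> C * (t + 1) powr (- lam0)" if t: "0 \<le> t" for t
  proof -
    have "K * (t + 1) powr (- lam0) \<le> C * (t + 1) powr (- lam0)"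
      by (intro mult_right_mono) (auto simp: C_def)
    with K[OF t] show ?thesis by (simp add: EE t)
  qed
  moreover have "0 < C" by (simp add: C_def)
  ultimately show ?thesis
    using I(1)[OF nonneg] I(2)[OF nonneg] unfolding \<E>_def \<mu>_def by (intro exI[of _ C] conjI allI impI) auto
qed

end
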